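(* Let $d\ge1$ and $\lambda_1=\dots=\lambda_d=1$, and let $\chi=(2\pi)^{-d/2}\big(\prod_{j=1}^{d-1}j!\big)^{-1}$. Uniformly over $x,z\in\mathrm{int}(W^d)$ (for the first relation) and $x,z\in W^d$ (for the second relation) with $x_d-x_1=o(\sqrt n)$, $x_1=o(\sqrt n)$, $z_d-z_1=o(\sqrt n)$ and $z_1=O(\sqrt n)$, as $n\to\infty$, $$\widetilde G_n(x,n+z)\sim\chi\,\Delta(x)\Delta(z)\,n^{-d^2/2}\,e^{-\frac1{2n}\sum_{j=1}^dz_j^2},$$ $$G_n(x,n+z)\sim\chi\,h(x)\hat h(z)\,n^{-d^2/2}\,e^{-\frac1{2n}\sum_{j=1}^dz_j^2}.$$
   Context: Let $W^d=\{x\in\mathbb{R}^d:x_1\le\dots\le x_d\}$, $\mathrm{int}(W^d)$ its interior, $\Delta(x)=\prod_{1\le i<j\le d}(x_j-x_i)$. Let $(X_{ij})$ be i.i.d. exponential random variables of rate $1$ and $S_j(n)=x_j+\sum_{i=1}^nX_{ij}$, $S(0)=x$, with law $\mathbb{P}_x$. Write $a\prec b$ if $a_1\le b_1\le a_2\le b_2\le\dots\le a_d\le b_d$. Let $\tau=\inf\{n\ge1:S(n)\notin W^d\}$, $\rho=\inf\{n\ge1:S(n-1)\nprec S(n)\}$. The transition densities are $$G_n(x,z)\,dz=\mathbb{P}_x(S(n)\in dz,\tau>n),\qquad \widetilde G_n(x,z)\,dz=\mathbb{P}_x(S(n)\in dz,\rho>n),$$ with versions $\widetilde G_n(x,z)=\det(f_n(z_j-x_i))_{i,j=1}^d$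 and $G_n(x,z)=\det(f_{n+i-j}(z_j-x_i))_{i,j=1}^d$, where $f_r(u)=\frac{u^{r-1}}{(r-1)!}e^{-u}1_{\{u>0\}}$ for $r\ge1$ (the determinant formula for $G_n$ is used for $n\ge d$). Here $n+z$ denotes $(n+z_1,\dots,n+z_d)$. Let $h(x)=\mathbb{E}[\Delta(x_1+\eta_1,\dots,x_d+\eta_d)]$ with $\eta_1=0$ and $\eta_j\sim\mathrm{Gamma}(j-1,1)$, $2\le j\le d$, independent; $\hat h(z)=h(-z_d,\dots,-z_1)$. The uniform asymptotics mean: for every sequence $\delta_n\to0$, $\delta_n>0$, and every $M<\infty$, the ratio of the two sides tends to $1$ uniformly over $x,z$ in the indicated set with $x_d-x_1\le\delta_n\sqrt n$, $|x_1|\le\delta_n\sqrt n$, $z_d-z_1\le\delta_n\sqrt n$, $|z_1|\le M\sqrt n$. *)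

theory Defs
  imports "HOL-Probability.Probability" "Jordan_Normal_Form.Determinant"
begin

text \<open>
  Points of \<open>\<real>\<^sup>d\<close> are the functions in \<open>{1..d} \<rightarrow>\<^sub>E UNIV\<close>, so that \<open>\<real>\<^sup>d\<close> with its Borel sets and
  Lebesgue measure is the product space below, and coordinates carry the indices \<open>1, \<dots>, d\<close>.
\<close>

definition leb :: "nat \<Rightarrow> (nat \<Rightarrow> real) measure" where
  "leb d = (\<Pi>\<^sub>M j\<in>{1..d}. lborel)"

definition weyl :: "nat \<Rightarrow> (nat \<Rightarrow> real) set" where
  "weyl d = {x \<in> {1..d} \<rightarrow>\<^sub>E UNIV. \<forall>j\<in>{1..<d}. x j \<le> x (Suc j)}"

text \<open>
  The interior is taken in the space \<open>\<real>\<^sup>d\<close>; as a set of functions on all of \<open>nat\<close>, the chamber has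
  empty interior.
\<close>

definition int_weyl :: "nat \<Rightarrow> (nat \<Rightarrow> real) set" where
  "int_weyl d = product_topology (\<lambda>_. euclideanreal) {1..d} interior_of weyl d"

definition vandermonde :: "nat \<Rightarrow> (nat \<Rightarrow> real) \<Rightarrow> real" where
  "vandermonde d x = (\<Prod>(i, j)\<in>{(i, j). 1 \<le> i \<and> i < j \<and> j \<le> d}. x j - x i)"

definition interlaces :: "nat \<Rightarrow> (nat \<Rightarrow> real) \<Rightarrow> (nat \<Rightarrow> real) \<Rightarrow> bool" where
  "interlaces d a b \<longleftrightarrow> (\<forall>j\<in>{1..d}. a j \<le> b j) \<and> (\<forall>j\<in>{1..<d}. b j \<le> a (Suc j))"

definition walk ::
  "nat \<Rightarrow> (nat \<Rightarrow> nat \<Rightarrow> 'w \<Rightarrow> real) \<Rightarrow> (nat \<Rightarrow> real) \<Rightarrow> nat \<Rightarrow> 'w \<Rightarrow> (nat \<Rightarrow> real)" where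
  "walk d X x n \<omega> = (\<lambda>j\<in>{1..d}. x j + (\<Sum>i=1..n. X i j \<omega>))"

definition exit_time :: "nat \<Rightarrow> (nat \<Rightarrow> 'w \<Rightarrow> (nat \<Rightarrow> real)) \<Rightarrow> 'w \<Rightarrow> enat" where
  "exit_time d S \<omega> = (INF n\<in>{n. 1 \<le> n \<and> S n \<omega> \<notin> weyl d}. enat n)"

definition noninterlacing_time :: "nat \<Rightarrow> (nat \<Rightarrow> 'w \<Rightarrow> (nat \<Rightarrow> real)) \<Rightarrow> 'w \<Rightarrow> enat" where
  "noninterlacing_time d S \<omega> =
     (INF n\<in>{n. 1 \<le> n \<and> \<not> interlaces d (S (n - 1) \<omega>) (S n \<omega>)}. enat n)"

text \<open>\<open>g\<close> is a version of the density of the sub-probability law \<open>P(S(n) \<in> dz, T > n)\<close>.\<close>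

definition killed_density ::
  "nat \<Rightarrow> 'w measure \<Rightarrow> (nat \<Rightarrow> 'w \<Rightarrow> (nat \<Rightarrow> real)) \<Rightarrow> ('w \<Rightarrow> enat) \<Rightarrow> nat
     \<Rightarrow> ((nat \<Rightarrow> real) \<Rightarrow> real) \<Rightarrow> bool" where
  "killed_density d P S T n g \<longleftrightarrow>
     g \<in> borel_measurable (leb d) \<and> (AE z in leb d. 0 \<le> g z) \<and>
     (\<forall>A\<in>sets (leb d).
        emeasure P {\<omega> \<in> space P. S n \<omega> \<in> A \<and> enat n < T \<omega>} =
        (\<integral>\<^sup>+z\<in>A. ennreal (g z) \<partial>leb d))"

text \<open>
  Gamma densities; used for \<open>r \<ge> 1\<close> only. They differ from \<^const>\<open>erlang_density\<close> (with shape
  parameter shifted by one) at the origin when \<open>r = 1\<close>.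
\<close>

definition gam :: "nat \<Rightarrow> real \<Rightarrow> real" where
  "gam r u = (if u > 0 then u ^ (r - 1) / fact (r - 1) * exp (- u) else 0)"

text \<open>
  Matrix entries are numbered from 0, hence the shifts; the difference of row and column index is
  not affected. In the second determinant \<open>n + i - j\<close> does not truncate for \<open>n \<ge> d\<close>.
\<close>

definition det_interlacing :: "nat \<Rightarrow> nat \<Rightarrow> (nat \<Rightarrow> real) \<Rightarrow> (nat \<Rightarrow> real) \<Rightarrow> real" where
  "det_interlacing d n x z =
     Determinant.det (mat d d (\<lambda>(i, j). gam n (z (Suc j) - x (Suc i))))"

definition det_ordered :: "nat \<Rightarrow> nat \<Rightarrow> (nat \<Rightarrow> real) \<Rightarrow> (nat \<Rightarrow> real) \<Rightarrow> real" where
  "det_ordered d n x z =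
     Determinant.det (mat d d (\<lambda>(i, j). gam (n + i - j) (z (Suc j) - x (Suc i))))"

text \<open>The law of \<open>\<eta>\<^sub>j\<close>: \<open>erlang_density (j - 2) 1\<close> is the density of \<open>Gamma(j - 1, 1)\<close>.\<close>

definition eta_law :: "nat \<Rightarrow> real measure" where
  "eta_law j = (if j = 1 then return borel 0 else density lborel (erlang_density (j - 2) 1))"

definition h :: "nat \<Rightarrow> (nat \<Rightarrow> real) \<Rightarrow> real" where
  "h d x = (\<integral>\<eta>. vandermonde d (\<lambda>j\<in>{1..d}. x j + \<eta> j) \<partial>(\<Pi>\<^sub>M j\<in>{1..d}. eta_law j))"

definition h_hat :: "nat \<Rightarrow> (nat \<Rightarrow> real) \<Rightarrow> real" where
  "h_hat d z = h d (\<lambda>j\<in>{1..d}. - z (d + 1 - j))"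

definition chi :: "nat \<Rightarrow> real" where
  "chi d = (2 * pi) powr (- real d / 2) * inverse (\<Prod>j=1..<d. fact j)"

text \<open>The drifted endpoint \<open>n + z\<close>.\<close>

definition add_drift :: "nat \<Rightarrow> nat \<Rightarrow> (nat \<Rightarrow> real) \<Rightarrow> (nat \<Rightarrow> real)" where
  "add_drift d n z = (\<lambda>j\<in>{1..d}. real n + z j)"

definition gauss_factor :: "nat \<Rightarrow> nat \<Rightarrow> (nat \<Rightarrow> real) \<Rightarrow> real" where
  "gauss_factor d n z =
     real n powr (- (real d)\<^sup>2 / 2) * exp (- (1 / (2 * real n)) * (\<Sum>j=1..d. (z j)\<^sup>2))"

definition region ::
  "nat \<Rightarrow> (nat \<Rightarrow> real) set \<Rightarrow> (nat \<Rightarrow> real) \<Rightarrow> real \<Rightarrow> nat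
     \<Rightarrow> ((nat \<Rightarrow> real) \<times> (nat \<Rightarrow> real)) set" where
  "region d D \<delta> C n = {(x, z). x \<in> D \<and> z \<in> D \<and>
     x d - x 1 \<le> \<delta> n * sqrt n \<and> \<bar>x 1\<bar> \<le> \<delta> n * sqrt n \<and>
     z d - z 1 \<le> \<delta> n * sqrt n \<and> \<bar>z 1\<bar> \<le> C * sqrt n}"

text \<open>
  Since \<open>a / 0 = 0\<close>, the condition forces \<open>b n p \<noteq> 0\<close> on \<open>A n\<close> for all large \<open>n\<close>.
\<close>

definition ratio_tendsto_1_uniformly ::
  "(nat \<Rightarrow> 'p set) \<Rightarrow> (nat \<Rightarrow> 'p \<Rightarrow> real) \<Rightarrow> (nat \<Rightarrow> 'p \<Rightarrow> real) \<Rightarrow> bool" where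
  "ratio_tendsto_1_uniformly A a b \<longleftrightarrow>
     (\<forall>\<epsilon>>0. \<forall>\<^sub>F n in sequentially. \<forall>p\<in>A n. \<bar>a n p / b n p - 1\<bar> < \<epsilon>)"

definition uniform_asymp ::
  "nat \<Rightarrow> (nat \<Rightarrow> real) set
     \<Rightarrow> (nat \<Rightarrow> (nat \<Rightarrow> real) \<Rightarrow> (nat \<Rightarrow> real) \<Rightarrow> real)
     \<Rightarrow> (nat \<Rightarrow> (nat \<Rightarrow> real) \<Rightarrow> (nat \<Rightarrow> real) \<Rightarrow> real) \<Rightarrow> bool" where
  "uniform_asymp d D F H \<longleftrightarrow>
     (\<forall>\<delta> C. (\<forall>n. 0 < \<delta> n) \<longrightarrow> \<delta> \<longlonglongrightarrow> 0 \<longrightarrow>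
        ratio_tendsto_1_uniformly (region d D \<delta> C)
          (\<lambda>n (x, z). F n x z) (\<lambda>n (x, z). H n x z))"

end

theory Submission
  imports Defs "HOL-Real_Asymp.Real_Asymp"
begin

text \<open>
  Both transition densities are determinants built from gamma densities \<open>f\<close>, and one statement about the
  kernel \<open>f(n + z - x)\<close> carries the proof (\<open>det_gam_asymp_uniform\<close>): if all \<open>x\<^sub>i\<close> and all
  \<open>z\<^sub>j - y sqrt n\<close> are \<open>o(sqrt n)\<close> and \<open>y\<close> is bounded, then the determinant of the kernel is \<open>\<Delta>(x) \<Delta>(z)\<close> times
  \<open>n\<close> to the power \<open>- d\<^sup>2 / 2\<close> times a quantity that tends to \<open>\<phi>(y) ^ d / (\<Prod>k<d. fact k)\<close>, where \<open>\<phi>\<close> is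
  the standard Gaussian density. By a mean value theorem of H. A. Schwarz (\<open>det_mean_value\<close>), applied
  in \<open>x\<close> and then in \<open>z\<close>, the quotient of the determinant by \<open>\<Delta>(x) \<Delta>(z)\<close> is up to factorials the
  determinant of the derivatives of \<open>f\<close> of order \<open>i + k\<close> at intermediate points. After scaling by powers of
  \<open>sqrt n\<close> these derivatives converge to \<open>\<phi>\<close> times Hermite polynomials, by the local limit theorem
  and a three-term recurrence (\<open>gam_deriv_tracks\<close>). The Hankel determinant of the Hermite polynomials
  is a constant (\<open>det_hermite_hankel\<close>). The points may come in any order and may
  coincide, which the averaging for the ordered walk relies on.

  For the interlacing walk this is already the claim. For the ordered walk, the entry \<open>(i, j)\<close> of the
  determinant is a gamma density of shape \<open>n + i - j\<close>, and this is the density of shape \<open>n + 1 - d\<close> averaged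
  over independent displacements \<open>\<eta>\<^sub>i\<close> of \<open>x\<^sub>i\<close> and \<open>- \<eta>'\<^sub>j\<close> of \<open>z\<^sub>j\<close>, where \<open>\<eta>\<^sub>i\<close> has shape \<open>i - 1\<close> and
  \<open>\<eta>'\<^sub>j\<close> has shape \<open>d - j\<close>. As the displacements of different rows and columns are independent, the whole
  determinant is the expectation of the determinant at the displaced points
  (\<open>det_ordered_eq_integral\<close>). The expectations of \<open>\<Delta>(x + \<eta>)\<close> and \<open>\<Delta>(z - \<eta>')\<close> are \<open>h(x)\<close> and its reflected
  version at \<open>z\<close>, so the kernel asymptotics under the expectation gives the leading term. Displacements beyond
  \<open>n ^ (1/4)\<close> are negligible because the determinant is at most \<open>fact d\<close> and the displacements
  have moments of all orders (\<open>shifted_det_error\<close>).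

  The error obtained in this way is small relative to the product over \<open>i < j\<close> of \<open>1 + x\<^sub>j - x\<^sub>i\<close> and the
  same product for \<open>z\<close>. It remains to know that \<open>h\<close> is at least of this size on the closed chamber
  (\<open>h_lower_bound\<close>). In the definition of \<open>h\<close> terms of both signs cancel. However, \<open>h(x)\<close> is also an iterated
  integral of \<open>\<Delta>\<close> with an exponential weight over configurations obtained from \<open>x\<close> by successive
  interlacing (\<open>stage_Suc_ge\<close>), where the integrand is nonnegative; restricting it to a box of
  configurations whose points are pushed apart by at least \<open>1\<close> gives the bound.
\<close>

section \<open>A mean value theorem for determinants\<close>

text \<open>
  The weights are the cofactors along row \<open>m\<close>. Both the mean value theorem and the positivity
  argument treat a determinant as a linear form in one of its rows.
\<close>

lemma det_expand_row:
  fixes M :: "nat \<Rightarrow> nat \<Rightarrow> real"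
  assumes "m < d"
  obtains w where "\<And>r. Determinant.det (Matrix.mat d d (\<lambda>(i, k). if i = m then r k else M i k)) = (\<Sum>k<d. w k * r k)"
proof -
  define w where "w k = cofactor (Matrix.mat d d (\<lambda>(i, k). M i k)) m k" for k
  have "Determinant.det (Matrix.mat d d (\<lambda>(i, k). if i = m then r k else M i k)) = (\<Sum>k<d. w k * r k)" for r
  proof -
    let ?A = "Matrix.mat d d (\<lambda>(i, k). if i = m then r k else M i k)"
    have "Determinant.det ?A = (\<Sum>k<d. ?A $$ (m,k) * cofactor ?A m k)"
      by (rule laplace_expansion_row) (use assms in auto)
    also have "\<dots> = (\<Sum>k<d. w k * r k)"
    proof (rule sum.cong)
      fix k assume k: "k \<in> {..<d}"
      have "mat_delete ?A m k = mat_delete (Matrix.mat d d (\<lambda>(i, k). M i k)) m k"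
        unfolding mat_delete_def using assms k by (intro eq_matI) auto
      then show "?A $$ (m,k) * cofactor ?A m k = w k * r k"
        using assms k by (simp add: w_def cofactor_def)
    qed simp
    finally show ?thesis .
  qed
  then show ?thesis using that by blast
qed

lemma det_two_rows_eq:
  fixes M :: "nat \<Rightarrow> nat \<Rightarrow> real"
  assumes "i < d" "j < d" "i \<noteq> j" "\<And>k. k < d \<Longrightarrow> M i k = M j k"
  shows "Determinant.det (Matrix.mat d d (\<lambda>(i, k). M i k)) = 0"
  by (rule det_identical_rows[of _ d i j]) (use assms in \<open>auto simp: Matrix.row_def\<close>)

lemma det_cong:
  assumes "\<And>i k. i < d \<Longrightarrow> k < d \<Longrightarrow> M i k = M' i k"
  shows "Determinant.det (Matrix.mat d d (\<lambda>(i, k). M i k)) = Determinant.det (Matrix.mat d d (\<lambda>(i, k). M' i k))"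
  by (rule arg_cong[where f=Determinant.det]) (use assms in auto)

lemma det_swap_indices:
  fixes M :: "nat \<Rightarrow> nat \<Rightarrow> real"
  shows "Determinant.det (Matrix.mat d d (\<lambda>(i, k). M k i)) = Determinant.det (Matrix.mat d d (\<lambda>(i, k). M i k))"
proof -
  have "transpose_mat (Matrix.mat d d (\<lambda>(i, k). M i k)) = Matrix.mat d d (\<lambda>(i, k). M k i)"
    by auto
  then show ?thesis
    using det_transpose[of "Matrix.mat d d (\<lambda>(i, k). M i k)" d] by simp
qed

text \<open>
  Between two consecutive zeros of \<open>f\<close> lies a zero of \<open>f'\<close>. The half-open range \<open>{Min Z..<Max Z}\<close> makes the
  induction work: a zero found beyond the old maximum differs from all earlier ones, and for a singleton
  \<open>Z\<close> the range is empty.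
\<close>

lemma finite_zeros_derivative:
  fixes f f' :: "real \<Rightarrow> real"
  assumes der: "\<And>t. (f has_real_derivative f' t) (at t)"
  assumes "finite Z" "Z \<noteq> {}" "\<And>z. z \<in> Z \<Longrightarrow> f z = 0"
  shows "\<exists>Y. finite Y \<and> card Z = Suc (card Y) \<and> Y \<subseteq> {Min Z..<Max Z} \<and> (\<forall>y\<in>Y. f' y = 0)"
  using assms(2-)
proof (induction Z rule: finite_linorder_max_induct)
  case empty
  then show ?case by simp
next
  case (insert b A)
  show ?case
  proof (cases "A = {}")
    case True
    then show ?thesis by (intro exI[of _ "{}"]) auto
  next
    case False
    then obtain Y where Y: "finite Y" "card A = Suc (card Y)" "Y \<subseteq> {Min A..<Max A}" "\<forall>y\<in>Y. f' y = 0"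
      using insert by auto
    have lt: "Max A < b" and fb: "f (Max A) = f b" using insert False by auto
    obtain c where c: "Max A < c" "c < b" "(f has_real_derivative 0) (at c)"
      using Rolle[OF lt fb] der
      by (metis DERIV_isCont continuous_at_imp_continuous_on real_differentiable_def)
    have "f' c = 0" using c der DERIV_unique by blast
    have "Min A \<le> Max A" using False insert(1) by simp
    have M: "Max (insert b A) = b" "Min (insert b A) = Min A"
      using insert False by (auto simp: max_def min_def) (metis Max_in Min_le not_less less_le_trans \<open>Min A \<le> Max A\<close> lt order_less_imp_le)+
    have nin: "c \<notin> Y" "b \<notin> A" using Y(3) c insert by auto
    show ?thesis
    proof (intro exI[of _ "insert c Y"] conjI)
      show "insert c Y \<subseteq> {Min (insert b A)..<Max (insert b A)}"
        unfolding M using Y(3) c lt \<open>Min A \<le> Max A\<close> by auto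
    qed (use Y nin insert \<open>f' c = 0\<close> in auto)
  qed
qed

lemma iterated_Rolle:
  fixes F :: "nat \<Rightarrow> real \<Rightarrow> real"
  assumes "\<And>l t. l < m \<Longrightarrow> (F l has_real_derivative F (Suc l) t) (at t)"
  assumes "finite Z" "card Z = Suc m" "Z \<subseteq> {a..b}" "\<And>z. z \<in> Z \<Longrightarrow> F 0 z = 0"
  shows "\<exists>\<xi>\<in>{a..b}. F m \<xi> = 0"
  using assms
proof (induction m arbitrary: F Z)
  case 0
  then obtain z where "Z = {z}" by (metis card_1_singletonE One_nat_def)
  then show ?case using 0 by auto
next
  case (Suc m)
  have ne: "Z \<noteq> {}" using Suc.prems by auto
  obtain Y where Y: "finite Y" "card Z = Suc (card Y)" "Y \<subseteq> {Min Z..<Max Z}" "\<forall>y\<in>Y. F 1 y = 0"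
    using finite_zeros_derivative[of "F 0" "F 1" Z] Suc.prems ne by auto
  have "Min Z \<in> Z" "Max Z \<in> Z" using Suc.prems ne by auto
  then have "Y \<subseteq> {a..b}" using Y(3) Suc.prems(4) by fastforce
  then have "\<exists>\<xi>\<in>{a..b}. (\<lambda>l. F (Suc l)) m \<xi> = 0"
    using Suc.prems Y by (intro Suc.IH[of "\<lambda>l. F (Suc l)" Y]) auto
  then show ?case by simp
qed

text \<open>
  The error formula of polynomial interpolation for a function vanishing at all nodes. Subtract from \<open>F 0\<close>
  the multiple of \<open>\<Prod>j<m. s - x j\<close> that makes \<open>t\<close> a further zero, and apply Rolle's theorem \<open>m\<close> times; the
  \<open>m\<close>-th derivative of the monic polynomial is the constant \<open>fact m\<close>.
\<close>

lemma interpolation_error: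
  fixes F :: "nat \<Rightarrow> real \<Rightarrow> real"
  assumes "\<And>l t. l < m \<Longrightarrow> (F l has_real_derivative F (Suc l) t) (at t)"
  assumes "\<And>j. j < m \<Longrightarrow> x j \<in> {a..b}" "inj_on x {..<m}" "\<And>j. j < m \<Longrightarrow> F 0 (x j) = 0"
  assumes "t \<in> {a..b}" "t \<notin> x ` {..<m}"
  shows "\<exists>\<xi>\<in>{a..b}. F 0 t = (\<Prod>j<m. t - x j) / fact m * F m \<xi>"
proof -
  define p where "p = (\<Prod>j<m. [: - x j, 1 :])"
  have degp: "Polynomial.degree p = m"
    by (simp add: p_def degree_prod_eq_sum_degree)
  have lc: "coeff p m = 1"
    using degp lead_coeff_prod[of "\<lambda>j. [: - x j, 1 :]" "{..<m}"] by (simp add: p_def)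
  have pt: "poly p s = (\<Prod>j<m. s - x j)" for s by (simp add: p_def poly_prod)
  have nz: "poly p t \<noteq> 0" using assms(6) by (auto simp: pt)
  define c where "c = F 0 t / poly p t"
  define G where "G l s = F l s - c * poly ((pderiv ^^ l) p) s" for l s
  have top: "poly ((pderiv ^^ m) p) s = fact m" for s
  proof -
    obtain a where "(pderiv ^^ m) p = [:a:]"
      by (rule degree_eq_zeroE[of "(pderiv ^^ m) p"]) (simp add: degree_higher_pderiv degp)
    moreover have "coeff ((pderiv ^^ m) p) 0 = fact m"
      using lc by (simp add: coeff_higher_pderiv pochhammer_fact)
    ultimately show ?thesis by simp
  qed
  have "\<exists>\<xi>\<in>{a..b}. G m \<xi> = 0"
  proof (rule iterated_Rolle[where Z = "insert t (x ` {..<m})"])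
    show "(G l has_real_derivative G (Suc l) s) (at s)" if "l < m" for l s
      unfolding G_def using assms(1)[OF that] by (auto intro!: derivative_eq_intros poly_DERIV)
    show "card (insert t (x ` {..<m})) = Suc m"
      using assms(3,6) by (simp add: card_image)
    show "G 0 z = 0" if "z \<in> insert t (x ` {..<m})" for z
      using that assms(4) nz by (auto simp: G_def c_def pt)
  qed (use assms in auto)
  then obtain \<xi> where \<xi>: "\<xi> \<in> {a..b}" "G m \<xi> = 0" by blast
  then have "F m \<xi> = c * fact m" by (simp add: G_def top)
  then have "F 0 t = poly p t / fact m * F m \<xi>" using nz by (simp add: c_def)
  with \<xi> show ?thesis unfolding pt by blast
qed

text \<open>
  A mean value theorem of H. A. Schwarz, with \<open>F l k\<close> the \<open>l\<close>-th derivative of \<open>F 0 k\<close>. It divides a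
  determinant by the Vandermonde product of its nodes without loss of uniformity as nodes merge: only
  derivatives at points of the same interval remain.
\<close>

lemma det_mean_value:
  fixes F :: "nat \<Rightarrow> nat \<Rightarrow> real \<Rightarrow> real"
  assumes der: "\<And>l k t. l < d \<Longrightarrow> k < d \<Longrightarrow> (F l k has_real_derivative F (Suc l) k t) (at t)"
  assumes x: "\<And>i. i < d \<Longrightarrow> x i \<in> {a..b}" and inj: "inj_on x {..<d}"
  shows "\<exists>\<xi>. (\<forall>i<d. \<xi> i \<in> {a..b}) \<and>
    Determinant.det (Matrix.mat d d (\<lambda>(i, k). F 0 k (x i))) =
    (\<Prod>i<d. (\<Prod>j<i. x i - x j) / fact i) * Determinant.det (Matrix.mat d d (\<lambda>(i, k). F i k (\<xi> i)))"
proof -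
  \<comment> \<open>The rows are treated from the last one upwards. When row \<open>m\<close> is reached, the rows above it still
      carry the undifferentiated functions, so that as a function of its argument the determinant vanishes
      at the nodes of those rows and the interpolation error formula applies.\<close>
  have "\<exists>\<xi>. (\<forall>i<d. \<xi> i \<in> {a..b}) \<and>
    Determinant.det (Matrix.mat d d (\<lambda>(i, k). F 0 k (x i))) =
    (\<Prod>i\<in>{m..<d}. (\<Prod>j<i. x i - x j) / fact i) *
      Determinant.det (Matrix.mat d d (\<lambda>(i, k). if i < m then F 0 k (x i) else F i k (\<xi> i)))"
    if "m \<le> d" for m
    using that
  proof (induction m rule: inc_induct)
    case base
    show ?case using x by (intro exI[of _ x]) (auto intro!: det_cong)
  next
    case (step m)
    then obtain \<xi> where \<xi>: "\<And>i. i < d \<Longrightarrow> \<xi> i \<in> {a..b}" and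
      eq: "Determinant.det (Matrix.mat d d (\<lambda>(i, k). F 0 k (x i))) =
    (\<Prod>i\<in>{Suc m..<d}. (\<Prod>j<i. x i - x j) / fact i) *
      Determinant.det (Matrix.mat d d (\<lambda>(i, k). if i < Suc m then F 0 k (x i) else F i k (\<xi> i)))"
      by blast
    have md: "m < d" using step by simp
    define M where "M i k = (if i < m then F 0 k (x i) else F i k (\<xi> i))" for i k
    define \<Phi> where "\<Phi> l t = Determinant.det (Matrix.mat d d (\<lambda>(i, k). if i = m then F l k t else M i k))" for l t
    obtain w where w: "\<And>r. Determinant.det (Matrix.mat d d (\<lambda>(i, k). if i = m then r k else M i k)) = (\<Sum>k<d. w k * r k)"
      using det_expand_row[OF md] by blast
    have \<Phi>w: "\<Phi> l t = (\<Sum>k<d. w k * F l k t)" for l t unfolding \<Phi>_def by (rule w)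
    have "\<exists>\<zeta>\<in>{a..b}. \<Phi> 0 (x m) = (\<Prod>j<m. x m - x j) / fact m * \<Phi> m \<zeta>"
    proof (rule interpolation_error)
      show "(\<Phi> l has_real_derivative \<Phi> (Suc l) t) (at t)" if "l < m" for l t
        unfolding \<Phi>w using that md der by (intro DERIV_sum DERIV_cmult) auto
      show "\<Phi> 0 (x j) = 0" if "j < m" for j
        unfolding \<Phi>_def using that md by (intro det_two_rows_eq[of m _ j]) (auto simp: M_def)
      show "x m \<notin> x ` {..<m}"
      proof
        assume "x m \<in> x ` {..<m}"
        then obtain j where "j < m" "x m = x j" by auto
        then show False using inj md by (auto dest!: inj_onD)
      qed
      show "inj_on x {..<m}" using inj md by (auto simp: inj_on_def)
    qed (use x md in auto)
    then obtain \<zeta> where \<zeta>: "\<zeta> \<in> {a..b}" "\<Phi> 0 (x m) = (\<Prod>j<m. x m - x j) / fact m * \<Phi> m \<zeta>" by blast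
    have 1: "Determinant.det (Matrix.mat d d (\<lambda>(i, k). if i < Suc m then F 0 k (x i) else F i k (\<xi> i))) = \<Phi> 0 (x m)"
      unfolding \<Phi>_def by (rule det_cong) (auto simp: M_def)
    have 2: "\<Phi> m \<zeta> = Determinant.det (Matrix.mat d d (\<lambda>(i, k). if i < m then F 0 k (x i) else F i k ((\<xi>(m := \<zeta>)) i)))"
      unfolding \<Phi>_def by (rule det_cong) (auto simp: M_def)
    show ?case
      using \<xi> \<zeta>(1) md
      by (intro exI[of _ "\<xi>(m := \<zeta>)"])
         (auto simp: eq 1 \<zeta>(2) 2[symmetric] prod.atLeast_Suc_lessThan)
  qed
  from this[of 0] show ?thesis by (simp add: atLeast0LessThan)
qed


lemma vandermonde_zero:
  fixes x :: "nat \<Rightarrow> real"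
  assumes "\<not> inj_on x {..<d}"
  shows "(\<Prod>i<d. \<Prod>j<i. x i - x j) = 0"
proof -
  obtain i j where ij: "i < d" "j < d" "i \<noteq> j" "x i = x j"
    using assms by (auto simp: inj_on_def)
  have "\<exists>i<d. \<exists>j<i. x i = x j"
  proof (cases "i < j")
    case True
    then show ?thesis using ij(2) ij(4)[symmetric] by blast
  next
    case False
    then have "j < i" using ij(3) by simp
    then show ?thesis using ij(1) ij(4) by blast
  qed
  then obtain i j where "i < d" "j < i" "x i = x j" by blast
  then have "(\<Prod>j<i. x i - x j) = 0" by (intro prod_zero) auto
  then show ?thesis using \<open>i < d\<close> by (intro prod_zero) auto
qed

text \<open>
  Applied to monomials, the mean value theorem leaves a triangular matrix with \<open>fact i\<close> on the
  diagonal.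
\<close>

lemma det_vandermonde:
  fixes x :: "nat \<Rightarrow> real"
  shows "Determinant.det (Matrix.mat d d (\<lambda>(i, k). x i ^ k)) = (\<Prod>i<d. \<Prod>j<i. x i - x j)"
proof (cases "inj_on x {..<d}")
  case True
  define F where "F l k t = poly ((pderiv ^^ l) (monom 1 k)) t" for l k and t :: real
  define a where "a = Min (insert 0 (x ` {..<d}))"
  define b where "b = Max (insert 0 (x ` {..<d}))"
  have ab: "x i \<in> {a..b}" if "i < d" for i using that by (auto simp: a_def b_def)
  have "\<exists>\<xi>. (\<forall>i<d. \<xi> i \<in> {a..b}) \<and>
    Determinant.det (Matrix.mat d d (\<lambda>(i, k). F 0 k (x i))) =
    (\<Prod>i<d. (\<Prod>j<i. x i - x j) / fact i) * Determinant.det (Matrix.mat d d (\<lambda>(i, k). F i k (\<xi> i)))"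
    by (rule det_mean_value) (use ab True in \<open>auto simp: F_def intro!: poly_DERIV\<close>)
  then obtain \<xi> where eq: "Determinant.det (Matrix.mat d d (\<lambda>(i, k). F 0 k (x i))) =
    (\<Prod>i<d. (\<Prod>j<i. x i - x j) / fact i) * Determinant.det (Matrix.mat d d (\<lambda>(i, k). F i k (\<xi> i)))"
    by blast
  have zero: "F i k t = 0" if "k < i" for i k t
  proof -
    have "(pderiv ^^ i) (monom (1::real) k) = 0"
      using that by (intro poly_eqI) (simp add: coeff_higher_pderiv)
    then show ?thesis by (simp add: F_def)
  qed
  have diag: "F i i t = fact i" for i t
  proof -
    have "(pderiv ^^ i) (monom (1::real) i) = [:fact i:]"
      by (intro poly_eqI) (auto simp: coeff_higher_pderiv pochhammer_fact coeff_pCons split: nat.split)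
    then show ?thesis by (simp add: F_def)
  qed
  let ?U = "Matrix.mat d d (\<lambda>(i, k). F i k (\<xi> i))"
  have "Determinant.det ?U = prod_list (diag_mat ?U)"
    by (rule det_upper_triangular) (auto simp: upper_triangular_def zero)
  also have "\<dots> = (\<Prod>i<d. fact i)"
    by (simp add: prod_list_diag_prod diag atLeast0LessThan)
  finally have U: "Determinant.det ?U = (\<Prod>i<d. fact i)" .
  show ?thesis using eq U by (simp add: F_def poly_monom prod_dividef)
next
  case False
  then obtain i j where "i < d" "j < d" "i \<noteq> j" "x i = x j" by (auto simp: inj_on_def)
  then have "Determinant.det (Matrix.mat d d (\<lambda>(i, k). x i ^ k)) = 0"
    by (intro det_two_rows_eq[of i _ j]) auto
  then show ?thesis using vandermonde_zero[OF False] by simp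
qed

text \<open>
  The mean value theorem used twice on a difference kernel, once in the rows and once in the columns;
  differentiation in \<open>x\<close> brings the sign.
\<close>

lemma det_mean_value_kernel:
  fixes f :: "nat \<Rightarrow> real \<Rightarrow> real"
  assumes der: "\<And>l t. l < 2 * d \<Longrightarrow> (f l has_real_derivative f (Suc l) t) (at t)"
  assumes x: "\<And>i. i < d \<Longrightarrow> x i \<in> {a..b}" "inj_on x {..<d}"
  assumes z: "\<And>i. i < d \<Longrightarrow> z i \<in> {a'..b'}" "inj_on z {..<d}"
  shows "\<exists>\<xi> \<zeta>. (\<forall>i<d. \<xi> i \<in> {a..b}) \<and> (\<forall>i<d. \<zeta> i \<in> {a'..b'}) \<and>
    Determinant.det (Matrix.mat d d (\<lambda>(i, k). f 0 (z k - x i))) =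
    (\<Prod>i<d. \<Prod>j<i. x i - x j) * (\<Prod>i<d. \<Prod>j<i. z i - z j) / (\<Prod>i<d. fact i)\<^sup>2 *
    Determinant.det (Matrix.mat d d (\<lambda>(k, i). (-1) ^ i * f (i + k) (\<zeta> k - \<xi> i)))"
proof -
  have "\<exists>\<xi>. (\<forall>i<d. \<xi> i \<in> {a..b}) \<and>
    Determinant.det (Matrix.mat d d (\<lambda>(i, k). (-1) ^ 0 * f 0 (z k - x i))) =
    (\<Prod>i<d. (\<Prod>j<i. x i - x j) / fact i) * Determinant.det (Matrix.mat d d (\<lambda>(i, k). (-1) ^ i * f i (z k - \<xi> i)))"
  proof (rule det_mean_value[where F = "\<lambda>l k t. (-1) ^ l * f l (z k - t)"])
    fix l k t assume "l < d" "k < d"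
    then have "(f l has_real_derivative f (Suc l) (z k - t)) (at (z k - t))" by (intro der) auto
    then show "((\<lambda>t. (-1) ^ l * f l (z k - t)) has_real_derivative (-1) ^ Suc l * f (Suc l) (z k - t)) (at t)"
      by (auto intro!: derivative_eq_intros DERIV_chain2[where f = "f l"])
  qed (use x in auto)
  then obtain \<xi> where \<xi>: "\<forall>i<d. \<xi> i \<in> {a..b}" and 1:
    "Determinant.det (Matrix.mat d d (\<lambda>(i, k). f 0 (z k - x i))) =
    (\<Prod>i<d. (\<Prod>j<i. x i - x j) / fact i) * Determinant.det (Matrix.mat d d (\<lambda>(i, k). (-1) ^ i * f i (z k - \<xi> i)))"
    by auto
  have "\<exists>\<zeta>. (\<forall>i<d. \<zeta> i \<in> {a'..b'}) \<and>
    Determinant.det (Matrix.mat d d (\<lambda>(k, i). (-1) ^ i * f (i + 0) (z k - \<xi> i))) =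
    (\<Prod>i<d. (\<Prod>j<i. z i - z j) / fact i) * Determinant.det (Matrix.mat d d (\<lambda>(k, i). (-1) ^ i * f (i + k) (\<zeta> k - \<xi> i)))"
  proof (rule det_mean_value[where F = "\<lambda>l i t. (-1) ^ i * f (i + l) (t - \<xi> i)"])
    fix l k t assume "l < d" "k < d"
    then have "(f (k + l) has_real_derivative f (Suc (k + l)) (t - \<xi> k)) (at (t - \<xi> k))" by (intro der) auto
    then show "((\<lambda>t. (-1) ^ k * f (k + l) (t - \<xi> k)) has_real_derivative (-1) ^ k * f (k + Suc l) (t - \<xi> k)) (at t)"
      by (auto intro!: derivative_eq_intros DERIV_chain2[where f = "f (k + l)"])
  qed (use z in auto)
  then obtain \<zeta> where \<zeta>: "\<forall>i<d. \<zeta> i \<in> {a'..b'}" and 2: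
    "Determinant.det (Matrix.mat d d (\<lambda>(k, i). (-1) ^ i * f i (z k - \<xi> i))) =
    (\<Prod>i<d. (\<Prod>j<i. z i - z j) / fact i) * Determinant.det (Matrix.mat d d (\<lambda>(k, i). (-1) ^ i * f (i + k) (\<zeta> k - \<xi> i)))"
    by auto
  have 3: "Determinant.det (Matrix.mat d d (\<lambda>(i, k). (-1) ^ i * f i (z k - \<xi> i))) =
    Determinant.det (Matrix.mat d d (\<lambda>(k, i). (-1) ^ i * f i (z k - \<xi> i)))"
    by (rule det_swap_indices)
  show ?thesis
    using \<xi> \<zeta> by (intro exI[of _ \<xi>] exI[of _ \<zeta>])
      (simp only: 1 2 3 prod_dividef power2_eq_square, simp)
qed

section \<open>A lower bound for a determinant of gamma moments\<close>

text \<open>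
  The moment \<open>E (x + \<eta>)\<^sup>k\<close> of a variable \<open>\<eta>\<close> with law \<open>Gamma(m, 1)\<close>, whose \<open>l\<close>-th moment is the rising
  factorial of \<open>m\<close>. With \<open>m = 0\<close> the variable vanishes.
\<close>

definition gam_moment :: "nat \<Rightarrow> nat \<Rightarrow> real \<Rightarrow> real" where
  "gam_moment m k x = (\<Sum>l\<le>k. real (k choose l) * pochhammer (real m) l * x ^ (k - l))"

lemma gam_moment_0: "gam_moment 0 k x = x ^ k"
proof -
  have "gam_moment 0 k x = (\<Sum>l\<in>{0}. real (k choose l) * pochhammer (real 0) l * x ^ (k - l))"
    unfolding gam_moment_def by (rule sum.mono_neutral_right) (auto simp: pochhammer_0_left)
  then show ?thesis by simp
qed

text \<open>
  Averaging over one more exponential variable inverts \<open>1 - D\<close>, where \<open>D\<close> is the derivative.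
\<close>

lemma gam_moment_has_derivative: "(gam_moment (Suc m) k has_real_derivative gam_moment (Suc m) k x - gam_moment m k x) (at x)"
proof -
  let ?P = "\<lambda>l. pochhammer (real (Suc m)) l"
  have "(gam_moment (Suc m) k has_real_derivative (\<Sum>l\<le>k. real (k choose l) * ?P l * (real (k - l) * x ^ (k - l - 1)))) (at x)"
    unfolding gam_moment_def by (intro DERIV_sum DERIV_cmult) (auto intro!: derivative_eq_intros)
  also have "(\<Sum>l\<le>k. real (k choose l) * ?P l * (real (k - l) * x ^ (k - l - 1))) =
      (\<Sum>l<k. real (k choose l) * ?P l * (real (k - l) * x ^ (k - l - 1)))"
    by (rule sum.mono_neutral_right) (auto simp: not_less)
  also have "\<dots> = (\<Sum>l<k. real (k choose Suc l) * (?P (Suc l) - pochhammer (real m) (Suc l)) * x ^ (k - Suc l))"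
  proof (rule sum.cong)
    fix l assume "l \<in> {..<k}"
    have P: "?P (Suc l) - pochhammer (real m) (Suc l) = real (Suc l) * ?P l"
      by (simp add: pochhammer_Suc[of "1 + real m"] pochhammer_rec[of "real m"] algebra_simps)
    have "Suc l * (k choose Suc l) = (k choose l) * (k - l)"
      using binomial_absorption[of l k] binomial_absorb_comp[of k l] by (simp only: mult.commute)
    then have C: "real (Suc l) * real (k choose Suc l) = real (k choose l) * real (k - l)"
      by (metis of_nat_mult)
    show "real (k choose l) * ?P l * (real (k - l) * x ^ (k - l - 1)) =
      real (k choose Suc l) * (?P (Suc l) - pochhammer (real m) (Suc l)) * x ^ (k - Suc l)"
      unfolding P using C by (simp add: ac_simps)
  qed simp
  also have "\<dots> = (\<Sum>l\<le>k. real (k choose l) * (?P l - pochhammer (real m) l) * x ^ (k - l))"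
  proof (cases k)
    case (Suc n)
    then show ?thesis by (simp only: sum.atMost_Suc_shift lessThan_Suc_atMost) simp
  qed simp
  also have "\<dots> = gam_moment (Suc m) k x - gam_moment m k x"
    unfolding gam_moment_def by (simp add: sum_subtractf algebra_simps)
  finally show ?thesis .
qed

text \<open>
  With the weight \<open>exp (- t)\<close>, averaging over an exponential variable becomes integration over
  \<open>{t..}\<close>. The next two lemmas express this through the derivative and the limit at infinity.
\<close>

definition damped_moment :: "nat \<Rightarrow> nat \<Rightarrow> real \<Rightarrow> real" where
  "damped_moment m k t = exp (- t) * gam_moment m k t"

lemma damped_moment_has_derivative: "(damped_moment (Suc m) k has_real_derivative - damped_moment m k t) (at t)"
  unfolding damped_moment_def by (auto intro!: derivative_eq_intros gam_moment_has_derivative simp: algebra_simps)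

lemma damped_moment_tendsto_0: "(damped_moment m k \<longlongrightarrow> 0) at_top"
proof -
  have "((\<lambda>t. \<Sum>l\<le>k. real (k choose l) * pochhammer (real m) l * (t ^ (k - l) / exp t)) \<longlongrightarrow> (\<Sum>l\<le>k. real (k choose l) * pochhammer (real m) l * 0)) at_top"
    by (intro tendsto_sum tendsto_mult tendsto_const tendsto_power_div_exp_0)
  then show ?thesis
    by (simp add: damped_moment_def[abs_def] gam_moment_def sum_distrib_left exp_minus field_simps)
qed

text \<open>
  \<open>L a - L b\<close> is the integral of \<open>g \<ge> 0\<close> over \<open>{a..b}\<close>, hence at least \<open>c\<close> if \<open>g \<ge> c\<close> on a subinterval of
  length 1. Monotonicity and the mean value theorem say the same without integrals.
\<close>

lemma window_decrease:
  fixes L g :: "real \<Rightarrow> real"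
  assumes der: "\<And>t. (L has_real_derivative - g t) (at t)"
  assumes "a \<le> b" "\<And>s. s \<in> {a..b} \<Longrightarrow> 0 \<le> g s"
  shows "L b \<le> L a"
    and "\<And>l c. a \<le> l \<Longrightarrow> l + 1 \<le> b \<Longrightarrow> (\<And>s. s \<in> {l..l + 1} \<Longrightarrow> c \<le> g s) \<Longrightarrow> L b + c \<le> L a"
proof -
  have mono: "L v \<le> L u" if "a \<le> u" "u \<le> v" "v \<le> b" for u v
    by (rule DERIV_nonpos_imp_nonincreasing[OF that(2)]) (use der assms that in \<open>force intro!: exI[of _ "- g _"]\<close>)
  show "L b \<le> L a" using mono assms by auto
  fix l c assume l: "a \<le> l" "l + 1 \<le> b" and c: "\<And>s. s \<in> {l..l + 1} \<Longrightarrow> c \<le> g s"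
  obtain \<xi> where \<xi>: "l < \<xi>" "\<xi> < l + 1" "L (l + 1) - L l = (l + 1 - l) * (- g \<xi>)"
    using MVT2[of l "l + 1" L "\<lambda>t. - g t"] der by auto
  then have "L (l + 1) + c \<le> L l" using c[of \<xi>] by auto
  then show "L b + c \<le> L a" using mono[of a l] mono[of "l + 1" b] l by auto
qed

text \<open>
  The hypotheses on \<open>R i\<close> say that it behaves like an integral of \<open>v i s\<close> with respect to a positive
  measure in \<open>s\<close> which is carried by \<open>T i\<close> and gives \<open>U i\<close> mass at least 1. Since a determinant is linear
  in each row, it is then an integral of the determinants with rows \<open>v i (s i)\<close>, and lower bounds for
  these carry over. The rows are exchanged one after another; the intermediate determinants must be
  nonnegative on all of \<open>T\<close>, not only on \<open>U\<close>.
\<close>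

lemma det_ge_by_rows:
  fixes R :: "nat \<Rightarrow> nat \<Rightarrow> real" and v :: "nat \<Rightarrow> real \<Rightarrow> nat \<Rightarrow> real"
  assumes J: "J \<subseteq> {..<d}"
  assumes nn: "\<And>i w. i \<in> J \<Longrightarrow> (\<And>s. s \<in> T i \<Longrightarrow> 0 \<le> (\<Sum>k<d. w k * v i s k)) \<Longrightarrow> 0 \<le> (\<Sum>k<d. w k * R i k)"
  assumes ge: "\<And>i w. i \<in> J \<Longrightarrow> (\<And>s. s \<in> T i \<Longrightarrow> 0 \<le> (\<Sum>k<d. w k * v i s k)) \<Longrightarrow>
     (\<And>s. s \<in> U i \<Longrightarrow> c \<le> (\<Sum>k<d. w k * v i s k)) \<Longrightarrow> c \<le> (\<Sum>k<d. w k * R i k)"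
  assumes UT: "\<And>i. i \<in> J \<Longrightarrow> U i \<subseteq> T i"
  assumes nonneg: "\<And>s. (\<And>i. i \<in> J \<Longrightarrow> s i \<in> T i) \<Longrightarrow>
     0 \<le> Determinant.det (Matrix.mat d d (\<lambda>(i, k). if i \<in> J then v i (s i) k else R i k))"
  assumes big: "\<And>s. (\<And>i. i \<in> J \<Longrightarrow> s i \<in> U i) \<Longrightarrow>
     c \<le> Determinant.det (Matrix.mat d d (\<lambda>(i, k). if i \<in> J then v i (s i) k else R i k))"
  shows "c \<le> Determinant.det (Matrix.mat d d (\<lambda>(i, k). R i k))"
proof -
  define D where "D K s = Determinant.det (Matrix.mat d d (\<lambda>(i, k). if i \<in> J - K then v i (s i) k else R i k))" for K s
  have "finite J" using J finite_subset by blast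
  moreover have "finite K \<Longrightarrow> K \<subseteq> J \<Longrightarrow> \<forall>s. ((\<forall>i\<in>J - K. s i \<in> T i) \<longrightarrow> 0 \<le> D K s) \<and> ((\<forall>i\<in>J - K. s i \<in> U i) \<longrightarrow> c \<le> D K s)" for K
  proof (induction K rule: finite_induct)
    case empty
    then show ?case using nonneg big by (auto simp: D_def)
  next
    case (insert a K)
    then have a: "a \<in> J" "a < d" "a \<notin> K" and IH: "\<And>s. (\<forall>i\<in>J - K. s i \<in> T i) \<Longrightarrow> 0 \<le> D K s" "\<And>s. (\<forall>i\<in>J - K. s i \<in> U i) \<Longrightarrow> c \<le> D K s"
      using J by auto
    show ?case
    proof (intro allI)
      fix s
      obtain w where w: "\<And>r. Determinant.det (Matrix.mat d d (\<lambda>(i, k). if i = a then r k else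
          (if i \<in> J - insert a K then v i (s i) k else R i k))) = (\<Sum>k<d. w k * r k)"
        by (rule det_expand_row[OF a(2), of "\<lambda>i k. if i \<in> J - insert a K then v i (s i) k else R i k"]) (rule that)
      have 1: "D (insert a K) s = (\<Sum>k<d. w k * R a k)"
        unfolding D_def w[symmetric] by (rule det_cong) auto
      have 2: "D K (s(a := t)) = (\<Sum>k<d. w k * v a t k)" for t
        unfolding D_def w[symmetric] by (rule det_cong) (use a in auto)
      have T: "0 \<le> (\<Sum>k<d. w k * v a t k)" if "\<forall>i\<in>J - insert a K. s i \<in> T i" "t \<in> T a" for t
        unfolding 2[symmetric] by (rule IH(1)) (use that in auto)
      have U: "c \<le> (\<Sum>k<d. w k * v a t k)" if "\<forall>i\<in>J - insert a K. s i \<in> U i" "t \<in> U a" for t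
        unfolding 2[symmetric] by (rule IH(2)) (use that in auto)
      show "((\<forall>i\<in>J - insert a K. s i \<in> T i) \<longrightarrow> 0 \<le> D (insert a K) s) \<and> ((\<forall>i\<in>J - insert a K. s i \<in> U i) \<longrightarrow> c \<le> D (insert a K) s)"
      proof (intro conjI impI)
        assume "\<forall>i\<in>J - insert a K. s i \<in> T i"
        then show "0 \<le> D (insert a K) s" unfolding 1 using nn[OF a(1)] T by blast
      next
        assume *: "\<forall>i\<in>J - insert a K. s i \<in> U i"
        then have "\<forall>i\<in>J - insert a K. s i \<in> T i" using UT by blast
        with * show "c \<le> D (insert a K) s" unfolding 1 using ge[OF a(1)] T U by blast
      qed
    qed
  qed
  ultimately have "(\<forall>i\<in>J - J. s i \<in> U i) \<longrightarrow> c \<le> D J s" for s by blast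
  then show ?thesis by (simp add: D_def)
qed

lemma mat_mult_mat:
  fixes f g :: "nat \<Rightarrow> nat \<Rightarrow> real"
  shows "Matrix.mat d d (\<lambda>(i, k). f i k) * Matrix.mat d d (\<lambda>(i, k). g i k) =
    Matrix.mat d d (\<lambda>(i, k). \<Sum>j<d. f i j * g j k)"
  by (rule eq_matI) (auto simp: Matrix.scalar_prod_def atLeast0LessThan)

lemma det_subtract_next_row:
  fixes M :: "nat \<Rightarrow> nat \<Rightarrow> real"
  assumes "\<And>i. P i \<Longrightarrow> Suc i < d"
  shows "Determinant.det (Matrix.mat d d (\<lambda>(i, k). if P i then M i k - M (Suc i) k else M i k)) =
    Determinant.det (Matrix.mat d d (\<lambda>(i, k). M i k))"
proof -
  let ?M = "Matrix.mat d d (\<lambda>(i, k). M i k)"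
  let ?U = "Matrix.mat d d (\<lambda>(i, j). if j = i then 1 else if P i \<and> j = Suc i then - 1 else (0::real))"
  have "Determinant.det ?U = prod_list (diag_mat ?U)"
    by (rule det_upper_triangular) (auto simp: upper_triangular_def)
  also have "\<dots> = 1" by (simp add: prod_list_diag_prod)
  finally have U: "Determinant.det ?U = 1" .
  have "?U * ?M = Matrix.mat d d (\<lambda>(i, k). if P i then M i k - M (Suc i) k else M i k)"
    unfolding mat_mult_mat
  proof (intro cong_mat refl, clarsimp split del: if_split)
    fix i k assume ik: "i < d" "k < d"
    have "(\<Sum>j<d. (if j = i then 1 else if P i \<and> j = Suc i then - 1 else 0) * M j k)
      = (\<Sum>j<d. (if j = i then M i k else 0) + (if j = Suc i then (if P i then - M (Suc i) k else 0) else 0))"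
      by (rule sum.cong) auto
    also have "\<dots> = (if P i then M i k - M (Suc i) k else M i k)"
      using ik assms[of i] by (simp add: sum.distrib)
    finally show "(\<Sum>j<d. (if j = i then 1 else if P i \<and> j = Suc i then - 1 else 0) * M j k) =
      (if P i then M i k - M (Suc i) k else M i k)" .
  qed
  then show ?thesis using U det_mult[of ?U d ?M] by simp
qed

text \<open>
  At stage \<open>q\<close>, row \<open>i\<close> is averaged over \<open>min i q\<close> exponential variables. Stage \<open>0\<close> is a Vandermonde
  determinant, and from stage \<open>d\<close> on row \<open>i\<close> has all its \<open>i\<close> variables.
\<close>

definition stage :: "nat \<Rightarrow> nat \<Rightarrow> (nat \<Rightarrow> real) \<Rightarrow> real" where
  "stage d q y = Determinant.det (Matrix.mat d d (\<lambda>(i, k). damped_moment (min i q) k (y i)))"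

lemma det_scale_rows:
  fixes M :: "nat \<Rightarrow> nat \<Rightarrow> real"
  shows "Determinant.det (Matrix.mat d d (\<lambda>(i, k). a i * M i k)) = (\<Prod>i<d. a i) * Determinant.det (Matrix.mat d d (\<lambda>(i, k). M i k))"
proof -
  let ?U = "Matrix.mat d d (\<lambda>(i, k). if k = i then a i else 0)"
  let ?M = "Matrix.mat d d (\<lambda>(i, k). M i k)"
  have "Determinant.det ?U = prod_list (diag_mat ?U)"
    by (rule det_upper_triangular) (auto simp: upper_triangular_def)
  also have "\<dots> = (\<Prod>i<d. a i)"
    by (simp add: prod_list_diag_prod atLeast0LessThan)
  finally have U: "Determinant.det ?U = (\<Prod>i<d. a i)" .
  have "?U * ?M = Matrix.mat d d (\<lambda>(i, k). a i * M i k)"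
    unfolding mat_mult_mat
  proof (intro cong_mat refl, clarsimp split del: if_split)
    fix i k assume ik: "i < d" "k < d"
    have "(\<Sum>j<d. (if j = i then a i else 0) * M j k) = (\<Sum>j<d. (if j = i then a i * M i k else 0))"
      by (rule sum.cong) auto
    also have "\<dots> = a i * M i k" using ik by simp
    finally show "(\<Sum>j<d. (if j = i then a i else 0) * M j k) = a i * M i k" .
  qed
  then show ?thesis using U det_mult[of ?U d ?M] by simp
qed

lemma exp_minus_sum: "exp (- (\<Sum>i<d::nat. x i)) = (\<Prod>i<d. exp (- (x i :: real)))"
  using exp_sum[OF finite_lessThan, of "\<lambda>i. - x i" d] by (simp add: sum_negf)

lemma stage_0: "stage d 0 y = exp (- (\<Sum>i<d. y i)) * (\<Prod>i<d. \<Prod>j<i. y i - y j)"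
  unfolding stage_def damped_moment_def exp_minus_sum
  by (simp add: det_scale_rows gam_moment_0 det_vandermonde)

text \<open>
  At stage \<open>q + 1\<close> all rows \<open>i > q\<close> carry the same functions. Subtracting from each of them the following
  row turns row \<open>i\<close> into an integral over \<open>{y i..y (Suc i)}\<close>, and the last row is an integral over
  \<open>{y (d - 1)..}\<close>; the integrands are the rows of stage \<open>q\<close>. So stage \<open>q + 1\<close> at \<open>y\<close> is an integral of stage
  \<open>q\<close> over configurations \<open>s\<close> that interlace with \<open>y\<close> and are again ordered. For \<open>c = 0\<close> this transports
  nonnegativity. For \<open>c > 0\<close> it transports a lower bound on a box of unit intervals \<open>{u i..u i + 1}\<close> that
  lies inside the interlacing region.
\<close>

lemma stage_Suc_ge:
  assumes ord: "\<And>i. Suc i < d \<Longrightarrow> y i \<le> y (Suc i)"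
  assumes c: "0 \<le> c"
  assumes u: "\<And>i. c \<noteq> 0 \<Longrightarrow> q < i \<Longrightarrow> i < d \<Longrightarrow> y i \<le> u i" "\<And>i. c \<noteq> 0 \<Longrightarrow> q < i \<Longrightarrow> Suc i < d \<Longrightarrow> u i + 1 \<le> y (Suc i)"
  assumes nonneg: "\<And>s. (\<And>i. Suc i < d \<Longrightarrow> s i \<le> s (Suc i)) \<Longrightarrow> 0 \<le> stage d q s"
  assumes big: "\<And>s. c \<noteq> 0 \<Longrightarrow> (\<And>i. i \<le> q \<Longrightarrow> s i = y i) \<Longrightarrow> (\<And>i. q < i \<Longrightarrow> i < d \<Longrightarrow> s i \<in> {u i..u i + 1}) \<Longrightarrow> c \<le> stage d q s"
  shows "c \<le> stage d (Suc q) y"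
proof -
  define J where "J = {i. q < i \<and> i < d}"
  define T where "T i = (if Suc i < d then {y i..y (Suc i)} else {y i..})" for i
  define U where "U i = (if c = 0 then T i else {u i..u i + 1})" for i
  define R where "R i k = (if q < i \<and> Suc i < d then damped_moment (min i (Suc q)) k (y i) - damped_moment (min (Suc i) (Suc q)) k (y (Suc i))
     else damped_moment (min i (Suc q)) k (y i))" for i k
  have UT: "U i \<subseteq> T i" if "i \<in> J" for i
    using u[of i] that by (auto simp: U_def T_def J_def)
  have row: "0 \<le> (\<Sum>k<d. w k * R i k) \<and> ((\<forall>s\<in>U i. c \<le> (\<Sum>k<d. w k * damped_moment q k s)) \<longrightarrow> c \<le> (\<Sum>k<d. w k * R i k))"
    if i: "i \<in> J" and nn: "\<And>s. s \<in> T i \<Longrightarrow> 0 \<le> (\<Sum>k<d. w k * damped_moment q k s)" for i w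
  proof -
    define L where "L t = (\<Sum>k<d. w k * damped_moment (Suc q) k t)" for t
    define g where "g t = (\<Sum>k<d. w k * damped_moment q k t)" for t
    have der: "(L has_real_derivative - g t) (at t)" for t
      unfolding L_def g_def sum_negf[symmetric]
      by (rule DERIV_cong[OF DERIV_sum[OF DERIV_cmult[OF damped_moment_has_derivative]]]) simp
    have qi: "q < i" "i < d" "c \<noteq> 0 \<Longrightarrow> u i \<ge> y i" using i u(1)[of i] by (auto simp: J_def)
    show ?thesis
    proof (cases "Suc i < d")
      case True
      have R: "(\<Sum>k<d. w k * R i k) = L (y i) - L (y (Suc i))"
        using True qi by (simp add: R_def L_def min_absorb2 sum_subtractf algebra_simps)
      have g: "0 \<le> g s" if "s \<in> {y i..y (Suc i)}" for s using nn[of s] that True by (simp add: T_def g_def)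
      show ?thesis
        unfolding R g_def[symmetric]
        using window_decrease(1)[OF der ord[OF True] g] window_decrease(2)[OF der ord[OF True] g, of "u i" c]
          u(2)[OF _ qi(1) True] qi by (cases "c = 0") (auto simp: U_def)
    next
      case False
      have R: "(\<Sum>k<d. w k * R i k) = L (y i)"
        using False qi by (simp add: R_def L_def min_absorb2)
      have g: "0 \<le> g s" if "s \<ge> y i" for s using nn[of s] that False by (simp add: T_def g_def)
      have lim: "(L \<longlongrightarrow> 0) at_top"
        unfolding L_def by (intro tendsto_null_sum tendsto_mult_right_zero damped_moment_tendsto_0)
      have 0: "0 \<le> L (y i)"
        by (rule tendsto_upperbound[OF lim eventually_mono[OF eventually_ge_at_top[of "y i"]]])
          (use window_decrease(1)[OF der] g in auto)
      have 1: "c \<le> L (y i)" if *: "c \<noteq> 0" "\<forall>s\<in>U i. c \<le> g s"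
      proof -
        have "((\<lambda>b. L b + c) \<longlongrightarrow> 0 + c) at_top" by (intro tendsto_intros lim)
        moreover have "\<forall>\<^sub>F b in at_top. L b + c \<le> L (y i)"
        proof (rule eventually_mono[OF eventually_ge_at_top[of "u i + 1"]])
          fix b assume b: "u i + 1 \<le> b"
          show "L b + c \<le> L (y i)"
            by (rule window_decrease(2)[OF der, of "y i" b "u i"]) (use b qi g * in \<open>auto simp: U_def\<close>)
        qed
        ultimately show ?thesis using tendsto_upperbound[of "\<lambda>b. L b + c" c at_top "L (y i)"] by auto
      qed
      show ?thesis unfolding R g_def[symmetric] using 0 1 by auto
    qed
  qed
  have mix: "Determinant.det (Matrix.mat d d (\<lambda>(i, k). if i \<in> J then damped_moment q k (s i) else R i k)) =
      stage d q (\<lambda>i. if q < i then s i else y i)" for s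
    unfolding stage_def by (rule det_cong) (auto simp: J_def R_def min_def)
  have nonneg': "0 \<le> stage d q (\<lambda>i. if q < i then s i else y i)" if s: "\<And>i. i \<in> J \<Longrightarrow> s i \<in> T i" for s
  proof (rule nonneg)
    fix i assume i: "Suc i < d"
    have "s i \<le> y (Suc i)" "y (Suc i) \<le> s (Suc i)" if "q < i"
      using s[of i] s[of "Suc i"] i that by (auto simp: J_def T_def split: if_splits)
    moreover have "y (Suc i) \<le> s (Suc i)" if "q < Suc i"
      using s[of "Suc i"] i that by (auto simp: J_def T_def split: if_splits)
    ultimately show "(if q < i then s i else y i) \<le> (if q < Suc i then s (Suc i) else y (Suc i))"
      using ord[OF i] by (auto intro: order_trans)
  qed
  have "c \<le> Determinant.det (Matrix.mat d d (\<lambda>(i, k). R i k))"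
  proof (rule det_ge_by_rows[where J = J and T = T and U = U and v = "\<lambda>i s k. damped_moment q k s"])
    show "0 \<le> (\<Sum>k<d. w k * R i k)" if "i \<in> J" "\<And>s. s \<in> T i \<Longrightarrow> 0 \<le> (\<Sum>k<d. w k * damped_moment q k s)" for i w
      using row[OF that] by blast
    show "c \<le> (\<Sum>k<d. w k * R i k)" if "i \<in> J" "\<And>s. s \<in> T i \<Longrightarrow> 0 \<le> (\<Sum>k<d. w k * damped_moment q k s)"
      "\<And>s. s \<in> U i \<Longrightarrow> c \<le> (\<Sum>k<d. w k * damped_moment q k s)" for i w
      using row[OF that(1,2)] that(3) by auto
    show "0 \<le> Determinant.det (Matrix.mat d d (\<lambda>(i, k). if i \<in> J then damped_moment q k (s i) else R i k))"
      if "\<And>i. i \<in> J \<Longrightarrow> s i \<in> T i" for s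
      unfolding mix using nonneg'[OF that] .
    show "c \<le> Determinant.det (Matrix.mat d d (\<lambda>(i, k). if i \<in> J then damped_moment q k (s i) else R i k))"
      if "\<And>i. i \<in> J \<Longrightarrow> s i \<in> U i" for s
      unfolding mix
      by (cases "c = 0")
        (use nonneg'[of s] big[of "\<lambda>i. if q < i then s i else y i"] UT that in \<open>auto simp: J_def U_def\<close>)
  qed (use UT in \<open>auto simp: J_def\<close>)
  also have "\<dots> = stage d (Suc q) y"
    unfolding stage_def R_def using det_subtract_next_row[of "\<lambda>i. q < i \<and> Suc i < d" d "\<lambda>i k. damped_moment (min i (Suc q)) k (y i)"]
    by simp
  finally show ?thesis .
qed

lemma stage_nonneg:
  "(\<And>i. Suc i < d \<Longrightarrow> y i \<le> y (Suc i)) \<Longrightarrow> 0 \<le> stage d q y"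
proof (induction q arbitrary: y)
  case 0
  have "y j \<le> y i" if "j \<le> i" "i < d" for i j
    using that by (induction i rule: dec_induct) (use 0 in \<open>force intro: order_trans\<close>)+
  then show ?case unfolding stage_0 by (auto intro!: mult_nonneg_nonneg prod_nonneg)
next
  case (Suc q)
  then show ?case by (intro stage_Suc_ge[where u = y]) auto
qed

text \<open>
  The unit intervals are nested so that each stage leaves room for the next: row \<open>i\<close> moves by at most a
  bounded amount at every stage \<open>q < i\<close>, the interval for \<open>i\<close> at stage \<open>q\<close> begins where its interval at
  stage \<open>q + 1\<close> ends, and it ends where the interval for \<open>i + 1\<close> at stage \<open>q + 1\<close> begins if
  \<open>x i = x (Suc i)\<close>. At stage \<open>0\<close> neighbouring points have been moved apart by at least \<open>1\<close>, while the
  weight \<open>exp (- (\<Sum>i<d. y i))\<close> has lost a constant factor only.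
\<close>

lemma stage_lower_bound:
  fixes x :: "nat \<Rightarrow> real"
  assumes x: "\<And>i. Suc i < d \<Longrightarrow> x i \<le> x (Suc i)"
  assumes "\<And>i. Suc i < d \<Longrightarrow> y i \<le> y (Suc i)"
  assumes "\<And>i. i \<le> q \<Longrightarrow> i < d \<Longrightarrow> y i = x i"
  assumes "\<And>i. q < i \<Longrightarrow> i < d \<Longrightarrow> y i \<in> {x i + 2 * real i - real q .. x i + 2 * real i - real q + 1}"
  shows "exp (- (real d)\<^sup>2) * exp (- (\<Sum>i<d. x i)) * (\<Prod>i<d. \<Prod>j<i. 1 + x i - x j) \<le> stage d q y"
  using assms(2-)
proof (induction q arbitrary: y)
  case 0
  have mono: "x j \<le> x i" if "j \<le> i" "i < d" for i j
    using that by (induction i rule: dec_induct) (use x in \<open>force intro: order_trans\<close>)+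
  have y: "x i + 2 * real i \<le> y i" "y i \<le> x i + (2 * real i + 1)" if "i < d" for i
    using 0(2)[of i] 0(3)[of i] that by (cases "i = 0"; auto)+
  have y': "y i \<le> x i + 2 * real i + (if i = 0 then 0 else 1)" if "i < d" for i
    using 0(2)[of i] 0(3)[of i] that by (cases "i = 0"; auto)
  have gap: "1 + x i - x j \<le> y i - y j" if "j < i" "i < d" for i j
  proof -
    have "real j + 1 \<le> real i" using that by simp
    then show ?thesis using y(1)[of i] y'[of j] that by (auto split: if_splits)
  qed
  have "(\<Sum>i<d. y i) \<le> (\<Sum>i<d. x i + (2 * real i + 1))" by (rule sum_mono) (use y in auto)
  also have "\<dots> = (\<Sum>i<d. x i) + (real d)\<^sup>2"
    unfolding sum.distrib by (induction d) (auto simp: power2_eq_square algebra_simps)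
  finally have "exp (- (real d)\<^sup>2) * exp (- (\<Sum>i<d. x i)) \<le> exp (- (\<Sum>i<d. y i))"
    by (simp add: exp_add[symmetric])
  moreover have "(\<Prod>i<d. \<Prod>j<i. 1 + x i - x j) \<le> (\<Prod>i<d. \<Prod>j<i. y i - y j)"
    using gap mono by (intro prod_mono conjI prod_nonneg) (auto intro: order_trans[OF _ gap] simp: add_increasing)
  ultimately show ?case unfolding stage_0
    using mono by (intro mult_mono) (auto intro!: prod_nonneg simp: add_increasing)
next
  case (Suc q)
  have mono: "x j \<le> x i" if "j \<le> i" "i < d" for i j
    using that by (induction i rule: dec_induct) (use x in \<open>force intro: order_trans\<close>)+
  show ?case
  proof (rule stage_Suc_ge[where u = "\<lambda>i. x i + 2 * real i - real q"])
    show "0 \<le> exp (- (real d)\<^sup>2) * exp (- (\<Sum>i<d. x i)) * (\<Prod>i<d. \<Prod>j<i. 1 + x i - x j)"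
      using mono by (auto intro!: mult_nonneg_nonneg prod_nonneg simp: add_increasing)
    show "y i \<le> x i + 2 * real i - real q" if "q < i" "i < d" for i
      using Suc.prems(2)[of i] Suc.prems(3)[of i] that by (cases "i = Suc q") auto
    show "x i + 2 * real i - real q + 1 \<le> y (Suc i)" if "q < i" "Suc i < d" for i
      using Suc.prems(3)[of "Suc i"] that x[of i] by auto
    show "0 \<le> stage d q s" if "\<And>i. Suc i < d \<Longrightarrow> s i \<le> s (Suc i)" for s
      using that by (rule stage_nonneg)
    fix s assume s: "\<And>i. i \<le> q \<Longrightarrow> s i = y i"
      "\<And>i. q < i \<Longrightarrow> i < d \<Longrightarrow> s i \<in> {x i + 2 * real i - real q..x i + 2 * real i - real q + 1}"
    show "exp (- (real d)\<^sup>2) * exp (- (\<Sum>i<d. x i)) * (\<Prod>i<d. \<Prod>j<i. 1 + x i - x j) \<le> stage d q s"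
    proof (rule Suc.IH)
      show "s i = x i" if "i \<le> q" "i < d" for i using s(1) Suc.prems(2) that by auto
      show "s i \<le> s (Suc i)" if "Suc i < d" for i
      proof -
        consider "Suc i \<le> q" | "i = q" | "q < i" by linarith
        then show ?thesis
        proof cases
          case 1
          then show ?thesis using s(1) Suc.prems(1)[OF that] by auto
        next
          case 2
          then show ?thesis using s(1)[of i] s(2)[of "Suc i"] Suc.prems(2)[of i] that x[OF that] by auto
        next
          case 3
          then show ?thesis using s(2)[of i] s(2)[of "Suc i"] that x[OF that] by auto
        qed
      qed
    qed (use s in auto)
  qed (use Suc.prems in auto)
qed

lemma det_gam_moment_ge:
  fixes x :: "nat \<Rightarrow> real"
  assumes x: "\<And>i. Suc i < d \<Longrightarrow> x i \<le> x (Suc i)"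
  shows "exp (- (real d)\<^sup>2) * (\<Prod>i<d. \<Prod>j<i. 1 + x i - x j) \<le>
    Determinant.det (Matrix.mat d d (\<lambda>(i, k). gam_moment i k (x i)))"
proof -
  have "stage d d x = exp (- (\<Sum>i<d. x i)) * Determinant.det (Matrix.mat d d (\<lambda>(i, k). gam_moment i k (x i)))"
    unfolding stage_def damped_moment_def det_scale_rows[symmetric] exp_minus_sum by (rule det_cong) simp
  with stage_lower_bound[of d x x d] x show ?thesis by auto
qed

section \<open>Hankel determinants of Hermite polynomials\<close>

text \<open>
  The probabilists' Hermite polynomials, orthogonal with respect to the standard Gaussian density.
\<close>

fun hermite :: "nat \<Rightarrow> real \<Rightarrow> real" where
  "hermite 0 y = 1"
| "hermite (Suc 0) y = y"
| "hermite (Suc (Suc n)) y = y * hermite (Suc n) y - real (Suc n) * hermite n y"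

lemma hermite_Suc: "hermite (Suc n) y = y * hermite n y - real n * hermite (n - 1) y"
  by (cases n) auto

definition falling :: "nat \<Rightarrow> nat \<Rightarrow> real" where
  "falling m k = (\<Prod>i<k. real m - real i)"

lemma falling_eq_0: "m < k \<Longrightarrow> falling m k = 0"
  unfolding falling_def by (intro prod_zero) auto

lemma falling_Suc: "falling m (Suc k) = falling m k * (real m - real k)"
  by (simp add: falling_def)

lemma falling_Suc_left: "falling (Suc m) (Suc k) = falling m (Suc k) + real (Suc k) * falling m k"
proof -
  have "falling (Suc m) (Suc k) = real (Suc m) * falling m k"
    unfolding falling_def by (subst prod.lessThan_Suc_shift) simp
  then show ?thesis by (simp add: falling_Suc algebra_simps)
qed

lemma falling_self: "falling k k = fact k"
proof (induction k)
  case (Suc k)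
  then show ?case using falling_Suc_left[of k k] falling_eq_0[of k "Suc k"] by simp
qed (simp add: falling_def)

text \<open>
  Up to sign the \<open>k\<close>-th derivative of the Hermite polynomial of index \<open>m\<close>. As a function of \<open>m\<close> it
  vanishes for \<open>m < k\<close>, which makes the matrix over \<open>m\<close> and \<open>k\<close> triangular.
\<close>

definition hermite_lowered :: "real \<Rightarrow> nat \<Rightarrow> nat \<Rightarrow> real" where
  "hermite_lowered y m k = (-1) ^ k * falling m k * hermite (m - k) y"

lemma hermite_lowered_Suc: "hermite_lowered y (Suc m) k = y * hermite_lowered y m k + hermite_lowered y m (Suc k) - real k * hermite_lowered y m (k - 1)"
proof (cases "k \<le> m")
  case True
  then have H: "hermite (Suc m - k) y = y * hermite (m - k) y - (real m - real k) * hermite (m - Suc k) y"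
    by (simp add: Suc_diff_le hermite_Suc of_nat_diff)
  have f: "falling (Suc m) k = falling m k + real k * falling m (k - 1)"
    by (cases k) (simp_all add: falling_Suc_left, simp add: falling_def)
  have "real k * falling m (k - 1) * (-1) ^ k * hermite (Suc m - k) y = - real k * hermite_lowered y m (k - 1)"
    by (cases k) (auto simp: hermite_lowered_def algebra_simps)
  moreover have "falling m k * (-1) ^ k * hermite (Suc m - k) y = y * hermite_lowered y m k + hermite_lowered y m (Suc k)"
    unfolding H by (simp add: hermite_lowered_def falling_Suc algebra_simps)
  ultimately show ?thesis by (simp add: hermite_lowered_def f algebra_simps)
next
  case False
  show ?thesis
  proof (cases "k = Suc m")
    case True
    then show ?thesis using falling_eq_0[of m "Suc m"] falling_eq_0[of m "Suc (Suc m)"]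
      by (simp add: hermite_lowered_def falling_Suc_left)
  next
    case neq: False
    with False obtain j where k: "k = Suc j" "m < j" by (cases k) auto
    then show ?thesis by (simp add: hermite_lowered_def falling_eq_0)
  qed
qed

text \<open>
  The coefficients that express the shift \<open>m \<mapsto> m + n\<close> of the Hermite index through the triangular family
  above. The recursion repeats the one for a single shift; the matrix of coefficients is unitriangular.
\<close>

fun hermite_connection :: "real \<Rightarrow> nat \<Rightarrow> nat \<Rightarrow> real" where
  "hermite_connection y 0 k = (if k = 0 then 1 else 0)"
| "hermite_connection y (Suc n) k = y * hermite_connection y n k + (if k = 0 then 0 else hermite_connection y n (k - 1)) - real (Suc k) * hermite_connection y n (Suc k)"

lemma hermite_connection_eq_0: "n < k \<Longrightarrow> hermite_connection y n k = 0"
  by (induction n arbitrary: k) auto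

lemma hermite_connection_diag: "hermite_connection y n n = 1"
  by (induction n) (auto simp: hermite_connection_eq_0)

lemma hermite_add: "hermite (m + n) y = (\<Sum>k\<le>n. hermite_connection y n k * hermite_lowered y m k)"
proof (induction n arbitrary: m)
  case 0
  then show ?case by (simp add: hermite_lowered_def falling_def)
next
  case (Suc n)
  let ?a = "hermite_connection y n"
  have "hermite (m + Suc n) y = (\<Sum>k\<le>n. ?a k * hermite_lowered y (Suc m) k)"
    using Suc.IH[of "Suc m"] by simp
  also have "\<dots> = (\<Sum>k\<le>n. ?a k * (y * hermite_lowered y m k)) + (\<Sum>k\<le>n. ?a k * hermite_lowered y m (Suc k))
      - (\<Sum>k\<le>n. ?a k * (real k * hermite_lowered y m (k - 1)))"
    by (simp add: hermite_lowered_Suc algebra_simps sum.distrib sum_subtractf)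
  also have "(\<Sum>k\<le>n. ?a k * (y * hermite_lowered y m k)) = (\<Sum>k\<le>Suc n. y * ?a k * hermite_lowered y m k)"
    by (simp add: hermite_connection_eq_0 algebra_simps)
  also have "(\<Sum>k\<le>n. ?a k * hermite_lowered y m (Suc k)) = (\<Sum>k\<le>Suc n. (if k = 0 then 0 else ?a (k - 1)) * hermite_lowered y m k)"
    by (subst sum.atMost_Suc_shift) simp
  also have "(\<Sum>k\<le>n. ?a k * (real k * hermite_lowered y m (k - 1))) = (\<Sum>k\<le>Suc (Suc n). ?a k * (real k * hermite_lowered y m (k - 1)))"
    by (simp add: hermite_connection_eq_0)
  also have "\<dots> = (\<Sum>k\<le>Suc n. real (Suc k) * ?a (Suc k) * hermite_lowered y m k)"
    by (subst sum.atMost_Suc_shift) (simp add: algebra_simps)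
  finally show ?case
    by (simp only: hermite_connection.simps left_diff_distrib distrib_right sum.distrib sum_subtractf)
qed

text \<open>
  The matrix is the product of a lower triangular matrix with diagonal \<open>(-1) ^ k * fact k\<close> and a
  unitriangular one. The value does not depend on \<open>y\<close>: this is what makes the limiting constant
  independent of the position of the endpoint.
\<close>

lemma det_hermite_hankel:
  "Determinant.det (Matrix.mat d d (\<lambda>(m, n). hermite (m + n) y)) = (\<Prod>k<d. (-1) ^ k * fact k)"
proof -
  let ?T = "Matrix.mat d d (\<lambda>(m, k). hermite_lowered y m k)"
  let ?A = "Matrix.mat d d (\<lambda>(k, n). hermite_connection y n k)"
  have "Determinant.det ?T = prod_list (diag_mat ?T)"
    by (rule det_lower_triangular[of d]) (auto simp: hermite_lowered_def falling_eq_0)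
  also have "\<dots> = (\<Prod>k<d. (-1) ^ k * fact k)"
    by (simp add: prod_list_diag_prod atLeast0LessThan hermite_lowered_def falling_self)
  finally have T: "Determinant.det ?T = (\<Prod>k<d. (-1) ^ k * fact k)" .
  have "Determinant.det ?A = prod_list (diag_mat ?A)"
    by (rule det_upper_triangular) (auto simp: upper_triangular_def hermite_connection_eq_0)
  also have "\<dots> = 1" by (simp add: prod_list_diag_prod hermite_connection_diag)
  finally have A: "Determinant.det ?A = 1" .
  have "?T * ?A = Matrix.mat d d (\<lambda>(m, n). hermite (m + n) y)"
    unfolding mat_mult_mat
  proof (intro cong_mat refl, clarsimp)
    fix m n assume "m < d" "n < d"
    then have "(\<Sum>k<d. hermite_lowered y m k * hermite_connection y n k) = (\<Sum>k\<le>n. hermite_lowered y m k * hermite_connection y n k)"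
      by (intro sum.mono_neutral_right) (auto simp: hermite_connection_eq_0)
    then show "(\<Sum>k<d. hermite_lowered y m k * hermite_connection y n k) = hermite (m + n) y"
      by (simp add: hermite_add mult.commute)
  qed
  then show ?thesis using T A det_mult[of ?T d ?A] by simp
qed

section \<open>Stirling's constant\<close>

text \<open>
  The logarithms of the sequence have summable increments, so the sequence \<open>a\<close> has a positive limit. The
  quotient \<open>a (2 * n) / a n ^ 2\<close> tends to the reciprocal of that limit, and is evaluated through the product formula for
  \<open>Gamma (1/2) = sqrt pi\<close>.
\<close>

lemma stirling_constant:
  "(\<lambda>n. sqrt n * (real n ^ n * exp (- real n) / fact n)) \<longlonglongrightarrow> 1 / sqrt (2 * pi)"
proof -
  define b where "b n = ln (sqrt (Suc n) * (real (Suc n) ^ Suc n * exp (- real (Suc n)) / fact (Suc n)))" for n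
  define a where "a n = sqrt n * (real n ^ n * exp (- real n) / fact n)" for n
  have b_alt: "b n = ln (real (Suc n)) / 2 + real (Suc n) * ln (real (Suc n)) - real (Suc n) - ln (fact (Suc n))" for n
    unfolding b_def by (simp add: ln_mult ln_div ln_sqrt ln_realpow del: fact_Suc) (simp add: algebra_simps)
  have step: "b (Suc n) - b n = (real n + 3/2) * ln (1 + 1 / (real n + 1)) - 1" for n
  proof -
    have 1: "ln (fact (Suc (Suc n)) :: real) = ln (real n + 2) + ln (fact (Suc n))"
      unfolding fact_Suc[of "Suc n"] by (subst ln_mult) (auto simp: add_ac)
    have 2: "ln (1 + 1 / (real n + 1)) = ln (real n + 2) - ln (real n + 1)"
      using ln_div[of "real n + 2" "real n + 1"] by (simp add: field_simps)
    have 3: "real (Suc (Suc n)) = real n + 2" "real (Suc n) = real n + 1" by simp_all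
    show ?thesis unfolding b_alt 1 2 3 by (simp add: algebra_simps add_divide_distrib del: fact_Suc)
  qed
  have "summable (\<lambda>n. b (Suc n) - b n)"
  proof (rule summable_comparison_test_bigo[where g = "\<lambda>n. 1 / real n ^ 2"])
    show "summable (\<lambda>n. norm (1 / real n ^ 2))"
      using inverse_power_summable[of 2, where 'a = real] by (simp add: inverse_eq_divide)
    show "(\<lambda>n. b (Suc n) - b n) \<in> O(\<lambda>n. 1 / real n ^ 2)" unfolding step by real_asymp
  qed
  then have "convergent (\<lambda>N. \<Sum>n<N. b (Suc n) - b n)" by (simp add: summable_iff_convergent)
  then have "convergent (\<lambda>N. b N - b 0)" by (simp add: sum_lessThan_telescope)
  then have "convergent (\<lambda>N. (b N - b 0) + b 0)" by (intro convergent_add convergent_const)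
  then obtain l where "b \<longlonglongrightarrow> l" by (auto simp: convergent_def)
  then have "(\<lambda>n. exp (b n)) \<longlonglongrightarrow> exp l" by (rule tendsto_exp)
  moreover have "exp (b n) = a (Suc n)" for n unfolding b_def a_def by (subst exp_ln) auto
  ultimately have "(\<lambda>n. a (Suc n)) \<longlonglongrightarrow> exp l" by simp
  then have a: "a \<longlonglongrightarrow> exp l" by (rule LIMSEQ_imp_Suc)
  have "(\<lambda>n. a (2 * n) / a n ^ 2) \<longlonglongrightarrow> exp l / exp l ^ 2"
    by (intro tendsto_intros a filterlim_compose[OF a]) (real_asymp | simp)+
  moreover have "(\<lambda>n. a (2 * n) / a n ^ 2) \<longlonglongrightarrow> sqrt 2 * sqrt pi"
  proof -
    have "(\<lambda>n. sqrt 2 * ((1 + 1 / (2 * real n)) * Gamma_series (1/2) n)) \<longlonglongrightarrow> sqrt 2 * (1 * Gamma (1/2))"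
      by (intro tendsto_intros Gamma_series_LIMSEQ) real_asymp
    moreover have "\<forall>\<^sub>F n in sequentially. sqrt 2 * ((1 + 1 / (2 * real n)) * Gamma_series (1/2) n) = a (2 * n) / a n ^ 2"
    proof (rule eventually_mono[OF eventually_gt_at_top[of 0]])
      fix n :: nat assume n: "n > 0"
      let ?p = "pochhammer (1/2 :: real) n"
      have p: "?p > 0" by (rule pochhammer_pos) simp
      have ex: "exp (ln (real n) / 2) = sqrt n"
        using n by (simp add: powr_half_sqrt[symmetric] powr_def)
      have 1: "Gamma_series (1/2) n = fact n * sqrt n / (?p * (1/2 + real n))"
        unfolding Gamma_series_def by (simp add: ex pochhammer_Suc)
      have 2: "a (2 * n) / a n ^ 2 = sqrt 2 * (fact n / (?p * sqrt n))"
      proof -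
        have "a (2 * n) / a n ^ 2 = (sqrt (2 * real n) * ((2 * real n) ^ (2 * n) * exp (- (2 * real n)) / (2 ^ (2 * n) * ?p * fact n))) /
           (real n * ((real n ^ n) ^ 2 * exp (- real n) ^ 2 / fact n ^ 2))"
          unfolding a_def by (simp add: fact_double[where 'a = real] power_mult_distrib power_divide)
        also have "exp (- real n) ^ 2 = exp (- (2 * real n))" by (simp add: exp_double[symmetric])
        also have "(2 * real n) ^ (2 * n) = 2 ^ (2 * n) * (real n ^ n) ^ 2"
          by (simp add: power_mult_distrib power_mult[symmetric] mult.commute)
        also have "(sqrt (2 * real n) * (2 ^ (2 * n) * (real n ^ n) ^ 2 * exp (- (2 * real n)) / (2 ^ (2 * n) * ?p * fact n))) /
           (real n * ((real n ^ n) ^ 2 * exp (- (2 * real n)) / fact n ^ 2)) = sqrt (2 * real n) * fact n / (?p * real n)"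
          using n p by (simp add: divide_simps power2_eq_square)
        also have "\<dots> = sqrt 2 * (fact n / (?p * sqrt n))"
          using n p by (simp add: real_sqrt_mult divide_simps)
        finally show ?thesis .
      qed
      show "sqrt 2 * ((1 + 1 / (2 * real n)) * Gamma_series (1/2) n) = a (2 * n) / a n ^ 2"
      proof -
        have "1 + 1 / (2 * real n) = (1/2 + real n) / n" using n by (simp add: field_simps)
        moreover have "1/2 + real n \<noteq> 0" by linarith
        moreover have "sqrt n / n = 1 / sqrt n" using n by (simp add: sqrt_divide_self_eq inverse_eq_divide)
        ultimately show ?thesis unfolding 1 2 using n p by (simp add: divide_simps)
      qed
    qed
    ultimately have "(\<lambda>n. a (2 * n) / a n ^ 2) \<longlonglongrightarrow> sqrt 2 * (1 * Gamma (1/2))" by (rule Lim_transform_eventually)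
    then show ?thesis by (simp add: Gamma_one_half_real)
  qed
  ultimately have "exp l / exp l ^ 2 = sqrt 2 * sqrt pi" by (rule LIMSEQ_unique)
  then have "exp l = 1 / sqrt (2 * pi)" by (simp add: power2_eq_square real_sqrt_mult field_simps)
  with a show ?thesis unfolding a_def by simp
qed

section \<open>Limits along a filter with a bounded moving target\<close>

text \<open>
  The target \<open>g\<close> moves with the parameters, and uniformity in these is encoded in the filter. Boundedness
  of the target makes the relation compatible with products and the exponential.
\<close>

definition tracks :: "'a filter \<Rightarrow> ('a \<Rightarrow> real) \<Rightarrow> ('a \<Rightarrow> real) \<Rightarrow> bool" where
  "tracks F f g \<longleftrightarrow> ((\<lambda>a. f a - g a) \<longlongrightarrow> 0) F \<and> (\<exists>B. \<forall>\<^sub>F a in F. \<bar>g a\<bar> \<le> B)"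

lemma tracks_const: "(f \<longlongrightarrow> c) F \<Longrightarrow> tracks F f (\<lambda>_. c)"
  unfolding tracks_def by (auto simp: LIM_zero intro!: exI[of _ "\<bar>c\<bar>"])

lemma tracks_cong: "tracks F f g \<Longrightarrow> \<forall>\<^sub>F a in F. f a = f' a \<Longrightarrow> tracks F f' g"
  unfolding tracks_def
  by (auto elim: Lim_transform_eventually eventually_mono intro: Lim_transform_eventually[of "\<lambda>a. f a - g a"])

lemma tracks_add:
  assumes "tracks F f g" "tracks F f' g'"
  shows "tracks F (\<lambda>a. f a + f' a) (\<lambda>a. g a + g' a)"
proof -
  obtain B B' where B: "\<forall>\<^sub>F a in F. \<bar>g a\<bar> \<le> B" "\<forall>\<^sub>F a in F. \<bar>g' a\<bar> \<le> B'"
    using assms unfolding tracks_def by blast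
  have "\<forall>\<^sub>F a in F. \<bar>g a + g' a\<bar> \<le> B + B'"
    using B by eventually_elim linarith
  moreover have "((\<lambda>a. (f a - g a) + (f' a - g' a)) \<longlongrightarrow> 0 + 0) F"
    using assms unfolding tracks_def by (intro tendsto_add) auto
  ultimately show ?thesis unfolding tracks_def by (auto simp: algebra_simps)
qed

lemma tracks_mult:
  assumes "tracks F f g" "tracks F f' g'"
  shows "tracks F (\<lambda>a. f a * f' a) (\<lambda>a. g a * g' a)"
proof -
  obtain B B' where B: "\<forall>\<^sub>F a in F. \<bar>g a\<bar> \<le> B" "\<forall>\<^sub>F a in F. \<bar>g' a\<bar> \<le> B'"
    using assms unfolding tracks_def by blast
  have l: "((\<lambda>a. f a - g a) \<longlongrightarrow> 0) F" "((\<lambda>a. f' a - g' a) \<longlongrightarrow> 0) F"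
    using assms unfolding tracks_def by auto
  have "\<forall>\<^sub>F a in F. \<bar>g a * g' a\<bar> \<le> B * B'"
    using B by eventually_elim (auto simp: abs_mult intro!: mult_mono intro: order_trans[OF abs_ge_zero])
  moreover have "((\<lambda>a. (f a - g a) * (f' a - g' a) + (f a - g a) * g' a + g a * (f' a - g' a)) \<longlongrightarrow> 0 * 0 + 0 + 0) F"
    using l B by (intro tendsto_add tendsto_mult lim_null_mult_left_bounded[of g B] lim_null_mult_right_bounded[of _ _ _ B']) auto
  ultimately show ?thesis unfolding tracks_def by (auto simp: algebra_simps)
qed

lemma tracks_cmult: "tracks F f g \<Longrightarrow> tracks F (\<lambda>a. c * f a) (\<lambda>a. c * g a)"
  by (rule tracks_mult[OF tracks_const]) auto

lemma tracks_diff: "tracks F f g \<Longrightarrow> tracks F f' g' \<Longrightarrow> tracks F (\<lambda>a. f a - f' a) (\<lambda>a. g a - g' a)"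
  using tracks_add[of F f g "\<lambda>a. - 1 * f' a" "\<lambda>a. - 1 * g' a"] tracks_cmult[of F f' g' "- 1"] by simp

lemma tracks_sum: "(\<And>i. i \<in> I \<Longrightarrow> tracks F (f i) (g i)) \<Longrightarrow> tracks F (\<lambda>a. \<Sum>i\<in>I. f i a) (\<lambda>a. \<Sum>i\<in>I. g i a)"
  by (induction I rule: infinite_finite_induct) (auto intro: tracks_add tracks_const)

lemma tracks_prod: "(\<And>i. i \<in> I \<Longrightarrow> tracks F (f i) (g i)) \<Longrightarrow> tracks F (\<lambda>a. \<Prod>i\<in>I. f i a) (\<lambda>a. \<Prod>i\<in>I. g i a)"
  by (induction I rule: infinite_finite_induct) (auto intro: tracks_mult tracks_const)

lemma tracks_exp:
  assumes "tracks F f g"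
  shows "tracks F (\<lambda>a. exp (f a)) (\<lambda>a. exp (g a))"
proof -
  obtain B where B: "\<forall>\<^sub>F a in F. \<bar>g a\<bar> \<le> B"
    using assms unfolding tracks_def by blast
  have b: "\<forall>\<^sub>F a in F. \<bar>exp (g a)\<bar> \<le> exp B"
    using B by eventually_elim auto
  have "((\<lambda>a. exp (f a - g a) - 1) \<longlongrightarrow> exp 0 - 1) F"
    using assms unfolding tracks_def by (intro tendsto_intros) auto
  then have "((\<lambda>a. exp (g a) * (exp (f a - g a) - 1)) \<longlongrightarrow> 0) F"
    using b by (intro lim_null_mult_left_bounded[of _ "exp B"]) auto
  then have "((\<lambda>a. exp (f a) - exp (g a)) \<longlongrightarrow> 0) F" by (simp add: exp_diff algebra_simps)
  then show ?thesis using b unfolding tracks_def by blast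
qed

lemma tracks_det:
  assumes "\<And>i k. i < d \<Longrightarrow> k < d \<Longrightarrow> tracks F (\<lambda>a. M a i k) (\<lambda>a. N a i k)"
  shows "tracks F (\<lambda>a. Determinant.det (Matrix.mat d d (\<lambda>(i, k). M a i k)))
    (\<lambda>a. Determinant.det (Matrix.mat d d (\<lambda>(i, k). N a i k)))"
proof -
  have *: "Determinant.det (Matrix.mat d d (\<lambda>(i, k). M i k)) =
      (\<Sum>p\<in>{p. p permutes {0..<d}}. signof p * (\<Prod>i = 0..<d. M i (p i)))" for M :: "nat \<Rightarrow> nat \<Rightarrow> real"
    by (subst det_def'[of _ d]) (auto intro!: sum.cong prod.cong dest: permutes_in_image[of _ "{0..<d}"])
  show ?thesis
    unfolding * by (intro tracks_sum tracks_cmult tracks_prod assms) (auto dest: permutes_in_image[of _ "{0..<d}"])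
qed

section \<open>Derivatives of gamma densities near the mode\<close>

text \<open>
  The \<open>k\<close>-th derivative of the gamma density \<open>gam r\<close>, extended analytically to the whole line. The
  extension keeps the mean value theorem free of the cutoff at the origin; recursion uses that
  differentiation of a gamma density lowers the shape: \<open>f\<^sub>r' = f\<^bsub>r-1\<^esub> - f\<^sub>r\<close>.
\<close>

fun gam_deriv :: "nat \<Rightarrow> nat \<Rightarrow> real \<Rightarrow> real" where
  "gam_deriv 0 r u = u ^ (r - 1) / fact (r - 1) * exp (- u)"
| "gam_deriv (Suc k) r u = gam_deriv k (r - 1) u - gam_deriv k r u"

lemma gam_deriv_has_derivative: "k + 2 \<le> r \<Longrightarrow> (gam_deriv k r has_real_derivative gam_deriv (Suc k) r u) (at u)"
proof (induction k arbitrary: r)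
  case 0
  then obtain m where r: "r = Suc (Suc m)" by (auto simp: le_iff_add)
  have *: "real (Suc m) * u ^ m / fact (Suc m) = u ^ m / fact m"
    by (simp add: divide_simps)
  have "((\<lambda>u. u ^ Suc m / fact (Suc m) * exp (- u)) has_real_derivative
      (real (Suc m) * u ^ m / fact (Suc m)) * exp (- u) + u ^ Suc m / fact (Suc m) * (- exp (- u))) (at u)"
    by (auto intro!: derivative_eq_intros simp: diff_divide_distrib simp del: fact_Suc power_Suc)
  then show ?case unfolding * by (simp add: r gam_deriv.simps(1)[abs_def] diff_divide_distrib del: fact_Suc power_Suc)
next
  case (Suc k)
  have "(gam_deriv k (r - 1) has_real_derivative gam_deriv (Suc k) (r - 1) u) (at u)"
    "(gam_deriv k r has_real_derivative gam_deriv (Suc k) r u) (at u)"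
    using Suc.prems by (intro Suc.IH; simp)+
  then show ?case unfolding gam_deriv.simps(2)[abs_def, of k] gam_deriv.simps(2)[of "Suc k"]
    by (rule DERIV_diff)
qed

text \<open>
  The identity \<open>u f' = (r - 1 - u) f\<close>, differentiated \<open>k\<close> times. Under the scaling \<open>u = n + y sqrt n\<close> it
  becomes the three-term recurrence of the Hermite polynomials.
\<close>

lemma gam_deriv_recurrence:
  "k + 2 \<le> r \<Longrightarrow> u * gam_deriv (Suc k) r u = (real r - 1 - real k - u) * gam_deriv k r u - real k * gam_deriv (k - 1) r u"
proof (induction k arbitrary: r)
  case 0
  then obtain m where r: "r = Suc (Suc m)" by (auto simp: le_iff_add)
  show ?case unfolding r by (simp add: divide_simps) (simp add: algebra_simps)
next
  case (Suc k)
  have 1: "u * gam_deriv (Suc k) (r - 1) u = (real (r - 1) - 1 - real k - u) * gam_deriv k (r - 1) u - real k * gam_deriv (k - 1) (r - 1) u"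
    using Suc.prems by (intro Suc.IH) simp
  have 2: "u * gam_deriv (Suc k) r u = (real r - 1 - real k - u) * gam_deriv k r u - real k * gam_deriv (k - 1) r u"
    using Suc.prems by (intro Suc.IH) simp
  have 3: "real (r - 1) = real r - 1" using Suc.prems by simp
  have 4: "real k * gam_deriv (k - 1) (r - 1) u - real k * gam_deriv (k - 1) r u = real k * gam_deriv k r u"
    by (cases k) (simp_all add: algebra_simps)
  have "u * gam_deriv (Suc (Suc k)) r u = u * gam_deriv (Suc k) (r - 1) u - u * gam_deriv (Suc k) r u"
    by (simp only: gam_deriv.simps(2)[of "Suc k"] right_diff_distrib)
  also have "\<dots> = (real r - 2 - real k - u) * gam_deriv k (r - 1) u - (real r - 1 - real k - u) * gam_deriv k r u
      - (real k * gam_deriv (k - 1) (r - 1) u - real k * gam_deriv (k - 1) r u)"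
    unfolding 1 2 3 by (simp add: algebra_simps)
  also have "\<dots> = (real r - 2 - real k - u) * gam_deriv (Suc k) r u - real (Suc k) * gam_deriv k r u"
    unfolding 4 by (simp add: algebra_simps)
  finally show ?case by (simp add: algebra_simps)
qed


lemma fact_eq_prod_falling: "b \<le> n \<Longrightarrow> (fact n :: real) = fact (n - b) * (\<Prod>i<b. real n - real i)"
proof (induction b)
  case (Suc b)
  then obtain m where m: "n = b + Suc m" by (metis add_Suc_right le_Suc_ex add_Suc)
  have "(fact n :: real) = fact (n - b) * (\<Prod>i<b. real n - real i)" using Suc by simp
  also have "fact (n - b) = fact (n - Suc b) * (real n - real b)" by (simp add: m)
  finally show ?case by (simp add: algebra_simps)
qed simp

text \<open>
  The local limit theorem for the gamma density. Stirling's formula gives the constant, and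
  \<open>n (ln (1 + t) - t) \<approx> - y\<^sup>2 / 2\<close> for \<open>t \<approx> y / sqrt n\<close> the exponent. A bounded shift \<open>c\<close> of the shape only
  contributes factors that tend to \<open>1\<close>.
\<close>

lemma gam_deriv_0_tracks:
  fixes n :: "'a \<Rightarrow> nat"
  assumes n: "filterlim n at_top F"
  assumes s: "tracks F (\<lambda>a. (u a - real (n a)) / sqrt (n a)) y"
  shows "tracks F (\<lambda>a. sqrt (n a) * gam_deriv 0 (n a - c) (u a)) (\<lambda>a. exp (- (y a)\<^sup>2 / 2) / sqrt (2 * pi))"
    and "((\<lambda>a. real (n a) / u a) \<longlongrightarrow> 1) F"
proof -
  define t where "t a = (u a - real (n a)) / real (n a)" for a
  \<comment> \<open>The Taylor remainder divided by \<open>t\<^sup>2\<close>, extended continuously: \<open>t a = 0\<close> may occur along the filter.\<close>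
  define g where "g t = (if t = 0 then - 1 / 2 else (ln (1 + t) - t) / t ^ 2)" for t :: real
  have rn: "filterlim (\<lambda>a. real (n a)) at_top F"
    by (rule filterlim_compose[OF filterlim_real_sequentially n])
  have pos: "\<forall>\<^sub>F a in F. n a > 0" by (rule eventually_compose_filterlim[OF eventually_gt_at_top n])
  have isq: "((\<lambda>a. 1 / sqrt (n a)) \<longlongrightarrow> 0) F"
    by (rule filterlim_compose[OF _ rn]) real_asymp
  have "tracks F (\<lambda>a. (u a - real (n a)) / sqrt (n a) * (1 / sqrt (n a))) (\<lambda>a. y a * 0)"
    by (rule tracks_mult[OF s tracks_const[OF isq]])
  then have "((\<lambda>a. (u a - real (n a)) / sqrt (n a) * (1 / sqrt (n a))) \<longlongrightarrow> 0) F"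
    by (simp add: tracks_def)
  then have t: "(t \<longlongrightarrow> 0) F" by (simp add: t_def[abs_def])
  have ut: "\<forall>\<^sub>F a in F. u a / real (n a) = 1 + t a"
    using pos by eventually_elim (simp add: t_def field_simps)
  have "((\<lambda>a. 1 / (1 + t a)) \<longlongrightarrow> 1 / (1 + 0)) F" by (intro tendsto_intros t) auto
  moreover have "\<forall>\<^sub>F a in F. 1 / (1 + t a) = real (n a) / u a"
    using ut by eventually_elim (metis divide_divide_eq_right mult_1)
  ultimately show nu: "((\<lambda>a. real (n a) / u a) \<longlongrightarrow> 1) F"
    by (simp add: Lim_transform_eventually)
  have "((\<lambda>t::real. (ln (1 + t) - t) / t ^ 2) \<longlongrightarrow> - 1 / 2) (at 0)" by real_asymp
  moreover have "(g \<longlongrightarrow> - 1 / 2) (at 0) \<longleftrightarrow> ((\<lambda>t::real. (ln (1 + t) - t) / t ^ 2) \<longlongrightarrow> (- 1 / 2 :: real)) (at 0)"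
    by (rule LIM_equal) (simp add: g_def)
  ultimately have "isCont g 0" by (simp add: isCont_def g_def)
  then have "((\<lambda>a. g (t a)) \<longlongrightarrow> g 0) F" using t by (rule isCont_tendsto_compose)
  then have gt: "((\<lambda>a. g (t a)) \<longlongrightarrow> - 1 / 2) F" by (simp add: g_def)
  have E: "tracks F (\<lambda>a. exp ((u a - real (n a)) / sqrt (n a) * ((u a - real (n a)) / sqrt (n a)) * g (t a)))
     (\<lambda>a. exp (y a * y a * (- 1 / 2)))"
    by (intro tracks_exp tracks_mult s tracks_const gt)
  define b where "b = c + 1"
  have "((\<lambda>a. real (n a) / u a * (1 - real i * (1 / real (n a)))) \<longlongrightarrow> 1 * (1 - real i * 0)) F" for i
    by (intro tendsto_intros nu filterlim_compose[OF _ rn, of "\<lambda>x. 1 / x"]) real_asymp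
  then have P: "((\<lambda>a. \<Prod>i<b. real (n a) / u a * (1 - real i * (1 / real (n a)))) \<longlongrightarrow> (\<Prod>i<b. 1)) F"
    by (intro tendsto_prod) auto
  have S: "((\<lambda>a. sqrt (n a) * (real (n a) ^ n a * exp (- real (n a)) / fact (n a))) \<longlongrightarrow> 1 / sqrt (2 * pi)) F"
    by (rule filterlim_compose[OF stirling_constant n])
  have main: "tracks F (\<lambda>a. sqrt (n a) * (real (n a) ^ n a * exp (- real (n a)) / fact (n a)) *
      exp ((u a - real (n a)) / sqrt (n a) * ((u a - real (n a)) / sqrt (n a)) * g (t a)) *
      (\<Prod>i<b. real (n a) / u a * (1 - real i * (1 / real (n a)))))
    (\<lambda>a. 1 / sqrt (2 * pi) * exp (y a * y a * (- 1 / 2)) * 1)"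
    using P by (intro tracks_mult tracks_const S E) simp
  have big: "\<forall>\<^sub>F a in F. n a \<ge> b" using n unfolding filterlim_at_top by blast
  have tpos: "\<forall>\<^sub>F a in F. t a > - 1" using t by (rule order_tendstoD) simp
  have "\<forall>\<^sub>F a in F. sqrt (n a) * (real (n a) ^ n a * exp (- real (n a)) / fact (n a)) *
      exp ((u a - real (n a)) / sqrt (n a) * ((u a - real (n a)) / sqrt (n a)) * g (t a)) *
      (\<Prod>i<b. real (n a) / u a * (1 - real i * (1 / real (n a)))) = sqrt (n a) * gam_deriv 0 (n a - c) (u a)"
    using pos big ut tpos
  proof eventually_elim
    fix a assume a: "n a > 0" "n a \<ge> b" "u a / real (n a) = 1 + t a" "t a > - 1"
    let ?n = "real (n a)"
    have u1: "u a = ?n * (1 + t a)" using a by (simp add: field_simps)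
    moreover have "?n * (1 + t a) > 0" using a by (intro mult_pos_pos) auto
    ultimately have u: "u a = ?n * (1 + t a)" "u a > 0" by simp_all
    have ex: "(u a - ?n) / sqrt ?n * ((u a - ?n) / sqrt ?n) * g (t a) = ?n * (ln (1 + t a) - t a)"
    proof (cases "t a = 0")
      case False
      have "(u a - ?n) / sqrt ?n * ((u a - ?n) / sqrt ?n) = ?n * (t a)\<^sup>2"
        using a(1) by (simp add: u(1) power2_eq_square field_simps)
      then show ?thesis using False by (simp add: g_def)
    qed (use a u in auto)
    have "exp (?n * (ln (1 + t a) - t a)) = exp (?n * ln (1 + t a)) * exp (- (?n * t a))"
      by (simp add: exp_diff exp_minus field_simps)
    also have "exp (?n * ln (1 + t a)) = (1 + t a) ^ n a"
      using a(4) by (subst exp_of_nat_mult) simp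
    finally have ex2: "exp (?n * (ln (1 + t a) - t a)) = (1 + t a) ^ n a * exp (- (?n * t a))" .
    have pr: "(\<Prod>i<b. ?n / u a * (1 - real i * (1 / ?n))) = (\<Prod>i<b. ?n - real i) / u a ^ b"
    proof -
      have "(\<Prod>i<b. ?n / u a * (1 - real i * (1 / ?n))) = (\<Prod>i<b. (?n - real i) / u a)"
        by (rule prod.cong) (use a(1) u(2) in \<open>auto simp: field_simps\<close>)
      then show ?thesis by (simp add: prod_dividef)
    qed
    have nb: "n a = (n a - b) + b" using a(2) by simp
    have "u a ^ (n a - b) * u a ^ b = u a ^ n a" using a(2) by (simp add: power_add[symmetric])
    then have up: "u a ^ (n a - b) = ?n ^ n a * (1 + t a) ^ n a / u a ^ b"
      using u by (simp add: power_mult_distrib[symmetric] field_simps)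
    have ee: "exp (- u a) = exp (- ?n) * exp (- (?n * t a))" by (simp add: u(1) exp_add[symmetric] algebra_simps)
    have nz: "(\<Prod>i<b. ?n - real i) \<noteq> 0" using a(2) by (auto simp: )
    have ncb: "n a - c - 1 = n a - b" by (simp add: b_def)
    show "sqrt ?n * (?n ^ n a * exp (- ?n) / fact (n a)) *
      exp ((u a - ?n) / sqrt ?n * ((u a - ?n) / sqrt ?n) * g (t a)) *
      (\<Prod>i<b. ?n / u a * (1 - real i * (1 / ?n))) = sqrt ?n * gam_deriv 0 (n a - c) (u a)"
      unfolding ex ex2 pr gam_deriv.simps ncb up ee fact_eq_prod_falling[OF a(2)]
      using nz u(2) by (simp add: divide_simps)
  qed
  from tracks_cong[OF main this]
  show "tracks F (\<lambda>a. sqrt (n a) * gam_deriv 0 (n a - c) (u a)) (\<lambda>a. exp (- (y a)\<^sup>2 / 2) / sqrt (2 * pi))"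
    by (simp add: power2_eq_square)
qed

text \<open>
  Induction along the recurrence: each derivative costs a factor \<open>sqrt n\<close>.
\<close>

lemma gam_deriv_tracks:
  fixes n :: "'a \<Rightarrow> nat"
  assumes n: "filterlim n at_top F"
  assumes s: "tracks F (\<lambda>a. (u a - real (n a)) / sqrt (n a)) y"
  shows "tracks F (\<lambda>a. sqrt (n a) ^ Suc k * gam_deriv k (n a - c) (u a))
    (\<lambda>a. (-1) ^ k * hermite k (y a) * (exp (- (y a)\<^sup>2 / 2) / sqrt (2 * pi)))"
proof (induction k rule: less_induct)
  case (less k)
  show ?case
  proof (cases k)
    case 0
    then show ?thesis using gam_deriv_0_tracks(1)[OF n s] by simp
  next
    case (Suc j)
    let ?\<phi> = "\<lambda>a. exp (- (y a)\<^sup>2 / 2) / sqrt (2 * pi)"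
    have rn: "filterlim (\<lambda>a. real (n a)) at_top F"
      by (rule filterlim_compose[OF filterlim_real_sequentially n])
    have isq: "((\<lambda>a. 1 / sqrt (n a)) \<longlongrightarrow> 0) F"
      by (rule filterlim_compose[OF _ rn]) real_asymp
    have 1: "tracks F (\<lambda>a. sqrt (n a) ^ Suc j * gam_deriv j (n a - c) (u a)) (\<lambda>a. (-1) ^ j * hermite j (y a) * ?\<phi> a)"
      using less.IH[of j] Suc by simp
    have 2: "tracks F (\<lambda>a. real j * (sqrt (n a) ^ j * gam_deriv (j - 1) (n a - c) (u a)))
       (\<lambda>a. real j * ((-1) ^ (j - 1) * hermite (j - 1) (y a) * ?\<phi> a))"
    proof (cases j)
      case 0
      then show ?thesis by (simp add: tracks_const)
    next
      case (Suc i)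
      then show ?thesis using less.IH[of i] \<open>k = Suc j\<close> by (intro tracks_cmult) simp
    qed
    have 3: "tracks F (\<lambda>a. real (n a) / u a * ((- 1 * ((u a - real (n a)) / sqrt (n a)) - (real c + 1 + real j) * (1 / sqrt (n a)))
        * (sqrt (n a) ^ Suc j * gam_deriv j (n a - c) (u a)) - real j * (sqrt (n a) ^ j * gam_deriv (j - 1) (n a - c) (u a))))
      (\<lambda>a. 1 * ((- 1 * y a - (real c + 1 + real j) * 0) * ((-1) ^ j * hermite j (y a) * ?\<phi> a)
        - real j * ((-1) ^ (j - 1) * hermite (j - 1) (y a) * ?\<phi> a)))"
      by (intro tracks_mult tracks_diff 1 2 s tracks_const gam_deriv_0_tracks(2)[OF n s] isq tendsto_const)
    have 4: "(\<lambda>a. 1 * ((- 1 * y a - (real c + 1 + real j) * 0) * ((-1) ^ j * hermite j (y a) * ?\<phi> a)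
        - real j * ((-1) ^ (j - 1) * hermite (j - 1) (y a) * ?\<phi> a))) = (\<lambda>a. (-1) ^ k * hermite k (y a) * ?\<phi> a)"
      unfolding Suc hermite_Suc by (rule ext, cases j) (simp_all add: algebra_simps add_divide_distrib)
    have big: "\<forall>\<^sub>F a in F. n a \<ge> j + c + 2" using n unfolding filterlim_at_top by blast
    have nu: "\<forall>\<^sub>F a in F. real (n a) / u a > 0"
      by (rule order_tendstoD[OF gam_deriv_0_tracks(2)[OF n s]]) simp
    show ?thesis
      using 3 unfolding 4
    proof (rule tracks_cong)
      show "\<forall>\<^sub>F a in F. real (n a) / u a * ((- 1 * ((u a - real (n a)) / sqrt (n a)) - (real c + 1 + real j) * (1 / sqrt (n a)))
        * (sqrt (n a) ^ Suc j * gam_deriv j (n a - c) (u a)) - real j * (sqrt (n a) ^ j * gam_deriv (j - 1) (n a - c) (u a)))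
        = sqrt (n a) ^ Suc k * gam_deriv k (n a - c) (u a)"
        using big nu
      proof eventually_elim
        fix a assume a: "n a \<ge> j + c + 2" "real (n a) / u a > 0"
        define r where "r = sqrt (n a)"
        have r: "r > 0" "real (n a) = r * r" using a(1) by (auto simp: r_def)
        have u: "u a \<noteq> 0" using a(2) by auto
        have rc: "real (n a - c) = r * r - real c" using a(1) r(2) by (simp add: of_nat_diff)
        have "u a * gam_deriv k (n a - c) (u a) = (r * r - real c - 1 - real j - u a) * gam_deriv j (n a - c) (u a)
           - real j * gam_deriv (j - 1) (n a - c) (u a)"
          using gam_deriv_recurrence[of j "n a - c" "u a"] a(1) unfolding Suc rc by simp
        then have D: "gam_deriv k (n a - c) (u a) = ((r * r - real c - 1 - real j - u a) * gam_deriv j (n a - c) (u a)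
           - real j * gam_deriv (j - 1) (n a - c) (u a)) / u a"
          using u by (simp add: field_simps)
        show "real (n a) / u a * ((- 1 * ((u a - real (n a)) / sqrt (n a)) - (real c + 1 + real j) * (1 / sqrt (n a)))
          * (sqrt (n a) ^ Suc j * gam_deriv j (n a - c) (u a)) - real j * (sqrt (n a) ^ j * gam_deriv (j - 1) (n a - c) (u a)))
          = sqrt (n a) ^ Suc k * gam_deriv k (n a - c) (u a)"
          unfolding r_def[symmetric] D unfolding Suc r(2)
          using r(1) u by (simp add: field_simps)
      qed
    qed
  qed
qed


section \<open>The determinant of the gamma kernel\<close>

lemma prod_double_power: "(\<Prod>i<d. r ^ i) * (\<Prod>i<d. r ^ Suc i) = (r :: real) ^ (d * d)"
proof (induction d)
  case (Suc d)
  have "(\<Prod>i<Suc d. r ^ i) * (\<Prod>i<Suc d. r ^ Suc i) = ((\<Prod>i<d. r ^ i) * (\<Prod>i<d. r ^ Suc i)) * (r ^ d * r ^ Suc d)"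
    by (simp add: mult_ac)
  also have "\<dots> = r ^ (Suc d * Suc d)" unfolding Suc by (simp add: power_add mult_ac)
  finally show ?case .
qed simp

lemma det_scale_rows_cols:
  fixes M :: "nat \<Rightarrow> nat \<Rightarrow> real"
  shows "Determinant.det (Matrix.mat d d (\<lambda>(i, k). a i * b k * M i k)) =
    (\<Prod>i<d. a i) * (\<Prod>k<d. b k) * Determinant.det (Matrix.mat d d (\<lambda>(i, k). M i k))"
proof -
  have "Determinant.det (Matrix.mat d d (\<lambda>(i, k). a i * b k * M i k)) =
      (\<Prod>i<d. a i) * Determinant.det (Matrix.mat d d (\<lambda>(i, k). b k * M i k))"
    unfolding det_scale_rows[symmetric] by (simp only: mult.assoc)
  also have "Determinant.det (Matrix.mat d d (\<lambda>(i, k). b k * M i k)) =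
      Determinant.det (Matrix.mat d d (\<lambda>(i, k). b i * M k i))"
    by (rule det_swap_indices)
  also have "\<dots> = (\<Prod>k<d. b k) * Determinant.det (Matrix.mat d d (\<lambda>(i, k). M i k))"
    unfolding det_scale_rows by (simp only: det_swap_indices[of d M])
  finally show ?thesis by simp
qed

lemma det_hermite_signed:
  "Determinant.det (Matrix.mat d d (\<lambda>(k, i). (-1) ^ i * ((-1) ^ (i + k) * hermite (i + k) y * c))) = c ^ d * (\<Prod>k<d. fact k)"
proof -
  have "Determinant.det (Matrix.mat d d (\<lambda>(k, i). (-1) ^ i * ((-1) ^ (i + k) * hermite (i + k) y * c))) =
      Determinant.det (Matrix.mat d d (\<lambda>(k, i). (-1) ^ k * c * hermite (k + i) y))"
    by (rule det_cong) (simp add: power_add power2_eq_square[symmetric] power_mult[symmetric] add.commute flip: mult.assoc power_mult_distrib)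
  also have "\<dots> = (\<Prod>k<d. (-1) ^ k * c) * (\<Prod>k<d. (-1) ^ k * fact k)"
    unfolding det_scale_rows det_hermite_hankel ..
  also have "\<dots> = c ^ d * (\<Prod>k<d. fact k)"
  proof -
    have "(\<Prod>k<d. (-1) ^ k * c) * (\<Prod>k<d. (-1) ^ k * fact k) = (\<Prod>k<d. ((-1) ^ k * c) * ((-1) ^ k * fact k))"
      by (rule prod.distrib[symmetric])
    also have "\<dots> = (\<Prod>k<d. c * fact k)"
      by (rule prod.cong) (simp_all add: power_mult_distrib[symmetric] flip: mult.assoc)
    finally show ?thesis by (simp add: prod.distrib)
  qed
  finally show ?thesis .
qed

text \<open>
  The quotient of the determinant by both Vandermonde products is a determinant of derivatives of the
  density at intermediate points, all of them in the regime \<open>n + y sqrt n + o(sqrt n)\<close>. Row \<open>k\<close> and column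
  \<open>i\<close> are scaled by \<open>sqrt n ^ k\<close> and \<open>sqrt n ^ (i + 1)\<close>, in total \<open>sqrt n ^ (d * d)\<close>, which makes the
  entries converge to Hermite polynomials times the Gaussian density. The points may be in any order: the
  averaging argument further below moves them across each other. They may also coincide, and then both
  sides vanish.
\<close>

lemma det_gam_asymp:
  fixes n :: "'a \<Rightarrow> nat" and x z :: "'a \<Rightarrow> nat \<Rightarrow> real"
  assumes n: "filterlim n at_top F"
  assumes x: "\<And>i. i < d \<Longrightarrow> ((\<lambda>a. x a i / sqrt (n a)) \<longlongrightarrow> 0) F"
  assumes z: "\<And>i. i < d \<Longrightarrow> ((\<lambda>a. z a i / sqrt (n a) - y a) \<longlongrightarrow> 0) F"
  assumes y: "\<forall>\<^sub>F a in F. \<bar>y a\<bar> \<le> C"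
  assumes e: "0 < \<epsilon>"
  shows "\<forall>\<^sub>F a in F. \<bar>Determinant.det (Matrix.mat d d (\<lambda>(i, k). gam (n a - c) (real (n a) + z a k - x a i)))
      - (\<Prod>i<d. \<Prod>j<i. x a i - x a j) * (\<Prod>i<d. \<Prod>j<i. z a i - z a j) / sqrt (n a) ^ (d * d) *
        ((exp (- (y a)\<^sup>2 / 2) / sqrt (2 * pi)) ^ d / (\<Prod>i<d. fact i))\<bar>
     \<le> \<epsilon> * (\<bar>\<Prod>i<d. \<Prod>j<i. x a i - x a j\<bar> * \<bar>\<Prod>i<d. \<Prod>j<i. z a i - z a j\<bar> / sqrt (n a) ^ (d * d))"
proof -
  define mx where "mx a = (\<Sum>i<d. \<bar>x a i\<bar>)" for a
  define mz where "mz a = (\<Sum>i<d. \<bar>z a i - y a * sqrt (n a)\<bar>)" for a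
  let ?V = "\<lambda>x :: nat \<Rightarrow> real. \<Prod>i<d. \<Prod>j<i. x i - x j"
  let ?M = "\<lambda>a \<xi> \<zeta>. Determinant.det (Matrix.mat d d (\<lambda>(k, i). (-1) ^ i * gam_deriv (i + k) (n a - c) (real (n a) + \<zeta> k - \<xi> i)))"
  have xb: "x a i \<in> {- mx a..mx a}" if "i < d" for a i
  proof -
    have "\<bar>x a i\<bar> \<le> mx a" unfolding mx_def by (rule member_le_sum) (use that in auto)
    then show ?thesis by auto
  qed
  have zb: "z a i \<in> {y a * sqrt (n a) - mz a..y a * sqrt (n a) + mz a}" if "i < d" for a i
  proof -
    have "\<bar>z a i - y a * sqrt (n a)\<bar> \<le> mz a"
      unfolding mz_def by (rule member_le_sum[of i "{..<d}" "\<lambda>i. \<bar>z a i - y a * sqrt (n a)\<bar>"]) (use that in auto)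
    then show ?thesis by auto
  qed
  \<comment> \<open>\<open>R a\<close> states the mean value theorem for the index \<open>a\<close>, with the hypotheses on \<open>a\<close> moved inside, so that
      the intermediate points can be chosen for all indices at once.\<close>
  define R where "R a \<xi> \<zeta> \<longleftrightarrow> (\<forall>i<d. \<xi> i \<in> {- mx a..mx a}) \<and> (\<forall>i<d. \<zeta> i \<in> {y a * sqrt (n a) - mz a..y a * sqrt (n a) + mz a}) \<and>
     (2 * d + 2 + c \<le> n a \<longrightarrow> inj_on (x a) {..<d} \<longrightarrow> inj_on (z a) {..<d} \<longrightarrow>
       Determinant.det (Matrix.mat d d (\<lambda>(i, k). gam_deriv 0 (n a - c) (real (n a) + z a k - x a i))) =
       ?V (x a) * ?V (z a) / (\<Prod>i<d. fact i)\<^sup>2 * ?M a \<xi> \<zeta>)" for a \<xi> \<zeta>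
  have ex: "\<exists>\<xi> \<zeta>. R a \<xi> \<zeta>" for a
  proof (cases "2 * d + 2 + c \<le> n a \<and> inj_on (x a) {..<d} \<and> inj_on (z a) {..<d}")
    case True
    have "\<exists>\<xi> \<zeta>. (\<forall>i<d. \<xi> i \<in> {- mx a..mx a}) \<and> (\<forall>i<d. \<zeta> i \<in> {y a * sqrt (n a) - mz a..y a * sqrt (n a) + mz a}) \<and>
      Determinant.det (Matrix.mat d d (\<lambda>(i, k). gam_deriv 0 (n a - c) (real (n a) + (z a k - x a i)))) =
      ?V (x a) * ?V (z a) / (\<Prod>i<d. fact i)\<^sup>2 *
        Determinant.det (Matrix.mat d d (\<lambda>(k, i). (-1) ^ i * gam_deriv (i + k) (n a - c) (real (n a) + (\<zeta> k - \<xi> i))))"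
    proof (rule det_mean_value_kernel[where f = "\<lambda>l t. gam_deriv l (n a - c) (real (n a) + t)"])
      fix l t assume "l < 2 * d"
      then have "(gam_deriv l (n a - c) has_real_derivative gam_deriv (Suc l) (n a - c) (real (n a) + t)) (at (real (n a) + t))"
        using True by (intro gam_deriv_has_derivative) auto
      then show "((\<lambda>t. gam_deriv l (n a - c) (real (n a) + t)) has_real_derivative gam_deriv (Suc l) (n a - c) (real (n a) + t)) (at t)"
        by (rule DERIV_cong[OF DERIV_chain2[where g = "\<lambda>t. real (n a) + t" and Db = 1]]) (auto intro!: derivative_eq_intros)
    qed (use xb zb True in auto)
    then obtain \<xi> \<zeta> where 1: "\<forall>i<d. \<xi> i \<in> {- mx a..mx a}" "\<forall>i<d. \<zeta> i \<in> {y a * sqrt (n a) - mz a..y a * sqrt (n a) + mz a}"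
      and 2: "Determinant.det (Matrix.mat d d (\<lambda>(i, k). gam_deriv 0 (n a - c) (real (n a) + (z a k - x a i)))) =
      ?V (x a) * ?V (z a) / (\<Prod>i<d. fact i)\<^sup>2 *
        Determinant.det (Matrix.mat d d (\<lambda>(k, i). (-1) ^ i * gam_deriv (i + k) (n a - c) (real (n a) + (\<zeta> k - \<xi> i))))"
      by (elim exE conjE) (rule that; assumption)
    show ?thesis
      unfolding R_def by (rule exI[of _ \<xi>], rule exI[of _ \<zeta>]) (intro conjI impI 1 2[unfolded add_diff_eq])
  next
    case False
    show ?thesis
      unfolding R_def by (rule exI[of _ "x a"], rule exI[of _ "z a"], intro conjI allI impI xb zb, assumption, assumption)
        (rule FalseE, use False in simp)
  qed
  then have "\<exists>p. R a (fst p) (snd p)" for a by auto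
  then obtain p where p: "\<And>a. R a (fst (p a)) (snd (p a))" by metis
  define \<xi> where "\<xi> a = fst (p a)" for a
  define \<zeta> where "\<zeta> a = snd (p a)" for a
  have RR: "R a (\<xi> a) (\<zeta> a)" for a unfolding \<xi>_def \<zeta>_def by (rule p)
  note RR' = RR[unfolded R_def]
  have \<xi>: "\<xi> a i \<in> {- mx a..mx a}" if "i < d" for a i
    using conjunct1[OF RR'] that by blast
  have \<zeta>: "\<zeta> a i \<in> {y a * sqrt (n a) - mz a..y a * sqrt (n a) + mz a}" if "i < d" for a i
    using conjunct1[OF conjunct2[OF RR']] that by blast
  have eq: "Determinant.det (Matrix.mat d d (\<lambda>(i, k). gam_deriv 0 (n a - c) (real (n a) + z a k - x a i))) =
       ?V (x a) * ?V (z a) / (\<Prod>i<d. fact i)\<^sup>2 * ?M a (\<xi> a) (\<zeta> a)"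
    if "2 * d + 2 + c \<le> n a" "inj_on (x a) {..<d}" "inj_on (z a) {..<d}" for a
    by (rule conjunct2[OF conjunct2[OF RR'], THEN mp, THEN mp, THEN mp]) (rule that)+
  have npos: "\<forall>\<^sub>F a in F. n a > 0" by (rule eventually_compose_filterlim[OF eventually_gt_at_top n])
  have nbig: "\<forall>\<^sub>F a in F. n a \<ge> 2 * d + 2 + c" by (rule eventually_compose_filterlim[OF eventually_ge_at_top n])
  have mx0: "((\<lambda>a. mx a / sqrt (n a)) \<longlongrightarrow> 0) F"
  proof -
    have "((\<lambda>a. \<Sum>i<d. \<bar>x a i / sqrt (n a)\<bar>) \<longlongrightarrow> 0) F"
      by (intro tendsto_null_sum tendsto_rabs_zero x) auto
    then show ?thesis by (simp add: mx_def sum_divide_distrib abs_divide)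
  qed
  have mz0: "((\<lambda>a. mz a / sqrt (n a)) \<longlongrightarrow> 0) F"
  proof -
    have "((\<lambda>a. \<Sum>i<d. \<bar>z a i / sqrt (n a) - y a\<bar>) \<longlongrightarrow> 0) F"
      by (intro tendsto_null_sum tendsto_rabs_zero z) auto
    moreover have "\<forall>\<^sub>F a in F. (\<Sum>i<d. \<bar>z a i / sqrt (n a) - y a\<bar>) = mz a / sqrt (n a)"
      using npos
    proof eventually_elim
      fix a assume "n a > 0"
      then have "z a i / sqrt (n a) - y a = (z a i - y a * sqrt (n a)) / sqrt (n a)" for i
        by (simp add: diff_divide_distrib)
      then have "\<bar>z a i / sqrt (n a) - y a\<bar> = \<bar>z a i - y a * sqrt (n a)\<bar> / sqrt (n a)" for i
        by (simp add: abs_divide)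
      then show "(\<Sum>i<d. \<bar>z a i / sqrt (n a) - y a\<bar>) = mz a / sqrt (n a)"
        by (simp add: mz_def sum_divide_distrib)
    qed
    ultimately show ?thesis by (rule Lim_transform_eventually)
  qed
  \<comment> \<open>Whatever the choice of the intermediate points, they stay in the scaling window of \<open>y\<close>.\<close>
  have arg: "tracks F (\<lambda>a. (real (n a) + \<zeta> a k - \<xi> a i - real (n a)) / sqrt (n a)) y" if "i < d" "k < d" for i k
    unfolding tracks_def
  proof
    have "((\<lambda>a. mz a / sqrt (n a) + mx a / sqrt (n a)) \<longlongrightarrow> 0 + 0) F" by (intro tendsto_add mx0 mz0)
    then have l: "((\<lambda>a. mz a / sqrt (n a) + mx a / sqrt (n a)) \<longlongrightarrow> 0) F" by simp
    show "((\<lambda>a. (real (n a) + \<zeta> a k - \<xi> a i - real (n a)) / sqrt (n a) - y a) \<longlongrightarrow> 0) F"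
    proof (rule Lim_null_comparison[OF _ l])
      show "\<forall>\<^sub>F a in F. norm ((real (n a) + \<zeta> a k - \<xi> a i - real (n a)) / sqrt (n a) - y a) \<le> mz a / sqrt (n a) + mx a / sqrt (n a)"
        using npos
      proof eventually_elim
        fix a assume "n a > 0"
        then have s: "sqrt (n a) > 0" by simp
        have "\<bar>\<zeta> a k - y a * sqrt (n a) - \<xi> a i\<bar> \<le> mz a + mx a"
          using \<xi>[OF that(1), of a] \<zeta>[OF that(2), of a] by auto
        then have "\<bar>\<zeta> a k - y a * sqrt (n a) - \<xi> a i\<bar> / sqrt (n a) \<le> (mz a + mx a) / sqrt (n a)"
          using s by (intro divide_right_mono) auto
        moreover have "(real (n a) + \<zeta> a k - \<xi> a i - real (n a)) / sqrt (n a) - y a = (\<zeta> a k - y a * sqrt (n a) - \<xi> a i) / sqrt (n a)"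
          using s by (simp add: field_simps)
        ultimately show "norm ((real (n a) + \<zeta> a k - \<xi> a i - real (n a)) / sqrt (n a) - y a) \<le> mz a / sqrt (n a) + mx a / sqrt (n a)"
          using s by (simp add: add_divide_distrib)
      qed
    qed
    show "\<exists>B. \<forall>\<^sub>F a in F. \<bar>y a\<bar> \<le> B" using y by blast
  qed
  let ?\<phi> = "\<lambda>a. exp (- (y a)\<^sup>2 / 2) / sqrt (2 * pi)"
  let ?K = "\<Prod>i<d. fact i :: real"
  have K: "?K > 0" by (simp add: prod_pos)
  have T: "tracks F (\<lambda>a. Determinant.det (Matrix.mat d d (\<lambda>(k, i). (-1) ^ i * (sqrt (n a) ^ Suc (i + k) * gam_deriv (i + k) (n a - c) (real (n a) + \<zeta> a k - \<xi> a i)))))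
     (\<lambda>a. Determinant.det (Matrix.mat d d (\<lambda>(k, i). (-1) ^ i * ((-1) ^ (i + k) * hermite (i + k) (y a) * ?\<phi> a))))"
    by (intro tracks_det tracks_cmult gam_deriv_tracks n arg)
  have Q: "Determinant.det (Matrix.mat d d (\<lambda>(k, i). (-1) ^ i * (sqrt (n a) ^ Suc (i + k) * gam_deriv (i + k) (n a - c) (real (n a) + \<zeta> a k - \<xi> a i))))
     = sqrt (n a) ^ (d * d) * ?M a (\<xi> a) (\<zeta> a)" for a
  proof -
    have "sqrt (n a) ^ (d * d) * ?M a (\<xi> a) (\<zeta> a) =
      Determinant.det (Matrix.mat d d (\<lambda>(k, i). sqrt (n a) ^ k * sqrt (n a) ^ Suc i * ((-1) ^ i * gam_deriv (i + k) (n a - c) (real (n a) + \<zeta> a k - \<xi> a i))))"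
      unfolding det_scale_rows_cols prod_double_power ..
    also have "\<dots> = Determinant.det (Matrix.mat d d (\<lambda>(k, i). (-1) ^ i * (sqrt (n a) ^ Suc (i + k) * gam_deriv (i + k) (n a - c) (real (n a) + \<zeta> a k - \<xi> a i))))"
      by (rule det_cong) (simp add: power_add mult_ac)
    finally show ?thesis by simp
  qed
  have "((\<lambda>a. sqrt (n a) ^ (d * d) * ?M a (\<xi> a) (\<zeta> a) - ?\<phi> a ^ d * ?K) \<longlongrightarrow> 0) F"
    using T unfolding Q det_hermite_signed tracks_def by blast
  then have lim: "\<forall>\<^sub>F a in F. \<bar>sqrt (n a) ^ (d * d) * ?M a (\<xi> a) (\<zeta> a) - ?\<phi> a ^ d * ?K\<bar> < \<epsilon> * ?K\<^sup>2"
    using e K by (auto dest!: tendstoD[where e = "\<epsilon> * ?K\<^sup>2"] simp: dist_norm)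
  have xs: "\<forall>\<^sub>F a in F. mx a / sqrt (n a) < 1" using mx0 by (rule order_tendstoD) simp
  have zs: "\<forall>\<^sub>F a in F. mz a / sqrt (n a) < 1" using mz0 by (rule order_tendstoD) simp
  have ns: "\<forall>\<^sub>F a in F. sqrt (n a) > C + 2"
    by (rule eventually_compose_filterlim[OF _ n]) real_asymp
  show ?thesis
    using lim xs zs ns nbig npos y
  proof eventually_elim
    fix a
    assume lim: "\<bar>sqrt (n a) ^ (d * d) * ?M a (\<xi> a) (\<zeta> a) - ?\<phi> a ^ d * ?K\<bar> < \<epsilon> * ?K\<^sup>2"
      and xs: "mx a / sqrt (n a) < 1" and zs: "mz a / sqrt (n a) < 1" and ns: "sqrt (n a) > C + 2"
      and nb: "2 * d + 2 + c \<le> n a" and "n a > 0" and ya: "\<bar>y a\<bar> \<le> C"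
    then have s: "sqrt (n a) > 0" by simp
    have pos: "real (n a) + z a k - x a i > 0" if "i < d" "k < d" for i k
    proof -
      have "mx a < sqrt (n a)" "mz a < sqrt (n a)" using xs zs s by (auto simp: field_simps)
      moreover have "\<bar>y a * sqrt (n a)\<bar> \<le> C * sqrt (n a)"
        using ya s by (simp add: abs_mult)
      moreover have "(C + 2) * sqrt (n a) < sqrt (n a) * sqrt (n a)"
        using ns s by (intro mult_strict_right_mono) auto
      moreover have "sqrt (n a) * sqrt (n a) = real (n a)" by simp
      ultimately show ?thesis using xb[OF that(1), of a] zb[OF that(2), of a]
        by (auto simp: algebra_simps abs_le_iff)
    qed
    have gd: "Determinant.det (Matrix.mat d d (\<lambda>(i, k). gam (n a - c) (real (n a) + z a k - x a i))) =
      Determinant.det (Matrix.mat d d (\<lambda>(i, k). gam_deriv 0 (n a - c) (real (n a) + z a k - x a i)))"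
    proof (rule det_cong)
      fix i k assume "i < d" "k < d"
      from pos[OF this]
      show "gam (n a - c) (real (n a) + z a k - x a i) = gam_deriv 0 (n a - c) (real (n a) + z a k - x a i)"
        by (simp add: gam_def)
    qed
    let ?D = "Determinant.det (Matrix.mat d d (\<lambda>(i, k). gam (n a - c) (real (n a) + z a k - x a i)))"
    let ?S = "sqrt (n a) ^ (d * d)"
    have S: "?S > 0" using s by simp
    show "\<bar>?D - ?V (x a) * ?V (z a) / ?S * (?\<phi> a ^ d / ?K)\<bar> \<le> \<epsilon> * (\<bar>?V (x a)\<bar> * \<bar>?V (z a)\<bar> / ?S)"
    proof (cases "inj_on (x a) {..<d} \<and> inj_on (z a) {..<d}")
      case True
      have E1: "?D - ?V (x a) * ?V (z a) / ?S * (?\<phi> a ^ d / ?K) =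
        ?V (x a) * ?V (z a) / ?S * ((?S * ?M a (\<xi> a) (\<zeta> a) - ?\<phi> a ^ d * ?K) / ?K\<^sup>2)"
      proof -
        have "A / k\<^sup>2 * m - A / s * (p / k) = A / s * ((s * m - p * k) / k\<^sup>2)" if "s > 0" "k > 0"
          for A k m s p :: real
          using that by (simp add: field_simps power2_eq_square)
        from this[OF S K] show ?thesis
          unfolding gd eq[OF nb conjunct1[OF True] conjunct2[OF True]] .
      qed
      have "\<bar>?D - ?V (x a) * ?V (z a) / ?S * (?\<phi> a ^ d / ?K)\<bar> = \<bar>?V (x a)\<bar> * \<bar>?V (z a)\<bar> / ?S * (\<bar>?S * ?M a (\<xi> a) (\<zeta> a) - ?\<phi> a ^ d * ?K\<bar> / ?K\<^sup>2)"
        unfolding E1 abs_mult abs_divide using S K by simp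
      also have "\<dots> \<le> \<bar>?V (x a)\<bar> * \<bar>?V (z a)\<bar> / ?S * \<epsilon>"
        using lim S K by (intro mult_left_mono) (auto simp: field_simps)
      finally show ?thesis by (simp add: mult.commute)
    next
      case False
      then have V0: "?V (x a) = 0 \<or> ?V (z a) = 0" using vandermonde_zero[of "x a" d] vandermonde_zero[of "z a" d] by blast
      have "Determinant.det (Matrix.mat d d (\<lambda>(i, k). gam (n a - c) (real (n a) + z a k - x a i))) = 0"
      proof (cases "inj_on (x a) {..<d}")
        case True
        with False obtain i j where "i < d" "j < d" "i \<noteq> j" "z a i = z a j" by (auto simp: inj_on_def)
        then show ?thesis
          by (subst det_swap_indices[symmetric], intro det_two_rows_eq[of i _ j]) auto
      next
        case False
        then obtain i j where "i < d" "j < d" "i \<noteq> j" "x a i = x a j" by (auto simp: inj_on_def)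
        then show ?thesis by (intro det_two_rows_eq[of i _ j]) auto
      qed
      moreover have "?V (x a) * ?V (z a) = 0" using V0 by (elim disjE) (simp_all only: mult_zero_left mult_zero_right)
      ultimately show ?thesis unfolding abs_mult[symmetric] by (simp only: div_0 mult_zero_left mult_zero_right diff_zero abs_zero)
    qed
  qed
qed


text \<open>
  Uniformity over a set of points is convergence along the filter generated by the set and \<open>n \<rightarrow> \<infinity>\<close>.
\<close>

lemma det_gam_asymp_uniform:
  assumes \<rho>: "\<rho> \<longlonglongrightarrow> 0" and e: "0 < \<epsilon>"
  shows "\<forall>\<^sub>F n in sequentially. \<forall>x z y. (\<forall>i<d. \<bar>x i\<bar> \<le> \<rho> n * sqrt n) \<longrightarrow>
    (\<forall>i<d. \<bar>z i - y * sqrt n\<bar> \<le> \<rho> n * sqrt n) \<longrightarrow> \<bar>y\<bar> \<le> C \<longrightarrow>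
    \<bar>Determinant.det (Matrix.mat d d (\<lambda>(i, k). gam (n - c) (real n + z k - x i)))
      - (\<Prod>i<d. \<Prod>j<i. x i - x j) * (\<Prod>i<d. \<Prod>j<i. z i - z j) / sqrt n ^ (d * d) *
        ((exp (- y\<^sup>2 / 2) / sqrt (2 * pi)) ^ d / (\<Prod>i<d. fact i))\<bar>
     \<le> \<epsilon> * (\<bar>\<Prod>i<d. \<Prod>j<i. x i - x j\<bar> * \<bar>\<Prod>i<d. \<Prod>j<i. z i - z j\<bar> / sqrt n ^ (d * d))"
proof -
  define A where "A = {(n :: nat, x :: nat \<Rightarrow> real, z :: nat \<Rightarrow> real, y :: real). (\<forall>i<d. \<bar>x i\<bar> \<le> \<rho> n * sqrt n) \<and>
    (\<forall>i<d. \<bar>z i - y * sqrt n\<bar> \<le> \<rho> n * sqrt n) \<and> \<bar>y\<bar> \<le> C}"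
  define F where "F = inf (filtercomap fst sequentially) (principal A)"
  have F: "eventually P F \<longleftrightarrow> (\<forall>\<^sub>F n in sequentially. \<forall>x z y. (n, x, z, y) \<in> A \<longrightarrow> P (n, x, z, y))" for P
    unfolding F_def eventually_inf_principal eventually_filtercomap
  proof safe
    fix Q assume "eventually Q sequentially" "\<forall>a. Q (fst a) \<longrightarrow> a \<in> A \<longrightarrow> P a"
    then show "\<forall>\<^sub>F n in sequentially. \<forall>x z y. (n, x, z, y) \<in> A \<longrightarrow> P (n, x, z, y)"
      by (auto elim!: eventually_mono)
  next
    assume "\<forall>\<^sub>F n in sequentially. \<forall>x z y. (n, x, z, y) \<in> A \<longrightarrow> P (n, x, z, y)"
    then show "\<exists>Q. eventually Q sequentially \<and> (\<forall>a. Q (fst a) \<longrightarrow> a \<in> A \<longrightarrow> P a)"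
      by (intro exI conjI) auto
  qed
  have n: "filterlim fst sequentially F"
    unfolding F_def by (rule filterlim_mono[OF filterlim_filtercomap order_refl inf_le1])
  have r: "((\<lambda>a. \<rho> (fst a)) \<longlongrightarrow> 0) F" by (rule filterlim_compose[OF \<rho> n])
  have npos: "\<forall>\<^sub>F a in F. fst a > 0" by (rule eventually_compose_filterlim[OF eventually_gt_at_top n])
  have inA: "\<forall>\<^sub>F a in F. a \<in> A" unfolding F by auto
  have "\<forall>\<^sub>F a in F. \<bar>Determinant.det (Matrix.mat d d (\<lambda>(i, k). gam (fst a - c) (real (fst a) + fst (snd (snd a)) k - fst (snd a) i)))
      - (\<Prod>i<d. \<Prod>j<i. fst (snd a) i - fst (snd a) j) * (\<Prod>i<d. \<Prod>j<i. fst (snd (snd a)) i - fst (snd (snd a)) j) / sqrt (fst a) ^ (d * d) *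
        ((exp (- (snd (snd (snd a)))\<^sup>2 / 2) / sqrt (2 * pi)) ^ d / (\<Prod>i<d. fact i))\<bar>
     \<le> \<epsilon> * (\<bar>\<Prod>i<d. \<Prod>j<i. fst (snd a) i - fst (snd a) j\<bar> * \<bar>\<Prod>i<d. \<Prod>j<i. fst (snd (snd a)) i - fst (snd (snd a)) j\<bar> / sqrt (fst a) ^ (d * d))"
  proof (rule det_gam_asymp[OF n _ _ _ e])
    fix i assume i: "i < d"
    show "((\<lambda>a. fst (snd a) i / sqrt (fst a)) \<longlongrightarrow> 0) F"
    proof (rule Lim_null_comparison[OF _ r])
      show "\<forall>\<^sub>F a in F. norm (fst (snd a) i / sqrt (fst a)) \<le> \<rho> (fst a)"
        using npos inA by eventually_elim (use i in \<open>auto simp: A_def abs_divide field_simps\<close>)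
    qed
    show "((\<lambda>a. fst (snd (snd a)) i / sqrt (fst a) - snd (snd (snd a))) \<longlongrightarrow> 0) F"
    proof (rule Lim_null_comparison[OF _ r])
      show "\<forall>\<^sub>F a in F. norm (fst (snd (snd a)) i / sqrt (fst a) - snd (snd (snd a))) \<le> \<rho> (fst a)"
        using npos inA
      proof eventually_elim
        fix a assume a: "fst a > 0" "a \<in> A"
        have "fst (snd (snd a)) i / sqrt (fst a) - snd (snd (snd a)) = (fst (snd (snd a)) i - snd (snd (snd a)) * sqrt (fst a)) / sqrt (fst a)"
          using a(1) by (simp add: diff_divide_distrib)
        then show "norm (fst (snd (snd a)) i / sqrt (fst a) - snd (snd (snd a))) \<le> \<rho> (fst a)"
          using a i by (auto simp: A_def abs_divide pos_divide_le_eq)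
      qed
    qed
  next
    show "\<forall>\<^sub>F a in F. \<bar>snd (snd (snd a))\<bar> \<le> C"
      using inA by eventually_elim (auto simp: A_def)
  qed
  then show ?thesis unfolding F by eventually_elim (simp add: A_def)
qed

section \<open>Averaging over gamma variables\<close>

lemma gam_nonneg: "0 \<le> gam r u"
  by (simp add: gam_def)

lemma gam_le_1: "gam r u \<le> 1"
proof (cases "u > 0")
  case True
  have "(\<Sum>n\<in>{r - 1}. u ^ n /\<^sub>R fact n) \<le> (\<Sum>n. u ^ n /\<^sub>R fact n)"
    using True by (intro sum_le_suminf summable_exp_generic) auto
  then have "u ^ (r - 1) / fact (r - 1) \<le> exp u"
    by (simp add: exp_def divide_inverse mult.commute)
  then show ?thesis using True by (simp add: gam_def exp_minus field_simps)
qed (simp add: gam_def)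

lemma gam_measurable [measurable]: "gam r \<in> borel_measurable borel"
  unfolding gam_def[abs_def] by measurable

lemma prob_space_eta_law: "prob_space (eta_law j)"
  unfolding eta_law_def by (auto intro!: prob_space_return prob_space_erlang_density)

lemma sets_eta_law [measurable_cong, simp]: "sets (eta_law j) = sets borel"
  by (simp add: eta_law_def)

lemma space_eta_law [simp]: "space (eta_law j) = UNIV"
  by (simp add: eta_law_def)

text \<open>
  Gamma laws form a convolution semigroup. For shape \<open>1\<close> the densities \<open>gam\<close> and \<open>erlang_density\<close>
  disagree at the origin, hence the detour through almost everywhere equality.
\<close>

lemma integral_eta_law_gam:
  assumes "1 \<le> N" "1 \<le> j"
  shows "integrable (eta_law j) (\<lambda>s. gam N (w - s))"
    and "(\<integral>s. gam N (w - s) \<partial>eta_law j) = gam (N + j - 1) w"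
proof -
  interpret prob_space "eta_law j" by (rule prob_space_eta_law)
  show int: "integrable (eta_law j) (\<lambda>s. gam N (w - s))"
    by (rule integrable_const_bound[where B = 1]) (auto simp: gam_nonneg gam_le_1)
  show "(\<integral>s. gam N (w - s) \<partial>eta_law j) = gam (N + j - 1) w"
  proof (cases "j = 1")
    case True
    then show ?thesis by (simp add: eta_law_def integral_return)
  next
    case False
    then obtain k where j: "j = Suc (Suc k)" using assms by (cases j; cases "j - 1") auto
    obtain m where N: "N = Suc m" using assms by (cases N) auto
    have AE: "AE s in lborel. gam N (w - s) = erlang_density m 1 (w - s)"
      using AE_lborel_singleton[of w] by eventually_elim (auto simp: gam_def erlang_density_def N)
    have "(\<integral>\<^sup>+s. ennreal (gam N (w - s)) \<partial>eta_law j) = (\<integral>\<^sup>+s. ennreal (erlang_density k 1 s) * ennreal (gam N (w - s)) \<partial>lborel)"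
      using j by (simp add: eta_law_def nn_integral_density)
    also have "\<dots> = (\<integral>\<^sup>+s. ennreal (erlang_density m 1 (w - s)) * ennreal (erlang_density k 1 s) \<partial>lborel)"
      using AE by (intro nn_integral_cong_AE) (auto simp: mult.commute)
    also have "\<dots> = ennreal (erlang_density (Suc m + Suc k - 1) 1 w)"
      using convolution_erlang_density[of 1 m k] by (simp add: fun_eq_iff)
    also have "erlang_density (Suc m + Suc k - 1) 1 w = gam (N + j - 1) w"
      by (auto simp: gam_def erlang_density_def N j)
    finally have "(\<integral>\<^sup>+s. ennreal (gam N (w - s)) \<partial>eta_law j) = ennreal (gam (N + j - 1) w)" .
    then show ?thesis
      using gam_nonneg by (subst integral_eq_nn_integral) auto
  qed
qed

lemma has_bochner_integral_eta_law_power: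
  assumes "1 \<le> j"
  shows "has_bochner_integral (eta_law j) (\<lambda>s. s ^ l) (pochhammer (real (j - 1)) l)"
proof (cases "j = 1")
  case True
  have "(\<integral>s. s ^ l \<partial>return borel 0) = (0 :: real) ^ l" by (rule integral_return) auto
  moreover have "integrable (return borel (0::real)) (\<lambda>s. s ^ l)"
    by (intro integrableI_bounded) (auto simp: nn_integral_return)
  ultimately show ?thesis using True by (auto simp: eta_law_def has_bochner_integral_iff pochhammer_0_left)
next
  case False
  then obtain k where j: "j = Suc (Suc k)" using assms by (cases j; cases "j - 1") auto
  let ?M = "density lborel (\<lambda>x. ennreal (erlang_density k 1 x))"
  have "prob_space ?M" by (rule prob_space_erlang_density) simp
  moreover have "distributed ?M lborel (\<lambda>x. x) (erlang_density k 1)"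
    by (auto simp: distributed_def intro!: measure_eqI simp: emeasure_distr)
  ultimately have "has_bochner_integral ?M (\<lambda>s. s ^ l) (fact (k + l) / (fact k * 1 ^ l))"
    by (intro prob_space.has_bochner_integral_erlang_ith_moment) auto
  moreover have "fact (k + l) = fact k * pochhammer (real (Suc k)) l"
    using pochhammer_product'[of "1::real" k l] by (simp add: pochhammer_fact)
  ultimately show ?thesis by (simp add: eta_law_def j)
qed

lemma has_bochner_integral_eta_law_shifted_power:
  assumes "1 \<le> j"
  shows "has_bochner_integral (eta_law j) (\<lambda>s. (x + s) ^ k) (gam_moment (j - 1) k x)"
proof -
  have "has_bochner_integral (eta_law j) (\<lambda>s. \<Sum>l\<le>k. (real (k choose l) * x ^ (k - l)) * s ^ l)
    (\<Sum>l\<le>k. (real (k choose l) * x ^ (k - l)) * pochhammer (real (j - 1)) l)"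
    by (intro has_bochner_integral_sum has_bochner_integral_mult_right has_bochner_integral_eta_law_power assms)
  then show ?thesis
    using binomial_ring[of _ x k] by (simp add: gam_moment_def mult_ac add.commute)
qed

lemma integrable_eta_law_growth:
  assumes "1 \<le> j"
  shows "integrable (eta_law j) (\<lambda>s. (1 + \<bar>s\<bar>) ^ q)"
proof -
  have "integrable (eta_law j) (\<lambda>s. \<Sum>l\<le>q. real (q choose l) * \<bar>s ^ l\<bar>)"
    using has_bochner_integral_eta_law_power[OF assms]
    by (intro Bochner_Integration.integrable_sum integrable_mult_right integrable_abs) (auto simp: has_bochner_integral_iff)
  moreover have "(1 + \<bar>s\<bar>) ^ q = (\<Sum>l\<le>q. real (q choose l) * \<bar>s ^ l\<bar>)" for s :: real
    using binomial_ring[of "\<bar>s\<bar>" 1 q] by (simp add: power_abs add.commute)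
  ultimately show ?thesis by simp
qed

text \<open>
  Expectation passes inside a determinant whose rows depend on different independent variables: every
  term of the Leibniz expansion has exactly one factor from each row. The bijection \<open>\<kappa>\<close> assigns
  the variables to the rows.
\<close>

lemma integral_det_rows:
  fixes f :: "nat \<Rightarrow> nat \<Rightarrow> real \<Rightarrow> real"
  assumes bij: "bij_betw \<kappa> {..<d} {1..d}"
  assumes int: "\<And>i k. i < d \<Longrightarrow> k < d \<Longrightarrow> integrable (eta_law (\<kappa> i)) (f i k)"
  shows "integrable (\<Pi>\<^sub>M j\<in>{1..d}. eta_law j) (\<lambda>\<eta>. Determinant.det (Matrix.mat d d (\<lambda>(i, k). f i k (\<eta> (\<kappa> i)))))"
    and "(\<integral>\<eta>. Determinant.det (Matrix.mat d d (\<lambda>(i, k). f i k (\<eta> (\<kappa> i)))) \<partial>(\<Pi>\<^sub>M j\<in>{1..d}. eta_law j))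
      = Determinant.det (Matrix.mat d d (\<lambda>(i, k). \<integral>s. f i k s \<partial>eta_law (\<kappa> i)))"
proof -
  interpret product_sigma_finite eta_law
    unfolding product_sigma_finite_def using prob_space_eta_law prob_space_imp_sigma_finite by blast
  define g where "g p j = f (the_inv_into {..<d} \<kappa> j) (p (the_inv_into {..<d} \<kappa> j))" for p j
  have inv: "the_inv_into {..<d} \<kappa> (\<kappa> i) = i" if "i < d" for i
    using bij that by (simp add: bij_betw_def the_inv_into_f_f)
  have *: "Determinant.det (Matrix.mat d d (\<lambda>(i, k). M i k)) =
      (\<Sum>p\<in>{p. p permutes {0..<d}}. signof p * (\<Prod>i<d. M i (p i)))" for M :: "nat \<Rightarrow> nat \<Rightarrow> real"
    by (subst det_def'[of _ d])
      (auto intro!: sum.cong prod.cong simp: atLeast0LessThan dest: permutes_in_image[of _ "{..<d}"])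
  have re: "(\<Prod>i<d. f i (p i) (\<eta> (\<kappa> i))) = (\<Prod>j\<in>{1..d}. g p j (\<eta> j))" for p \<eta>
    by (subst prod.reindex_bij_betw[OF bij, symmetric]) (simp add: g_def inv)
  have re2: "(\<Prod>i<d. \<integral>s. f i (p i) s \<partial>eta_law (\<kappa> i)) = (\<Prod>j\<in>{1..d}. \<integral>s. g p j s \<partial>eta_law j)" for p
    by (subst prod.reindex_bij_betw[OF bij, symmetric]) (simp add: g_def inv)
  have gi: "integrable (eta_law j) (g p j)" if p: "p permutes {0..<d}" and j: "j \<in> {1..d}" for p j
  proof -
    have "j \<in> \<kappa> ` {..<d}" unfolding bij_betw_imp_surj_on[OF bij] by (rule j)
    then obtain i where i: "i < d" "j = \<kappa> i" by auto
    have "p i < d" using p i permutes_in_image[of p "{0..<d}" i] by simp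
    then show ?thesis using int[of i "p i"] i by (simp add: g_def inv)
  qed
  have pi: "integrable (\<Pi>\<^sub>M j\<in>{1..d}. eta_law j) (\<lambda>\<eta>. \<Prod>j\<in>{1..d}. g p j (\<eta> j))" if "p permutes {0..<d}" for p
    by (rule product_integrable_prod) (use gi that in auto)
  show "integrable (\<Pi>\<^sub>M j\<in>{1..d}. eta_law j) (\<lambda>\<eta>. Determinant.det (Matrix.mat d d (\<lambda>(i, k). f i k (\<eta> (\<kappa> i)))))"
    unfolding * re by (intro Bochner_Integration.integrable_sum integrable_mult_right pi) auto
  have "(\<integral>\<eta>. Determinant.det (Matrix.mat d d (\<lambda>(i, k). f i k (\<eta> (\<kappa> i)))) \<partial>(\<Pi>\<^sub>M j\<in>{1..d}. eta_law j)) =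
    (\<Sum>p\<in>{p. p permutes {0..<d}}. signof p * (\<integral>\<eta>. (\<Prod>j\<in>{1..d}. g p j (\<eta> j)) \<partial>(\<Pi>\<^sub>M j\<in>{1..d}. eta_law j)))"
    unfolding * re by (subst Bochner_Integration.integral_sum) (use pi in \<open>simp_all\<close>)
  also have "\<dots> = (\<Sum>p\<in>{p. p permutes {0..<d}}. signof p * (\<Prod>j\<in>{1..d}. \<integral>s. g p j s \<partial>eta_law j))"
    by (intro sum.cong refl arg_cong2[where f = "(*)"] product_integral_prod) (auto intro: gi)
  finally show "(\<integral>\<eta>. Determinant.det (Matrix.mat d d (\<lambda>(i, k). f i k (\<eta> (\<kappa> i)))) \<partial>(\<Pi>\<^sub>M j\<in>{1..d}. eta_law j))
      = Determinant.det (Matrix.mat d d (\<lambda>(i, k). \<integral>s. f i k s \<partial>eta_law (\<kappa> i)))"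
    unfolding * re2 .
qed

lemma det_abs_le_fact:
  fixes M :: "nat \<Rightarrow> nat \<Rightarrow> real"
  assumes "\<And>i k. i < d \<Longrightarrow> k < d \<Longrightarrow> \<bar>M i k\<bar> \<le> 1"
  shows "\<bar>Determinant.det (Matrix.mat d d (\<lambda>(i, k). M i k))\<bar> \<le> fact d"
proof -
  have *: "Determinant.det (Matrix.mat d d (\<lambda>(i, k). M i k)) =
      (\<Sum>p\<in>{p. p permutes {0..<d}}. signof p * (\<Prod>i=0..<d. M i (p i)))"
    by (subst det_def'[of _ d])
      (auto intro!: sum.cong prod.cong dest: permutes_in_image[of _ "{0..<d}"])
  have "\<bar>Determinant.det (Matrix.mat d d (\<lambda>(i, k). M i k))\<bar> \<le> (\<Sum>p\<in>{p. p permutes {0..<d}}. 1)"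
    unfolding *
  proof (intro order_trans[OF sum_abs] sum_mono)
    fix p assume p: "p \<in> {p. p permutes {0..<d}}"
    have "\<bar>\<Prod>i=0..<d. M i (p i)\<bar> \<le> 1"
      unfolding abs_prod by (rule prod_le_1) (use p assms permutes_in_image[of p "{0..<d}"] in auto)
    then show "\<bar>signof p * (\<Prod>i=0..<d. M i (p i))\<bar> \<le> 1"
      by (simp add: abs_mult sign_def)
  qed
  also have "\<dots> = fact d" by (simp add: card_permutations)
  finally show ?thesis .
qed

lemma vandermonde_eq: "vandermonde d x = (\<Prod>i<d. \<Prod>j<i. x (Suc i) - x (Suc j))"
proof -
  have "(\<Prod>i<d. \<Prod>j<i. x (Suc i) - x (Suc j)) = (\<Prod>(i, j)\<in>(SIGMA i:{..<d}. {..<i}). x (Suc i) - x (Suc j))"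
    by (rule prod.Sigma) auto
  also have "\<dots> = vandermonde d x"
    unfolding vandermonde_def
  proof (rule prod.reindex_bij_witness[where j = "\<lambda>(i, j). (Suc j, Suc i)" and i = "\<lambda>(i, j). (j - 1, i - 1)"])
  qed auto
  finally show ?thesis ..
qed

text \<open>
  The reflection \<open>(z\<^sub>1, \<dots>, z\<^sub>d) \<mapsto> (- z\<^sub>d, \<dots>, - z\<^sub>1)\<close> permutes the pairs \<open>j < i\<close>, and each difference keeps
  its sign.
\<close>

lemma prod_pairs_reverse:
  fixes F :: "nat \<Rightarrow> nat \<Rightarrow> real"
  shows "(\<Prod>i<d. \<Prod>j<i. F (d - 1 - j) (d - 1 - i)) = (\<Prod>i<d. \<Prod>j<i. F i j)"
proof -
  have "(\<Prod>i<d. \<Prod>j<i. F (d - 1 - j) (d - 1 - i)) = (\<Prod>(i, j)\<in>(SIGMA i:{..<d}. {..<i}). F (d - 1 - j) (d - 1 - i))"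
    by (rule prod.Sigma) auto
  also have "\<dots> = (\<Prod>(i, j)\<in>(SIGMA i:{..<d}. {..<i}). F i j)"
    by (rule prod.reindex_bij_witness[where j = "\<lambda>(i, j). (d - 1 - j, d - 1 - i)" and i = "\<lambda>(i, j). (d - 1 - j, d - 1 - i)"]) auto
  also have "\<dots> = (\<Prod>i<d. \<Prod>j<i. F i j)"
    by (rule prod.Sigma[symmetric]) auto
  finally show ?thesis .
qed


abbreviation eta_prod :: "nat \<Rightarrow> (nat \<Rightarrow> real) measure" where
  "eta_prod d \<equiv> \<Pi>\<^sub>M j\<in>{1..d}. eta_law j"

lemma bij_betw_Suc_atLeast1: "bij_betw Suc {..<d} {1..d}"
  by (rule bij_betw_byWitness[where f' = "\<lambda>i. i - 1"]) auto

lemma bij_betw_reverse_atLeast1: "bij_betw (\<lambda>k. d - k) {..<d} {1..d :: nat}"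
  by (rule bij_betw_byWitness[where f' = "\<lambda>i. d - i"]) auto

lemma h_eq_integral:
  "h d x = (\<integral>\<eta>. (\<Prod>i<d. \<Prod>j<i. (x (Suc i) + \<eta> (Suc i)) - (x (Suc j) + \<eta> (Suc j))) \<partial>eta_prod d)"
  unfolding h_def vandermonde_eq by (intro Bochner_Integration.integral_cong refl prod.cong) auto

lemma integrable_vandermonde_eta:
  "integrable (eta_prod d) (\<lambda>\<eta>. \<Prod>i<d. \<Prod>j<i. (x (Suc i) + \<eta> (Suc i)) - (x (Suc j) + \<eta> (Suc j)))"
  unfolding det_vandermonde[symmetric]
  by (rule integral_det_rows(1)[OF bij_betw_Suc_atLeast1])
    (use has_bochner_integral_eta_law_shifted_power in \<open>auto simp: has_bochner_integral_iff\<close>)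

lemma h_eq_det: "h d x = Determinant.det (Matrix.mat d d (\<lambda>(i, k). gam_moment i k (x (Suc i))))"
proof -
  have "h d x = Determinant.det (Matrix.mat d d (\<lambda>(i, k). \<integral>s. (x (Suc i) + s) ^ k \<partial>eta_law (Suc i)))"
    unfolding h_eq_integral det_vandermonde[symmetric]
    by (rule integral_det_rows(2)[OF bij_betw_Suc_atLeast1])
      (use has_bochner_integral_eta_law_shifted_power in \<open>auto simp: has_bochner_integral_iff\<close>)
  also have "\<dots> = Determinant.det (Matrix.mat d d (\<lambda>(i, k). gam_moment i k (x (Suc i))))"
    using has_bochner_integral_eta_law_shifted_power by (intro det_cong) (auto simp: has_bochner_integral_iff)
  finally show ?thesis .
qed

text \<open>
  The expectation defining \<open>h\<close> has an integrand of varying sign; as a determinant of gamma moments it is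
  an integral of a positive function over interlacing configurations.
\<close>

lemma h_lower_bound:
  assumes "x \<in> weyl d"
  shows "exp (- (real d)\<^sup>2) * (\<Prod>i<d. \<Prod>j<i. 1 + x (Suc i) - x (Suc j)) \<le> h d x"
  unfolding h_eq_det by (rule det_gam_moment_ge) (use assms in \<open>auto simp: weyl_def\<close>)

text \<open>
  A single weight that dominates every polynomial growth in the averaging variables, with all moments
  finite.
\<close>

definition eta_size :: "nat \<Rightarrow> (nat \<Rightarrow> real) \<Rightarrow> real" where
  "eta_size d \<eta> = (\<Prod>j\<in>{1..d}. 1 + \<bar>\<eta> j\<bar>)"

lemma integrable_eta_size_power: "integrable (eta_prod d) (\<lambda>\<eta>. eta_size d \<eta> ^ q)"
proof -
  interpret product_sigma_finite eta_law
    unfolding product_sigma_finite_def using prob_space_eta_law prob_space_imp_sigma_finite by blast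
  show ?thesis
    unfolding eta_size_def prod_power_distrib
    by (rule product_integrable_prod) (auto intro: integrable_eta_law_growth)
qed

lemma eta_size_ge:
  assumes "j \<in> {1..d}"
  shows "1 + \<bar>\<eta> j\<bar> \<le> eta_size d \<eta>"
proof -
  have "1 \<le> (\<Prod>i\<in>{1..d} - {j}. 1 + \<bar>\<eta> i\<bar>)" by (rule prod_ge_1) auto
  then show ?thesis
    using assms by (simp add: eta_size_def prod.remove[of _ j] mult_le_cancel_left1)
qed

lemma eta_size_ge_1: "1 \<le> eta_size d \<eta>"
  unfolding eta_size_def by (rule prod_ge_1) auto

lemma abs_vandermonde_eta_le:
  assumes x: "\<And>i j. j < i \<Longrightarrow> i < d \<Longrightarrow> x (Suc j) \<le> x (Suc i)"
  shows "\<bar>\<Prod>i<d. \<Prod>j<i. (x (Suc i) + \<eta> (Suc i)) - (x (Suc j) + \<eta> (Suc j))\<bar> \<le>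
    (\<Prod>i<d. \<Prod>j<i. 1 + x (Suc i) - x (Suc j)) * eta_size d \<eta> ^ (2 * d * d)"
proof -
  let ?B = "eta_size d \<eta>"
  have B: "1 \<le> ?B" by (rule eta_size_ge_1)
  have f: "\<bar>(x (Suc i) + \<eta> (Suc i)) - (x (Suc j) + \<eta> (Suc j))\<bar> \<le> (1 + x (Suc i) - x (Suc j)) * ?B ^ 2"
    if "j < i" "i < d" for i j
  proof -
    have g: "0 \<le> x (Suc i) - x (Suc j)" using x[OF that] by simp
    have e: "1 + \<bar>\<eta> (Suc i)\<bar> \<le> ?B" "1 + \<bar>\<eta> (Suc j)\<bar> \<le> ?B" using that by (intro eta_size_ge; auto)+
    have "\<bar>(x (Suc i) + \<eta> (Suc i)) - (x (Suc j) + \<eta> (Suc j))\<bar> \<le> (x (Suc i) - x (Suc j)) + (\<bar>\<eta> (Suc i)\<bar> + \<bar>\<eta> (Suc j)\<bar>)"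
      using g by (auto simp: abs_if)
    also have "\<dots> \<le> (x (Suc i) - x (Suc j)) * ((1 + \<bar>\<eta> (Suc i)\<bar>) * (1 + \<bar>\<eta> (Suc j)\<bar>)) + (1 + \<bar>\<eta> (Suc i)\<bar>) * (1 + \<bar>\<eta> (Suc j)\<bar>)"
    proof (rule add_mono)
      have "1 \<le> (1 + \<bar>\<eta> (Suc i)\<bar>) * (1 + \<bar>\<eta> (Suc j)\<bar>)" by (simp add: algebra_simps)
      then show "x (Suc i) - x (Suc j) \<le> (x (Suc i) - x (Suc j)) * ((1 + \<bar>\<eta> (Suc i)\<bar>) * (1 + \<bar>\<eta> (Suc j)\<bar>))"
        using g mult_left_mono by fastforce
    qed (simp add: algebra_simps)
    also have "\<dots> = (1 + x (Suc i) - x (Suc j)) * ((1 + \<bar>\<eta> (Suc i)\<bar>) * (1 + \<bar>\<eta> (Suc j)\<bar>))"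
      by (simp add: algebra_simps)
    also have "\<dots> \<le> (1 + x (Suc i) - x (Suc j)) * (?B * ?B)"
      using g e by (intro mult_left_mono mult_mono) auto
    finally show ?thesis by (simp add: power2_eq_square)
  qed
  have "\<bar>\<Prod>i<d. \<Prod>j<i. (x (Suc i) + \<eta> (Suc i)) - (x (Suc j) + \<eta> (Suc j))\<bar> \<le>
      (\<Prod>i<d. \<Prod>j<i. (1 + x (Suc i) - x (Suc j)) * ?B ^ 2)"
    unfolding abs_prod using f by (intro prod_mono conjI prod_nonneg) auto
  also have "\<dots> = (\<Prod>i<d. \<Prod>j<i. 1 + x (Suc i) - x (Suc j)) * (\<Prod>i<d. (?B ^ 2) ^ i)"
    by (simp add: prod.distrib)
  also have "\<dots> \<le> (\<Prod>i<d. \<Prod>j<i. 1 + x (Suc i) - x (Suc j)) * (\<Prod>i<d. (?B ^ 2) ^ d)"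
    using x B by (intro mult_left_mono prod_mono prod_nonneg conjI power_increasing) (auto simp: add_increasing)
  also have "(\<Prod>i<d. (?B ^ 2) ^ d) = ?B ^ (2 * d * d)"
    by (simp add: power_mult[symmetric] mult.assoc)
  finally show ?thesis .
qed

text \<open>
  The kernel determinant after displacing the starting points by \<open>\<eta>\<close> and the end points by \<open>- \<eta>'\<close>. The
  variables \<open>\<eta>'\<close> enter in reversed order, as the end point with index \<open>j\<close> needs shape \<open>d - j\<close>.
\<close>

definition shifted_det ::
  "nat \<Rightarrow> nat \<Rightarrow> (nat \<Rightarrow> real) \<Rightarrow> (nat \<Rightarrow> real) \<Rightarrow> (nat \<Rightarrow> real) \<Rightarrow> (nat \<Rightarrow> real) \<Rightarrow> real" where
  "shifted_det d n x z \<eta> \<eta>' = Determinant.det (Matrix.mat d d (\<lambda>(i, k).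
    gam (n - (d - 1)) (real n + (z (Suc k) - \<eta>' (d - k)) - (x (Suc i) + \<eta> (Suc i)))))"

text \<open>
  Averaging over \<open>\<eta>\<close> raises the shape in row \<open>i\<close> by \<open>i\<close>, averaging over \<open>\<eta>'\<close> raises it in column \<open>k\<close> by
  \<open>d - 1 - k\<close> (counting from \<open>0\<close>). Starting from the common shape \<open>n - (d - 1)\<close>, this yields the shapes
  \<open>n + i - k\<close> of the determinant for the ordered walk.
\<close>

lemma det_ordered_eq_integral:
  assumes n: "d \<le> n" and z: "\<And>j. j \<in> {1..d} \<Longrightarrow> w j = real n + z j"
  assumes d: "1 \<le> d"
  shows "integrable (eta_prod d) (\<lambda>\<eta>. shifted_det d n x z \<eta> \<eta>')"
    and "integrable (eta_prod d) (\<lambda>\<eta>'. \<integral>\<eta>. shifted_det d n x z \<eta> \<eta>' \<partial>eta_prod d)"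
    and "det_ordered d n x w = (\<integral>\<eta>'. \<integral>\<eta>. shifted_det d n x z \<eta> \<eta>' \<partial>eta_prod d \<partial>eta_prod d)"
proof -
  define N where "N = n - (d - 1)"
  have N: "1 \<le> N" "\<And>i k. i < d \<Longrightarrow> k < d \<Longrightarrow> N + i + (d - k) - 1 = n + i - k"
    using n d by (auto simp: N_def)
  have D: "shifted_det d n x z \<eta> \<eta>' = Determinant.det (Matrix.mat d d (\<lambda>(i, k). (\<lambda>s. gam N ((real n + (z (Suc k) - \<eta>' (d - k)) - x (Suc i)) - s)) (\<eta> (Suc i))))" for \<eta> \<eta>'
    unfolding shifted_det_def N_def by (simp only: diff_diff_eq)
  show int: "integrable (eta_prod d) (\<lambda>\<eta>. shifted_det d n x z \<eta> \<eta>')" for \<eta>'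
    unfolding D by (rule integral_det_rows(1)[OF bij_betw_Suc_atLeast1]) (use N in \<open>auto intro!: integral_eta_law_gam\<close>)
  have inner: "(\<integral>\<eta>. shifted_det d n x z \<eta> \<eta>' \<partial>eta_prod d) = Determinant.det (Matrix.mat d d (\<lambda>(k, i).
      (\<lambda>s. gam (N + i) ((real n + z (Suc k) - x (Suc i)) - s)) (\<eta>' (d - k))))" for \<eta>'
  proof -
    have "(\<integral>\<eta>. shifted_det d n x z \<eta> \<eta>' \<partial>eta_prod d) = Determinant.det (Matrix.mat d d (\<lambda>(i, k).
        \<integral>s. gam N ((real n + (z (Suc k) - \<eta>' (d - k)) - x (Suc i)) - s) \<partial>eta_law (Suc i)))"
      unfolding D by (rule integral_det_rows(2)[OF bij_betw_Suc_atLeast1]) (use N in \<open>auto intro!: integral_eta_law_gam\<close>)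
    also have "\<dots> = Determinant.det (Matrix.mat d d (\<lambda>(i, k). gam (N + i) ((real n + z (Suc k) - x (Suc i)) - \<eta>' (d - k))))"
      by (intro det_cong, subst integral_eta_law_gam(2)) (use N in \<open>auto simp: algebra_simps\<close>)
    also have "\<dots> = Determinant.det (Matrix.mat d d (\<lambda>(k, i). gam (N + i) ((real n + z (Suc k) - x (Suc i)) - \<eta>' (d - k))))"
      by (rule det_swap_indices)
    finally show ?thesis .
  qed
  show "integrable (eta_prod d) (\<lambda>\<eta>'. \<integral>\<eta>. shifted_det d n x z \<eta> \<eta>' \<partial>eta_prod d)"
    unfolding inner by (rule integral_det_rows(1)[OF bij_betw_reverse_atLeast1]) (use N in \<open>auto intro!: integral_eta_law_gam\<close>)
  have "(\<integral>\<eta>'. \<integral>\<eta>. shifted_det d n x z \<eta> \<eta>' \<partial>eta_prod d \<partial>eta_prod d) = Determinant.det (Matrix.mat d d (\<lambda>(k, i).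
      \<integral>s. gam (N + i) ((real n + z (Suc k) - x (Suc i)) - s) \<partial>eta_law (d - k)))"
    unfolding inner by (rule integral_det_rows(2)[OF bij_betw_reverse_atLeast1]) (use N in \<open>auto intro!: integral_eta_law_gam\<close>)
  also have "\<dots> = Determinant.det (Matrix.mat d d (\<lambda>(k, i). gam (n + i - k) (w (Suc k) - x (Suc i))))"
    by (intro det_cong, subst integral_eta_law_gam(2)) (use N z in auto)
  also have "\<dots> = det_ordered d n x w"
    unfolding det_ordered_def by (rule det_swap_indices)
  finally show "det_ordered d n x w = (\<integral>\<eta>'. \<integral>\<eta>. shifted_det d n x z \<eta> \<eta>' \<partial>eta_prod d \<partial>eta_prod d)" ..
qed

section \<open>The Weyl chamber\<close>

lemma weyl_mono:
  assumes "x \<in> weyl d" "1 \<le> i" "i \<le> j" "j \<le> d"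
  shows "x i \<le> x j"
  using assms(3,4)
proof (induction j rule: dec_induct)
  case (step m)
  then have "x m \<le> x (Suc m)" using assms(1,2) by (auto simp: weyl_def)
  then show ?case using step by simp
qed simp

lemma int_weyl_subset: "int_weyl d \<subseteq> weyl d"
  unfolding int_weyl_def by (rule interior_of_subset)

text \<open>
  If two neighbouring coordinates agreed, raising the first of them slightly would leave the chamber.
\<close>

lemma int_weyl_strict:
  assumes x: "x \<in> int_weyl d" and j: "j \<in> {1..<d}"
  shows "x j < x (Suc j)"
proof -
  let ?T = "product_topology (\<lambda>_. euclideanreal) {1..d}"
  obtain U where U: "openin ?T U" "x \<in> U" "U \<subseteq> weyl d"
    using x unfolding int_weyl_def interior_of_def by blast
  have xe: "x \<in> extensional {1..d}"
    using x int_weyl_subset by (fastforce simp: weyl_def PiE_def)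
  have "continuous_map euclideanreal ?T (\<lambda>t. x(j := t))"
    unfolding continuous_map_componentwise
  proof (intro conjI ballI)
    show "(\<lambda>t. x(j := t)) ` topspace euclideanreal \<subseteq> extensional {1..d}"
      using xe j by (auto simp: extensional_def)
    fix k assume "k \<in> {1..d}"
    show "continuous_map euclideanreal euclideanreal (\<lambda>t. (x(j := t)) k)"
      by (cases "k = j") auto
  qed
  then have "openin euclideanreal {t \<in> topspace euclideanreal. x(j := t) \<in> U}"
    using U(1) by (rule openin_continuous_map_preimage)
  then have "open {t. x(j := t) \<in> U}" by simp
  moreover have "x j \<in> {t. x(j := t) \<in> U}" using U(2) by simp
  ultimately obtain e where e: "e > 0" "cball (x j) e \<subseteq> {t. x(j := t) \<in> U}"
    by (meson open_contains_cball)
  then have "x j + e \<in> {t. x(j := t) \<in> U}" by (auto simp: subset_iff dist_real_def)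
  then have "x(j := x j + e) \<in> weyl d" using U(3) by auto
  then have "(x(j := x j + e)) j \<le> (x(j := x j + e)) (Suc j)" using j unfolding weyl_def by blast
  then show ?thesis using e(1) by simp
qed

lemma vandermonde_pos:
  assumes "x \<in> int_weyl d"
  shows "0 < vandermonde d x"
proof -
  have "x (Suc j) < x (Suc i)" if "j < i" "i < d" for i j
  proof -
    have "x (Suc j) < x (Suc (Suc j))" using that by (intro int_weyl_strict[OF assms]) auto
    also have "x (Suc (Suc j)) \<le> x (Suc i)"
      by (rule weyl_mono) (use that assms int_weyl_subset in auto)
    finally show ?thesis .
  qed
  then show ?thesis unfolding vandermonde_eq by (intro prod_pos ballI) auto
qed

section \<open>Uniform asymptotics of the two determinants\<close>

text \<open>
  A ratio close to \<open>1\<close> has a nonzero denominator, so the intermediate term cancels.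
\<close>

lemma ratio_tendsto_1_uniformly_trans:
  assumes "ratio_tendsto_1_uniformly A a b" "ratio_tendsto_1_uniformly A b c"
  shows "ratio_tendsto_1_uniformly A a c"
  unfolding ratio_tendsto_1_uniformly_def
proof (intro allI impI)
  fix e :: real assume e: "e > 0"
  define e' where "e' = min (1/2) (e / 4)"
  have e': "0 < e'" "e' \<le> 1/2" "4 * e' \<le> e" using e by (auto simp: e'_def)
  have "\<forall>\<^sub>F n in sequentially. \<forall>p\<in>A n. \<bar>a n p / b n p - 1\<bar> < e'"
    "\<forall>\<^sub>F n in sequentially. \<forall>p\<in>A n. \<bar>b n p / c n p - 1\<bar> < e'"
    using assms e'(1) unfolding ratio_tendsto_1_uniformly_def by blast+
  then show "\<forall>\<^sub>F n in sequentially. \<forall>p\<in>A n. \<bar>a n p / c n p - 1\<bar> < e"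
  proof eventually_elim
    fix n assume ab: "\<forall>p\<in>A n. \<bar>a n p / b n p - 1\<bar> < e'" and bc: "\<forall>p\<in>A n. \<bar>b n p / c n p - 1\<bar> < e'"
    show "\<forall>p\<in>A n. \<bar>a n p / c n p - 1\<bar> < e"
    proof
      fix p assume p: "p \<in> A n"
      define u where "u = a n p / b n p - 1"
      define v where "v = b n p / c n p - 1"
      have uv: "\<bar>u\<bar> < e'" "\<bar>v\<bar> < e'" using ab bc p by (auto simp: u_def v_def)
      have "b n p \<noteq> 0" using uv(1) e' by (auto simp: u_def)
      then have "a n p / c n p - 1 = u * v + u + v"
        by (simp add: u_def v_def algebra_simps)
      moreover have "\<bar>u * v\<bar> \<le> e' * 1" unfolding abs_mult using uv e' by (intro mult_mono) auto
      ultimately show "\<bar>a n p / c n p - 1\<bar> < e" using uv e' by linarith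
    qed
  qed
qed

text \<open>
  The factor \<open>chi d * gauss_factor d n z\<close> with every \<open>z j\<close> in the Gaussian replaced by \<open>z 1\<close>: the form in
  which the kernel asymptotics produces it.
\<close>

definition lead_factor :: "nat \<Rightarrow> nat \<Rightarrow> (nat \<Rightarrow> real) \<Rightarrow> real" where
  "lead_factor d n z = (exp (- (z 1 / sqrt n)\<^sup>2 / 2) / sqrt (2 * pi)) ^ d / (\<Prod>i<d. fact i) / sqrt n ^ (d * d)"

lemma lead_factor_bounds:
  assumes "n > 0" "\<bar>z 1\<bar> \<le> C * sqrt n"
  shows "(exp (- C\<^sup>2 / 2) / sqrt (2 * pi)) ^ d / (\<Prod>i<d. fact i) \<le> lead_factor d n z * sqrt n ^ (d * d)"
    and "lead_factor d n z * sqrt n ^ (d * d) \<le> 1" and "0 < lead_factor d n z"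
proof -
  have s: "sqrt n > 0" using assms by simp
  have K: "(1 :: real) \<le> (\<Prod>i<d. fact i)" by (rule prod_ge_1) auto
  have eq: "lead_factor d n z * sqrt n ^ (d * d) = (exp (- (z 1 / sqrt n)\<^sup>2 / 2) / sqrt (2 * pi)) ^ d / (\<Prod>i<d. fact i)"
    using s by (simp add: lead_factor_def)
  have "\<bar>z 1 / sqrt n\<bar> \<le> C" using assms s by (simp add: abs_divide pos_divide_le_eq)
  then have "(z 1 / sqrt n)\<^sup>2 \<le> C\<^sup>2" by (meson abs_ge_zero order_trans power2_le_iff_abs_le)
  then have 1: "exp (- C\<^sup>2 / 2) / sqrt (2 * pi) \<le> exp (- (z 1 / sqrt n)\<^sup>2 / 2) / sqrt (2 * pi)"
    by (intro divide_right_mono) auto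
  show "(exp (- C\<^sup>2 / 2) / sqrt (2 * pi)) ^ d / (\<Prod>i<d. fact i) \<le> lead_factor d n z * sqrt n ^ (d * d)"
    unfolding eq by (rule divide_right_mono[OF power_mono[OF 1]]) (use K in auto)
  have "1 \<le> sqrt (2 * pi)" using pi_ge_two by simp
  then have le: "exp (- (z 1 / sqrt n)\<^sup>2 / 2) \<le> sqrt (2 * pi)"
    by (rule order_trans[rotated]) (simp only: exp_le_one_iff, simp)
  have "0 < sqrt (2 * pi)" by simp
  from pos_divide_le_eq[OF this] le
  have "exp (- (z 1 / sqrt n)\<^sup>2 / 2) / sqrt (2 * pi) \<le> 1"
    by (simp only: mult_1)
  then have "(exp (- (z 1 / sqrt n)\<^sup>2 / 2) / sqrt (2 * pi)) ^ d \<le> 1"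
    by (intro power_le_one) auto
  then show "lead_factor d n z * sqrt n ^ (d * d) \<le> 1"
    unfolding eq using K by (simp add: divide_le_eq)
  show "0 < lead_factor d n z" unfolding lead_factor_def using s K by (intro divide_pos_pos zero_less_power) auto
qed

lemma lead_factor_eq:
  assumes n: "n > 0"
  shows "lead_factor d n z = chi d * gauss_factor d n z * exp ((\<Sum>j=1..d. (z j)\<^sup>2 - (z 1)\<^sup>2) / (2 * real n))"
proof -
  have 1: "sqrt (2 * pi) ^ d = (2 * pi) powr (real d / 2)"
    by (simp add: powr_half_sqrt[symmetric] powr_realpow[symmetric] powr_powr del: powr_half_sqrt_powr)
  have 2: "sqrt n ^ (d * d) = real n powr ((real d)\<^sup>2 / 2)"
    using n by (simp add: powr_half_sqrt[symmetric] powr_realpow[symmetric] powr_powr power2_eq_square del: powr_half_sqrt_powr)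
  have 3: "(\<Prod>i<d. fact i :: real) = (\<Prod>j=1..<d. fact j)"
    by (rule prod.mono_neutral_right) (auto simp: not_le less_Suc_eq)
  have 4: "exp (- (z 1 / sqrt n)\<^sup>2 / 2) ^ d = exp (- (1 / (2 * real n)) * (\<Sum>j=1..d. (z j)\<^sup>2)) * exp ((\<Sum>j=1..d. (z j)\<^sup>2 - (z 1)\<^sup>2) / (2 * real n))"
    using n by (simp add: exp_of_nat_mult[symmetric] exp_add[symmetric] sum_subtractf power_divide) (simp add: field_simps)
  have 5: "(2 * pi) powr (- real d / 2) = inverse ((2 * pi) powr (real d / 2))"
    using powr_minus[of "2 * pi" "real d / 2"] by simp
  have 6: "real n powr (- (real d)\<^sup>2 / 2) = inverse (real n powr ((real d)\<^sup>2 / 2))"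
    using powr_minus[of "real n" "(real d)\<^sup>2 / 2"] by simp
  show ?thesis
    unfolding lead_factor_def chi_def gauss_factor_def power_divide[of "exp _"] 1 2 3 4
    unfolding 5 6 by (simp only: divide_inverse inverse_mult_distrib mult_ac)
qed

text \<open>
  \<open>\<bar>(z j)\<^sup>2 - (z 1)\<^sup>2\<bar> = \<bar>z j - z 1\<bar> * \<bar>z j + z 1\<bar> = o(n)\<close> on the region.
\<close>

lemma lead_factor_ratio:
  assumes \<delta>: "\<And>n. 0 < \<delta> n" "\<delta> \<longlonglongrightarrow> 0" and d: "1 \<le> d" and e: "0 < \<epsilon>" and D: "D \<subseteq> weyl d"
  shows "\<forall>\<^sub>F n in sequentially. \<forall>(x, z)\<in>region d D \<delta> C n. \<bar>lead_factor d n z / (chi d * gauss_factor d n z) - 1\<bar> < \<epsilon>"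
proof -
  have "(\<lambda>n. exp (real d * (\<delta> n * (2 * C + \<delta> n)) / 2) - 1) \<longlonglongrightarrow> exp (real d * (0 * (2 * C + 0)) / 2) - 1"
    by (intro tendsto_intros \<delta>) auto
  then have "\<forall>\<^sub>F n in sequentially. exp (real d * (\<delta> n * (2 * C + \<delta> n)) / 2) - 1 < \<epsilon>"
    by (rule order_tendstoD) (use e in simp)
  then show ?thesis
    using eventually_gt_at_top[of 0]
  proof eventually_elim
    fix n :: nat
    assume en: "exp (real d * (\<delta> n * (2 * C + \<delta> n)) / 2) - 1 < \<epsilon>" and n: "0 < n"
    show "\<forall>(x, z)\<in>region d D \<delta> C n. \<bar>lead_factor d n z / (chi d * gauss_factor d n z) - 1\<bar> < \<epsilon>"
    proof clarify
      fix x z assume "(x, z) \<in> region d D \<delta> C n"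
      then have z: "z \<in> weyl d" "z d - z 1 \<le> \<delta> n * sqrt n" "\<bar>z 1\<bar> \<le> C * sqrt n"
        using D by (auto simp: region_def)
      define t where "t = (\<Sum>j=1..d. (z j)\<^sup>2 - (z 1)\<^sup>2) / (2 * real n)"
      have s: "sqrt n > 0" using n by simp
      have "\<bar>\<Sum>j=1..d. (z j)\<^sup>2 - (z 1)\<^sup>2\<bar> \<le> (\<Sum>j=1..d. (\<delta> n * sqrt n) * ((2 * C + \<delta> n) * sqrt n))"
      proof (intro order_trans[OF sum_abs] sum_mono)
        fix j assume j: "j \<in> {1..d}"
        have a: "\<bar>z j - z 1\<bar> \<le> \<delta> n * sqrt n"
          using weyl_mono[OF z(1), of 1 j] weyl_mono[OF z(1), of j d] j z(2) by auto
        have b: "\<bar>z j + z 1\<bar> \<le> (2 * C + \<delta> n) * sqrt n"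
        proof -
          have "\<bar>z j + z 1\<bar> \<le> \<bar>z j - z 1\<bar> + 2 * \<bar>z 1\<bar>" by linarith
          then show ?thesis using a z(3) by (simp add: algebra_simps)
        qed
        have "\<bar>(z j)\<^sup>2 - (z 1)\<^sup>2\<bar> = \<bar>z j - z 1\<bar> * \<bar>z j + z 1\<bar>"
          by (simp add: abs_mult[symmetric] power2_eq_square algebra_simps)
        also have "\<dots> \<le> (\<delta> n * sqrt n) * ((2 * C + \<delta> n) * sqrt n)"
          using a b by (intro mult_mono) (auto intro: order_trans[OF abs_ge_zero])
        finally show "\<bar>(z j)\<^sup>2 - (z 1)\<^sup>2\<bar> \<le> (\<delta> n * sqrt n) * ((2 * C + \<delta> n) * sqrt n)" .
      qed
      also have "\<dots> = real d * (\<delta> n * (2 * C + \<delta> n)) * real n"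
        by (simp add: algebra_simps)
      finally have "\<bar>\<Sum>j=1..d. (z j)\<^sup>2 - (z 1)\<^sup>2\<bar> / (2 * real n) \<le> real d * (\<delta> n * (2 * C + \<delta> n)) * real n / (2 * real n)"
        by (rule divide_right_mono) simp
      moreover have "\<bar>t\<bar> = \<bar>\<Sum>j=1..d. (z j)\<^sup>2 - (z 1)\<^sup>2\<bar> / (2 * real n)"
        by (simp add: t_def)
      ultimately have t: "\<bar>t\<bar> \<le> real d * (\<delta> n * (2 * C + \<delta> n)) / 2" using n by simp
      have "\<bar>exp t - 1\<bar> \<le> exp \<bar>t\<bar> - 1"
      proof (cases "t \<ge> 0")
        case False
        have "0 \<le> exp (- t) * (exp t - 1)\<^sup>2" by simp
        also have "\<dots> = exp t - 2 + exp (- t)" by (simp add: power2_eq_square exp_minus field_simps)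
        finally show ?thesis using False exp_le_one_iff[of t] by (simp add: abs_if)
      qed (simp add: abs_if)
      also have "\<dots> \<le> exp (real d * (\<delta> n * (2 * C + \<delta> n)) / 2) - 1" using t by simp
      finally have "\<bar>exp t - 1\<bar> < \<epsilon>" using en by linarith
      moreover have "chi d * gauss_factor d n z \<noteq> 0"
        using lead_factor_eq[OF n, of d z] lead_factor_bounds(3)[of n z C d] n z(3) by auto
      ultimately show "\<bar>lead_factor d n z / (chi d * gauss_factor d n z) - 1\<bar> < \<epsilon>"
        unfolding lead_factor_eq[OF n] t_def[symmetric] by simp
    qed
  qed
qed

lemma det_interlacing_asymp:
  assumes d: "1 \<le> d" and \<delta>: "\<And>n. 0 < \<delta> n" "\<delta> \<longlonglongrightarrow> 0"
  shows "ratio_tendsto_1_uniformly (region d (int_weyl d) \<delta> C)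
    (\<lambda>n (x, z). det_interlacing d n x (add_drift d n z))
    (\<lambda>n (x, z). vandermonde d x * vandermonde d z * lead_factor d n z)"
  unfolding ratio_tendsto_1_uniformly_def
proof (intro allI impI)
  fix \<epsilon> :: real assume e: "\<epsilon> > 0"
  define c0 where "c0 = (exp (- C\<^sup>2 / 2) / sqrt (2 * pi)) ^ d / (\<Prod>i<d. fact i)"
  have c0: "c0 > 0" unfolding c0_def by (intro divide_pos_pos zero_less_power prod_pos) auto
  have "(\<lambda>n. 2 * \<delta> n) \<longlonglongrightarrow> 2 * 0" by (intro tendsto_intros \<delta>)
  then have r: "(\<lambda>n. 2 * \<delta> n) \<longlonglongrightarrow> 0" by simp
  have "\<epsilon> * c0 / 2 > 0" using e c0 by simp
  from det_gam_asymp_uniform[OF r this, of d C 0] eventually_gt_at_top[of 0]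
  show "\<forall>\<^sub>F n in sequentially. \<forall>p\<in>region d (int_weyl d) \<delta> C n.
    \<bar>(case p of (x, z) \<Rightarrow> det_interlacing d n x (add_drift d n z)) /
      (case p of (x, z) \<Rightarrow> vandermonde d x * vandermonde d z * lead_factor d n z) - 1\<bar> < \<epsilon>"
  proof eventually_elim
    case (elim n)
    then have n: "n > 0" by simp
    have s: "sqrt n > 0" using n by simp
    show ?case
    proof clarify
      fix x z assume "(x, z) \<in> region d (int_weyl d) \<delta> C n"
      then have x: "x \<in> int_weyl d" "x d - x 1 \<le> \<delta> n * sqrt n" "\<bar>x 1\<bar> \<le> \<delta> n * sqrt n"
        and z: "z \<in> int_weyl d" "z d - z 1 \<le> \<delta> n * sqrt n" "\<bar>z 1\<bar> \<le> C * sqrt n"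
        by (auto simp: region_def)
      have xw: "x \<in> weyl d" and zw: "z \<in> weyl d" using x z int_weyl_subset by auto
      have xb: "\<forall>i<d. \<bar>x (Suc i)\<bar> \<le> 2 * \<delta> n * sqrt n"
      proof (intro allI impI)
        fix i assume "i < d"
        then show "\<bar>x (Suc i)\<bar> \<le> 2 * \<delta> n * sqrt n"
          using weyl_mono[OF xw, of 1 "Suc i"] weyl_mono[OF xw, of "Suc i" d] x by auto
      qed
      have zb: "\<forall>i<d. \<bar>z (Suc i) - z 1 / sqrt n * sqrt n\<bar> \<le> 2 * \<delta> n * sqrt n"
      proof (intro allI impI)
        fix i assume "i < d"
        then have "\<bar>z (Suc i) - z 1\<bar> \<le> \<delta> n * sqrt n"
          using weyl_mono[OF zw, of 1 "Suc i"] weyl_mono[OF zw, of "Suc i" d] z by auto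
        also have "\<dots> \<le> 2 * \<delta> n * sqrt n" using \<delta>(1)[of n] s by simp
        finally show "\<bar>z (Suc i) - z 1 / sqrt n * sqrt n\<bar> \<le> 2 * \<delta> n * sqrt n" using s by simp
      qed
      have yb: "\<bar>z 1 / sqrt n\<bar> \<le> C" using z(3) s by (simp add: abs_divide pos_divide_le_eq)
      define v where "v = vandermonde d x * vandermonde d z"
      have v: "v > 0" unfolding v_def using vandermonde_pos x z by simp
      define S where "S = sqrt n ^ (d * d)"
      have S: "S > 0" using s by (simp add: S_def)
      define L where "L = lead_factor d n z"
      have L: "c0 \<le> L * S" "L > 0" using lead_factor_bounds[of n z C d, OF n z(3)] by (auto simp: L_def S_def c0_def)
      have dd: "det_interlacing d n x (add_drift d n z) = Determinant.det (Matrix.mat d d (\<lambda>(i, k). gam (n - 0) (real n + z (Suc k) - x (Suc i))))"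
        unfolding det_interlacing_def by (rule det_cong) (simp add: add_drift_def)
      have "\<bar>det_interlacing d n x (add_drift d n z) - v * L\<bar> \<le> \<epsilon> * c0 / 2 * (v / S)"
        using elim(1)[rule_format, of "\<lambda>i. x (Suc i)" "\<lambda>i. z (Suc i)" "z 1 / sqrt n"] xb zb yb v S
          vandermonde_pos[OF x(1)] vandermonde_pos[OF z(1)]
        unfolding dd v_def vandermonde_eq L_def lead_factor_def S_def
        by (simp add: abs_mult[symmetric] mult_ac)
      also have "\<dots> = (\<epsilon> / 2) * v * (c0 / S)" by simp
      also have "\<dots> \<le> (\<epsilon> / 2) * v * L" using L(1) S e v by (intro mult_left_mono) (auto simp: pos_divide_le_eq)
      also have "\<dots> < \<epsilon> * (v * L)" using e v L(2) by simp
      finally have "\<bar>det_interlacing d n x (add_drift d n z) - v * L\<bar> / (v * L) < \<epsilon>"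
        using v L(2) by (simp add: pos_divide_less_eq)
      moreover have "det_interlacing d n x (add_drift d n z) / (v * L) - 1 = (det_interlacing d n x (add_drift d n z) - v * L) / (v * L)"
        using v L(2) by (simp add: diff_divide_distrib)
      ultimately show "\<bar>det_interlacing d n x (add_drift d n z) / (vandermonde d x * vandermonde d z * lead_factor d n z) - 1\<bar> < \<epsilon>"
        using v L(2) unfolding v_def[symmetric] L_def[symmetric] by (simp add: abs_divide)
    qed
  qed
qed


lemma reversed_vandermonde:
  fixes d :: nat and z \<eta> :: "nat \<Rightarrow> real"
  defines "zr \<equiv> \<lambda>j\<in>{1..d}. - z (d + 1 - j)"
  shows "(\<Prod>i<d. \<Prod>j<i. (z (Suc i) - \<eta> (d - i)) - (z (Suc j) - \<eta> (d - j))) =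
    (\<Prod>i<d. \<Prod>j<i. (zr (Suc i) + \<eta> (Suc i)) - (zr (Suc j) + \<eta> (Suc j)))"
proof -
  define F where "F i j = (zr (Suc i) + \<eta> (Suc i)) - (zr (Suc j) + \<eta> (Suc j))" for i j
  have "(z (Suc i) - \<eta> (d - i)) - (z (Suc j) - \<eta> (d - j)) = F (d - 1 - j) (d - 1 - i)" if "i < d" "j < i" for i j
    using that by (auto simp: F_def zr_def Suc_diff_Suc)
  then have "(\<Prod>i<d. \<Prod>j<i. (z (Suc i) - \<eta> (d - i)) - (z (Suc j) - \<eta> (d - j))) =
      (\<Prod>i<d. \<Prod>j<i. F (d - 1 - j) (d - 1 - i))"
    by (intro prod.cong) auto
  then show ?thesis unfolding prod_pairs_reverse unfolding F_def[abs_def] by (simp only:)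
qed

lemma reversed_in_weyl:
  assumes "z \<in> weyl d"
  shows "(\<lambda>j\<in>{1..d}. - z (d + 1 - j)) \<in> weyl d"
  unfolding weyl_def
proof (intro CollectI conjI ballI)
  fix j assume j: "j \<in> {1..<d}"
  have "z (d - j) \<le> z (Suc (d - j))" using assms j by (auto simp: weyl_def)
  then show "(\<lambda>j\<in>{1..d}. - z (d + 1 - j)) j \<le> (\<lambda>j\<in>{1..d}. - z (d + 1 - j)) (Suc j)"
    using j by (auto simp: Suc_diff_le)
qed auto

lemma one_le_prod_gaps:
  assumes "x \<in> weyl d"
  shows "1 \<le> (\<Prod>i<d. \<Prod>j<i. 1 + x (Suc i) - x (Suc j))"
proof (intro prod_ge_1)
  fix i j assume "i \<in> {..<d}" "j \<in> {..<i}"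
  then show "1 \<le> 1 + x (Suc i) - x (Suc j)" using weyl_mono[OF assms, of "Suc j" "Suc i"] by auto
qed

text \<open>
  The error of the kernel asymptotics, made integrable. As long as all displacements are at most
  \<open>r = n ^ (1/4)\<close>, the asymptotics applies. Otherwise the weights satisfy \<open>eta_size d \<eta> * eta_size d \<eta>' \<ge> r\<close>,
  and the trivial bound \<open>fact d\<close> for the determinant is affordable after multiplication with
  \<open>(eta_size d \<eta> * eta_size d \<eta>' / r) ^ (4 * d * d)\<close>, whose denominator is \<open>S\<^sup>2\<close>.
\<close>

lemma shifted_det_error:
  fixes d n :: nat and x z \<eta> \<eta>' :: "nat \<Rightarrow> real" and e L :: real
  defines "zr \<equiv> \<lambda>j\<in>{1..d}. - z (d + 1 - j)"
  defines "S \<equiv> sqrt n ^ (d * d)" and "r \<equiv> sqrt (sqrt n)"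
  defines "U \<equiv> \<lambda>x \<eta>. \<Prod>i<d. \<Prod>j<i. (x (Suc i) + \<eta> (Suc i)) - (x (Suc j) + \<eta> (Suc j))"
  defines "Q \<equiv> \<lambda>x. \<Prod>i<d. \<Prod>j<i. 1 + x (Suc i) - x (Suc j)"
  assumes n: "n > 0" and x: "x \<in> weyl d" and z: "z \<in> weyl d" and e: "0 \<le> e"
  assumes L: "0 < L" "L * S \<le> 1"
  assumes main: "(\<forall>j\<in>{1..d}. \<bar>\<eta> j\<bar> \<le> r) \<Longrightarrow> (\<forall>j\<in>{1..d}. \<bar>\<eta>' j\<bar> \<le> r) \<Longrightarrow>
    \<bar>shifted_det d n x z \<eta> \<eta>' - L * U x \<eta> * U zr \<eta>'\<bar> \<le> e * (\<bar>U x \<eta>\<bar> * \<bar>U zr \<eta>'\<bar> / S)"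
  shows "\<bar>shifted_det d n x z \<eta> \<eta>' - L * U x \<eta> * U zr \<eta>'\<bar> \<le>
    Q x * Q zr / S * (e + (fact d + 1) / S) * (eta_size d \<eta> ^ (6 * d * d) * eta_size d \<eta>' ^ (6 * d * d))"
proof -
  define B B' where "B = eta_size d \<eta>" and "B' = eta_size d \<eta>'"
  have B: "1 \<le> B" "1 \<le> B'" unfolding B_def B'_def by (rule eta_size_ge_1)+
  have BB: "1 \<le> B * B'" using mult_mono[OF B] B by simp
  have n1: "1 \<le> sqrt n" using n by simp
  have S: "1 \<le> S" unfolding S_def by (rule one_le_power[OF n1])
  have zr: "zr \<in> weyl d" unfolding zr_def by (rule reversed_in_weyl[OF z])
  have Qx: "1 \<le> Q x" unfolding Q_def by (rule one_le_prod_gaps[OF x])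
  have Qz: "1 \<le> Q zr" unfolding Q_def by (rule one_le_prod_gaps[OF zr])
  have Q1: "1 \<le> Q x * Q zr" using mult_mono[OF Qx Qz] Qx by simp
  have u1: "\<bar>U x \<eta>\<bar> \<le> Q x * B ^ (2 * d * d)" unfolding U_def Q_def B_def
    by (rule abs_vandermonde_eta_le) (use weyl_mono[OF x] in auto)
  have u2: "\<bar>U zr \<eta>'\<bar> \<le> Q zr * B' ^ (2 * d * d)" unfolding U_def Q_def B'_def
    by (rule abs_vandermonde_eta_le) (use weyl_mono[OF zr] in auto)
  have UU: "\<bar>U x \<eta>\<bar> * \<bar>U zr \<eta>'\<bar> \<le> (Q x * Q zr) * (B * B') ^ (2 * d * d)"
  proof -
    have "\<bar>U x \<eta>\<bar> * \<bar>U zr \<eta>'\<bar> \<le> (Q x * B ^ (2 * d * d)) * (Q zr * B' ^ (2 * d * d))"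
      using u1 u2 Qx B by (intro mult_mono) auto
    then show ?thesis by (simp add: power_mult_distrib mult_ac)
  qed
  have goal: "\<bar>shifted_det d n x z \<eta> \<eta>' - L * U x \<eta> * U zr \<eta>'\<bar> \<le>
    Q x * Q zr / S * (e + (fact d + 1) / S) * (B * B') ^ (6 * d * d)"
  proof (cases "(\<forall>j\<in>{1..d}. \<bar>\<eta> j\<bar> \<le> r) \<and> (\<forall>j\<in>{1..d}. \<bar>\<eta>' j\<bar> \<le> r)")
    case True
    then have "\<bar>shifted_det d n x z \<eta> \<eta>' - L * U x \<eta> * U zr \<eta>'\<bar> \<le> e * (\<bar>U x \<eta>\<bar> * \<bar>U zr \<eta>'\<bar> / S)"
      using main by blast
    also have "\<dots> \<le> e * ((Q x * Q zr) * (B * B') ^ (6 * d * d) / S)"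
    proof (intro mult_left_mono divide_right_mono order_trans[OF UU] power_increasing)
    qed (use e S BB Q1 in auto)
    also have "\<dots> = Q x * Q zr / S * e * (B * B') ^ (6 * d * d)" by simp
    also have "\<dots> \<le> Q x * Q zr / S * (e + (fact d + 1) / S) * (B * B') ^ (6 * d * d)"
      using S Q1 B by (intro mult_right_mono mult_left_mono) auto
    finally show ?thesis .
  next
    case False
    have rpos: "r > 0" using n by (simp add: r_def)
    have "r \<le> B * B'"
    proof (cases "\<forall>j\<in>{1..d}. \<bar>\<eta> j\<bar> \<le> r")
      case True
      with False obtain j where j: "j \<in> {1..d}" "\<bar>\<eta>' j\<bar> > r" by force
      then have "r \<le> 1 * B'" using eta_size_ge[OF j(1), of \<eta>'] by (simp add: B'_def)
      also have "\<dots> \<le> B * B'" using B by (intro mult_right_mono) auto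
      finally show ?thesis .
    next
      case False
      then obtain j where j: "j \<in> {1..d}" "\<bar>\<eta> j\<bar> > r" by force
      then have "r \<le> B * 1" using eta_size_ge[OF j(1), of \<eta>] by (simp add: B_def)
      also have "\<dots> \<le> B * B'" using B by (intro mult_left_mono) auto
      finally show ?thesis .
    qed
    then have "r ^ (4 * (d * d)) \<le> (B * B') ^ (4 * (d * d))" using rpos by (intro power_mono) auto
    moreover have "r ^ (4 * (d * d)) = S * S"
    proof -
      have "r ^ (4 * (d * d)) = ((r\<^sup>2) ^ (d * d))\<^sup>2" by (simp add: power_mult[symmetric] mult.commute mult.left_commute)
      also have "r\<^sup>2 = sqrt n" by (simp add: r_def)
      finally show ?thesis by (simp add: S_def power2_eq_square)
    qed
    ultimately have SS: "S * S \<le> (B * B') ^ (4 * (d * d))" by simp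
    have D: "\<bar>shifted_det d n x z \<eta> \<eta>'\<bar> \<le> fact d"
      unfolding shifted_det_def by (rule det_abs_le_fact) (simp add: gam_nonneg gam_le_1)
    have "\<bar>L * U x \<eta> * U zr \<eta>'\<bar> = L * (\<bar>U x \<eta>\<bar> * \<bar>U zr \<eta>'\<bar>)" using L by (simp add: abs_mult)
    also have "\<dots> \<le> 1 * ((Q x * Q zr) * (B * B') ^ (2 * d * d))"
    proof (rule mult_mono[OF _ UU])
      show "L \<le> 1"
        by (rule order_trans[OF mult_left_mono[OF S, of L, unfolded mult_1_right] L(2)]) (use L in simp)
    qed auto
    finally have LU: "\<bar>L * U x \<eta> * U zr \<eta>'\<bar> \<le> (Q x * Q zr) * (B * B') ^ (2 * d * d)" by simp
    have one: "1 \<le> (Q x * Q zr) * (B * B') ^ (2 * d * d)"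
      using mult_mono[OF Q1 one_le_power[OF BB, of "2 * d * d"]] Q1 by simp
    have "\<bar>shifted_det d n x z \<eta> \<eta>' - L * U x \<eta> * U zr \<eta>'\<bar> \<le> fact d + (Q x * Q zr) * (B * B') ^ (2 * d * d)"
      using D LU by linarith
    also have "\<dots> \<le> (fact d + 1) * ((Q x * Q zr) * (B * B') ^ (2 * d * d))"
      using mult_left_mono[OF one, of "fact d"] by (simp add: algebra_simps)
    also have "\<dots> = (fact d + 1) * ((Q x * Q zr) * (B * B') ^ (2 * d * d)) * (S * S) / (S * S)" using S by simp
    also have "\<dots> \<le> (fact d + 1) * ((Q x * Q zr) * (B * B') ^ (2 * d * d)) * (B * B') ^ (4 * (d * d)) / (S * S)"
      using SS S Q1 B by (intro divide_right_mono mult_left_mono) auto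
    also have "\<dots> = Q x * Q zr / S * (0 + (fact d + 1) / S) * ((B * B') ^ (2 * d * d) * (B * B') ^ (4 * (d * d)))"
      by simp
    also have "(B * B') ^ (2 * d * d) * (B * B') ^ (4 * (d * d)) = (B * B') ^ (6 * d * d)"
      by (simp add: power_add[symmetric] mult.assoc)
    also have "Q x * Q zr / S * (0 + (fact d + 1) / S) * (B * B') ^ (6 * d * d) \<le>
        Q x * Q zr / S * (e + (fact d + 1) / S) * (B * B') ^ (6 * d * d)"
      using S Q1 B e by (intro mult_right_mono mult_left_mono add_right_mono) auto
    finally show ?thesis .
  qed
  then show ?thesis unfolding B_def B'_def by (simp only: power_mult_distrib)
qed

lemma abs_integral_le_integral:
  fixes f g :: "'a \<Rightarrow> real"
  assumes "integrable M f" "integrable M g" "\<And>x. \<bar>f x\<bar> \<le> g x"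
  shows "\<bar>\<integral>x. f x \<partial>M\<bar> \<le> (\<integral>x. g x \<partial>M)"
proof (rule order_trans[OF integral_abs_bound])
  show "(\<integral>x. \<bar>f x\<bar> \<partial>M) \<le> (\<integral>x. g x \<partial>M)"
    by (rule integral_mono) (use assms in auto)
qed

text \<open>
  Integrating a pointwise estimate over both families of displacements turns the Vandermonde products
  into \<open>h\<close>.
\<close>

lemma det_ordered_error:
  fixes n :: nat and z :: "nat \<Rightarrow> real"
  assumes d: "1 \<le> d" "d \<le> n"
  assumes bound: "\<And>\<eta> \<eta>'. \<bar>shifted_det d n x z \<eta> \<eta>' -
      L * (\<Prod>i<d. \<Prod>j<i. (x (Suc i) + \<eta> (Suc i)) - (x (Suc j) + \<eta> (Suc j))) *
      (\<Prod>i<d. \<Prod>j<i. (w (Suc i) + \<eta>' (Suc i)) - (w (Suc j) + \<eta>' (Suc j)))\<bar>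
      \<le> K * (eta_size d \<eta> ^ q * eta_size d \<eta>' ^ q)"
  shows "\<bar>det_ordered d n x (add_drift d n z) - L * h d x * h d w\<bar> \<le> K * (\<integral>\<eta>. eta_size d \<eta> ^ q \<partial>eta_prod d)\<^sup>2"
proof -
  define U where "U x \<eta> = (\<Prod>i<d. \<Prod>j<i. (x (Suc i) + \<eta> (Suc i)) - (x (Suc j) + \<eta> (Suc j)))" for x \<eta> :: "nat \<Rightarrow> real"
  define M where "M = (\<integral>\<eta>. eta_size d \<eta> ^ q \<partial>eta_prod d)"
  let ?D = "shifted_det d n x z"
  have drift: "add_drift d n z j = real n + z j" if "j \<in> {1..d}" for j
    using that by (simp add: add_drift_def)
  note rep = det_ordered_eq_integral[OF d(2) drift d(1), where x = x]
  have hU: "h d y = (\<integral>\<eta>. U y \<eta> \<partial>eta_prod d)" for y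
    unfolding U_def by (rule h_eq_integral)
  have iU: "integrable (eta_prod d) (U y)" for y
    unfolding U_def[abs_def] by (rule integrable_vandermonde_eta)
  have iE: "integrable (eta_prod d) (\<lambda>\<eta>. eta_size d \<eta> ^ q)" by (rule integrable_eta_size_power)
  have inner: "\<bar>(\<integral>\<eta>. ?D \<eta> \<eta>' \<partial>eta_prod d) - L * h d x * U w \<eta>'\<bar> \<le> (K * M) * eta_size d \<eta>' ^ q" for \<eta>'
  proof -
    have i1: "integrable (eta_prod d) (\<lambda>\<eta>. ?D \<eta> \<eta>')" by (rule rep(1))
    have i2: "integrable (eta_prod d) (\<lambda>\<eta>. L * U x \<eta> * U w \<eta>')" by (intro integrable_mult_left integrable_mult_right iU)
    have "(\<integral>\<eta>. ?D \<eta> \<eta>' - L * U x \<eta> * U w \<eta>' \<partial>eta_prod d) = (\<integral>\<eta>. ?D \<eta> \<eta>' \<partial>eta_prod d) - L * h d x * U w \<eta>'"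
      using i1 i2 iU by (simp add: hU)
    moreover have "\<bar>\<integral>\<eta>. ?D \<eta> \<eta>' - L * U x \<eta> * U w \<eta>' \<partial>eta_prod d\<bar> \<le> (\<integral>\<eta>. K * (eta_size d \<eta> ^ q * eta_size d \<eta>' ^ q) \<partial>eta_prod d)"
    proof (rule abs_integral_le_integral)
      show "integrable (eta_prod d) (\<lambda>\<eta>. ?D \<eta> \<eta>' - L * U x \<eta> * U w \<eta>')" by (rule Bochner_Integration.integrable_diff[OF i1 i2])
      show "integrable (eta_prod d) (\<lambda>\<eta>. K * (eta_size d \<eta> ^ q * eta_size d \<eta>' ^ q))"
        by (intro integrable_mult_left integrable_mult_right iE)
    qed (use bound in \<open>simp add: U_def\<close>)
    moreover have "(\<integral>\<eta>. K * (eta_size d \<eta> ^ q * eta_size d \<eta>' ^ q) \<partial>eta_prod d) = (K * M) * eta_size d \<eta>' ^ q"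
      using iE by (simp add: M_def)
    ultimately show ?thesis by (simp only:)
  qed
  have i1: "integrable (eta_prod d) (\<lambda>\<eta>'. \<integral>\<eta>. ?D \<eta> \<eta>' \<partial>eta_prod d)" by (rule rep(2))
  have i2: "integrable (eta_prod d) (\<lambda>\<eta>'. L * h d x * U w \<eta>')" by (intro integrable_mult_right iU)
  have "(\<integral>\<eta>'. (\<integral>\<eta>. ?D \<eta> \<eta>' \<partial>eta_prod d) - L * h d x * U w \<eta>' \<partial>eta_prod d) = det_ordered d n x (add_drift d n z) - L * h d x * h d w"
  proof -
    have "det_ordered d n x (add_drift d n z) = (\<integral>\<eta>'. \<integral>\<eta>. ?D \<eta> \<eta>' \<partial>eta_prod d \<partial>eta_prod d)"
      by (rule rep(3))
    moreover have "(\<integral>\<eta>'. L * h d x * U w \<eta>' \<partial>eta_prod d) = L * h d x * h d w"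
      by (simp add: hU[of w])
    ultimately show ?thesis
      using Bochner_Integration.integral_diff[OF i1 i2] by (simp only:)
  qed
  moreover have "\<bar>\<integral>\<eta>'. (\<integral>\<eta>. ?D \<eta> \<eta>' \<partial>eta_prod d) - L * h d x * U w \<eta>' \<partial>eta_prod d\<bar> \<le> (\<integral>\<eta>'. (K * M) * eta_size d \<eta>' ^ q \<partial>eta_prod d)"
    by (rule abs_integral_le_integral) (use i1 i2 iE inner in auto)
  moreover have "(\<integral>\<eta>'. (K * M) * eta_size d \<eta>' ^ q \<partial>eta_prod d) = K * M\<^sup>2"
    using iE by (simp add: M_def power2_eq_square)
  ultimately show ?thesis unfolding M_def[symmetric] by (simp only:)
qed


text \<open>
  The averaged error is small in comparison with the product of all \<open>1 + x\<^sub>j - x\<^sub>i\<close> and the same product for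
  \<open>z\<close>. By the lower bound these products are at most a constant times \<open>h\<close> and its reflection, so
  that the error is small relative to the leading term.
\<close>

lemma det_ordered_asymp:
  assumes d: "1 \<le> d" and \<delta>: "\<And>n. 0 < \<delta> n" "\<delta> \<longlonglongrightarrow> 0"
  shows "ratio_tendsto_1_uniformly (region d (weyl d) \<delta> C)
    (\<lambda>n (x, z). det_ordered d n x (add_drift d n z))
    (\<lambda>n (x, z). h d x * h_hat d z * lead_factor d n z)"
  unfolding ratio_tendsto_1_uniformly_def
proof (intro allI impI)
  fix \<epsilon> :: real assume e: "\<epsilon> > 0"
  define M where "M = (\<integral>\<eta>. eta_size d \<eta> ^ (6 * d * d) \<partial>eta_prod d)"
  define c0 where "c0 = (exp (- C\<^sup>2 / 2) / sqrt (2 * pi)) ^ d / (\<Prod>i<d. fact i)"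
  define c1 where "c1 = exp (- (real d)\<^sup>2)"
  have c0: "c0 > 0" unfolding c0_def by (intro divide_pos_pos zero_less_power prod_pos) auto
  have c1: "c1 > 0" by (simp add: c1_def)
  \<comment> \<open>The precision needed in the kernel asymptotics, after the loss of the constants from the lower bounds
      for \<open>h\<close> and the Gaussian factor and of the moments \<open>M\<close>.\<close>
  define e0 where "e0 = \<epsilon> * (c1\<^sup>2 * c0) / (4 * (M\<^sup>2 + 1))"
  have M1: "M\<^sup>2 + 1 > 0" by (simp add: add_nonneg_pos)
  have e0: "e0 > 0" unfolding e0_def using e c0 c1 M1 by simp
  \<comment> \<open>Starting points and displacements together: \<open>2 * \<delta> n * sqrt n + n ^ (1/4) = \<rho> n * sqrt n\<close>.\<close>
  define \<rho> where "\<rho> n = 2 * \<delta> n + 1 / sqrt (sqrt (real n))" for n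
  have "(\<lambda>n. 1 / sqrt (sqrt (real n))) \<longlonglongrightarrow> 0" by real_asymp
  then have "\<rho> \<longlonglongrightarrow> 2 * 0 + 0" unfolding \<rho>_def[abs_def] by (intro tendsto_intros \<delta>)
  then have \<rho>: "\<rho> \<longlonglongrightarrow> 0" by simp
  have "(\<lambda>n. (fact d + 1) / sqrt (real n)) \<longlonglongrightarrow> 0" by real_asymp
  then have "\<forall>\<^sub>F n in sequentially. (fact d + 1) / sqrt (real n) < e0" using e0 by (rule order_tendstoD)
  then show "\<forall>\<^sub>F n in sequentially. \<forall>p\<in>region d (weyl d) \<delta> C n.
    \<bar>(case p of (x, z) \<Rightarrow> det_ordered d n x (add_drift d n z)) /
      (case p of (x, z) \<Rightarrow> h d x * h_hat d z * lead_factor d n z) - 1\<bar> < \<epsilon>"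
    using det_gam_asymp_uniform[OF \<rho> e0, of d C "d - 1"] eventually_ge_at_top[of d]
  proof eventually_elim
    case (elim n)
    then have n: "n > 0" "d \<le> n" using d by auto
    have s: "sqrt n > 0" using n by simp
    show ?case
    proof clarify
      fix x z assume "(x, z) \<in> region d (weyl d) \<delta> C n"
      then have x: "x \<in> weyl d" "x d - x 1 \<le> \<delta> n * sqrt n" "\<bar>x 1\<bar> \<le> \<delta> n * sqrt n"
        and z: "z \<in> weyl d" "z d - z 1 \<le> \<delta> n * sqrt n" "\<bar>z 1\<bar> \<le> C * sqrt n"
        by (auto simp: region_def)
      define zr where "zr = (\<lambda>j\<in>{1..d}. - z (d + 1 - j))"
      have zr: "zr \<in> weyl d" unfolding zr_def by (rule reversed_in_weyl[OF z(1)])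
      have hh: "h_hat d z = h d zr" by (simp add: h_hat_def zr_def)
      define S where "S = sqrt n ^ (d * d)"
      define L where "L = lead_factor d n z"
      define Q where "Q x = (\<Prod>i<d. \<Prod>j<i. 1 + x (Suc i) - x (Suc j))" for x :: "nat \<Rightarrow> real"
      define r where "r = sqrt (sqrt (real n))"
      have rr: "r = 1 / r * sqrt n" using n by (simp add: r_def real_div_sqrt)
      have n1: "1 \<le> sqrt n" using n by simp
      have S: "S > 0" "sqrt n \<le> S" using s n1 d self_le_power[OF n1, of "d * d"] by (auto simp: S_def)
      have L: "c0 \<le> L * S" "L * S \<le> 1" "L > 0"
        using lead_factor_bounds[of n z C d, OF n(1) z(3)] by (auto simp: L_def S_def c0_def)
      have yb: "\<bar>z 1 / sqrt n\<bar> \<le> C" using z(3) s by (simp add: abs_divide pos_divide_le_eq)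
      have err: "\<bar>shifted_det d n x z \<eta> \<eta>' -
          L * (\<Prod>i<d. \<Prod>j<i. (x (Suc i) + \<eta> (Suc i)) - (x (Suc j) + \<eta> (Suc j))) *
          (\<Prod>i<d. \<Prod>j<i. (zr (Suc i) + \<eta>' (Suc i)) - (zr (Suc j) + \<eta>' (Suc j)))\<bar>
        \<le> Q x * Q zr / S * (e0 + (fact d + 1) / S) * (eta_size d \<eta> ^ (6 * d * d) * eta_size d \<eta>' ^ (6 * d * d))" for \<eta> \<eta>'
        unfolding S_def Q_def zr_def
      proof (rule shifted_det_error)
        assume \<eta>: "\<forall>j\<in>{1..d}. \<bar>\<eta> j\<bar> \<le> sqrt (sqrt (real n))" "\<forall>j\<in>{1..d}. \<bar>\<eta>' j\<bar> \<le> sqrt (sqrt (real n))"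
        have \<rho>n: "\<rho> n * sqrt n = 2 * \<delta> n * sqrt n + r" using rr by (simp add: \<rho>_def r_def[symmetric] algebra_simps)
        have xb: "\<forall>i<d. \<bar>x (Suc i) + \<eta> (Suc i)\<bar> \<le> \<rho> n * sqrt n"
        proof (intro allI impI)
          fix i assume i: "i < d"
          then have "\<bar>x (Suc i)\<bar> \<le> 2 * \<delta> n * sqrt n"
            using weyl_mono[OF x(1), of 1 "Suc i"] weyl_mono[OF x(1), of "Suc i" d] x by auto
          moreover have "\<bar>\<eta> (Suc i)\<bar> \<le> r" using \<eta>(1) i by (auto simp: r_def)
          ultimately show "\<bar>x (Suc i) + \<eta> (Suc i)\<bar> \<le> \<rho> n * sqrt n" unfolding \<rho>n by linarith
        qed
        have zb: "\<forall>i<d. \<bar>(z (Suc i) - \<eta>' (d - i)) - z 1 / sqrt n * sqrt n\<bar> \<le> \<rho> n * sqrt n"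
        proof (intro allI impI)
          fix i assume i: "i < d"
          then have "\<bar>z (Suc i) - z 1\<bar> \<le> \<delta> n * sqrt n"
            using weyl_mono[OF z(1), of 1 "Suc i"] weyl_mono[OF z(1), of "Suc i" d] z by auto
          moreover have "\<bar>\<eta>' (d - i)\<bar> \<le> r" using \<eta>(2) i by (auto simp: r_def)
          moreover have "0 \<le> \<delta> n * sqrt n" using \<delta>(1)[of n] s by simp
          moreover have "z 1 / sqrt n * sqrt n = z 1" using s by simp
          ultimately show "\<bar>(z (Suc i) - \<eta>' (d - i)) - z 1 / sqrt n * sqrt n\<bar> \<le> \<rho> n * sqrt n"
            unfolding \<rho>n by linarith
        qed
        from elim(2)[rule_format, of "\<lambda>i. x (Suc i) + \<eta> (Suc i)" "\<lambda>i. z (Suc i) - \<eta>' (d - i)" "z 1 / sqrt n"] xb zb yb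
        have "\<bar>Determinant.det (Matrix.mat d d (\<lambda>(i, k). gam (n - (d - 1)) (real n + (z (Suc k) - \<eta>' (d - k)) - (x (Suc i) + \<eta> (Suc i)))))
            - (\<Prod>i<d. \<Prod>j<i. x (Suc i) + \<eta> (Suc i) - (x (Suc j) + \<eta> (Suc j))) * (\<Prod>i<d. \<Prod>j<i. z (Suc i) - \<eta>' (d - i) - (z (Suc j) - \<eta>' (d - j))) / sqrt n ^ (d * d) *
              ((exp (- (z 1 / sqrt n)\<^sup>2 / 2) / sqrt (2 * pi)) ^ d / (\<Prod>i<d. fact i))\<bar>
          \<le> e0 * (\<bar>\<Prod>i<d. \<Prod>j<i. x (Suc i) + \<eta> (Suc i) - (x (Suc j) + \<eta> (Suc j))\<bar> * \<bar>\<Prod>i<d. \<Prod>j<i. z (Suc i) - \<eta>' (d - i) - (z (Suc j) - \<eta>' (d - j))\<bar> / sqrt n ^ (d * d))"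
          by simp
        moreover have "V * W / T * (p / q) = (p / q / T) * V * W" for V W T p q :: real by (simp add: mult_ac)
        ultimately show "\<bar>shifted_det d n x z \<eta> \<eta>' -
          L * (\<Prod>i<d. \<Prod>j<i. x (Suc i) + \<eta> (Suc i) - (x (Suc j) + \<eta> (Suc j))) *
          (\<Prod>i<d. \<Prod>j<i. (\<lambda>j\<in>{1..d}. - z (d + 1 - j)) (Suc i) + \<eta>' (Suc i) - ((\<lambda>j\<in>{1..d}. - z (d + 1 - j)) (Suc j) + \<eta>' (Suc j)))\<bar>
          \<le> e0 * (\<bar>\<Prod>i<d. \<Prod>j<i. x (Suc i) + \<eta> (Suc i) - (x (Suc j) + \<eta> (Suc j))\<bar> *
            \<bar>\<Prod>i<d. \<Prod>j<i. (\<lambda>j\<in>{1..d}. - z (d + 1 - j)) (Suc i) + \<eta>' (Suc i) - ((\<lambda>j\<in>{1..d}. - z (d + 1 - j)) (Suc j) + \<eta>' (Suc j))\<bar> / sqrt n ^ (d * d))"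
          unfolding reversed_vandermonde[symmetric] shifted_det_def L_def lead_factor_def by (simp only:)
      qed (use n x z e0 L in \<open>auto simp: S_def\<close>)
      have E: "\<bar>det_ordered d n x (add_drift d n z) - L * h d x * h d zr\<bar> \<le>
          Q x * Q zr / S * (e0 + (fact d + 1) / S) * M\<^sup>2"
        unfolding M_def by (rule det_ordered_error[OF d n(2) err])
      have Q: "1 \<le> Q x" "1 \<le> Q zr" unfolding Q_def using one_le_prod_gaps x zr by auto
      have hb: "c1 * Q x \<le> h d x" "c1 * Q zr \<le> h d zr"
        unfolding c1_def Q_def using h_lower_bound x zr by auto
      define H where "H = h d x * h d zr"
      have H: "c1\<^sup>2 * (Q x * Q zr) \<le> H" "0 < H"
      proof -
        have "c1 * Q x * (c1 * Q zr) \<le> h d x * h d zr"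
          using hb Q c1 by (intro mult_mono) (auto intro: order_trans[OF _ hb(1)])
        then show "c1\<^sup>2 * (Q x * Q zr) \<le> H" by (simp add: H_def power2_eq_square mult_ac)
        moreover have "0 < c1\<^sup>2 * (Q x * Q zr)" using c1 Q by (intro mult_pos_pos) auto
        ultimately show "0 < H" by linarith
      qed
      have "(fact d + 1) / S \<le> (fact d + 1) / sqrt n" by (rule divide_left_mono[OF S(2)]) (simp, intro mult_pos_pos S s)
      then have T: "e0 + (fact d + 1) / S \<le> 2 * e0" using elim(1) by linarith
      have "\<bar>det_ordered d n x (add_drift d n z) - L * H\<bar> \<le> Q x * Q zr / S * (e0 + (fact d + 1) / S) * M\<^sup>2"
        using E by (simp add: H_def mult.assoc)
      also have "\<dots> \<le> Q x * Q zr / S * (2 * e0) * (M\<^sup>2 + 1)"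
        using T Q S e0 by (intro mult_mono mult_left_mono) auto
      also have "\<dots> = (\<epsilon> / 2) * (c1\<^sup>2 * (Q x * Q zr)) * (c0 / S)"
      proof -
        have "2 * (a / (4 * m)) * m = a / 2" if "m > 0" for a m :: real using that by simp
        from this[OF M1, of "\<epsilon> * (c1\<^sup>2 * c0)"] have "2 * e0 * (M\<^sup>2 + 1) = \<epsilon> * (c1\<^sup>2 * c0) / 2"
          unfolding e0_def .
        then show ?thesis by (simp only: mult.assoc) (simp add: mult_ac)
      qed
      also have "\<dots> \<le> (\<epsilon> / 2) * H * L"
      proof (intro mult_mono)
        show "c0 / S \<le> L" using L(1) S by (simp add: pos_divide_le_eq)
        show "0 \<le> c1\<^sup>2 * (Q x * Q zr)" using Q by (intro mult_nonneg_nonneg) auto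
      qed (use H e c0 S in auto)
      also have "\<dots> < \<epsilon> * (L * H)" using e H(2) L(3) by simp
      finally have "\<bar>det_ordered d n x (add_drift d n z) - L * H\<bar> / (L * H) < \<epsilon>"
        using H(2) L(3) by (simp add: pos_divide_less_eq)
      moreover have "det_ordered d n x (add_drift d n z) / (L * H) - 1 = (det_ordered d n x (add_drift d n z) - L * H) / (L * H)"
        using H(2) L(3) by (simp add: diff_divide_distrib)
      moreover have "h d x * h_hat d z * lead_factor d n z = L * H"
        by (simp add: hh H_def L_def)
      ultimately show "\<bar>det_ordered d n x (add_drift d n z) / (h d x * h_hat d z * lead_factor d n z) - 1\<bar> < \<epsilon>"
        using H(2) L(3) by (simp add: abs_divide)
    qed
  qed
qed

lemma add_drift_in_weyl: "z \<in> weyl d \<Longrightarrow> add_drift d n z \<in> weyl d"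
  by (auto simp: weyl_def add_drift_def)

lemma h_pos:
  assumes "x \<in> weyl d"
  shows "0 < h d x"
proof -
  have "0 < exp (- (real d)\<^sup>2) * (\<Prod>i<d. \<Prod>j<i. 1 + x (Suc i) - x (Suc j))"
    using one_le_prod_gaps[OF assms] by (intro mult_pos_pos) auto
  then show ?thesis using h_lower_bound[OF assms] by linarith
qed

text \<open>
  The common end of both relations: a version of the density may be exchanged for its determinant, and
  the leading factor for the Gaussian factor with all coordinates of \<open>z\<close>.
\<close>

lemma uniform_asymp_of_lead_factor:
  assumes d: "1 \<le> d" and D: "D \<subseteq> weyl d"
  assumes Phi: "\<And>x. x \<in> D \<Longrightarrow> \<Phi> x \<noteq> 0" and Psi: "\<And>z. z \<in> D \<Longrightarrow> \<Psi> z \<noteq> 0"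
  assumes F: "\<And>n x z. d \<le> n \<Longrightarrow> x \<in> D \<Longrightarrow> z \<in> D \<Longrightarrow> F n x z = F' n x z"
  assumes F': "\<And>\<delta> C. (\<And>n. 0 < \<delta> n) \<Longrightarrow> \<delta> \<longlonglongrightarrow> 0 \<Longrightarrow> ratio_tendsto_1_uniformly (region d D \<delta> C)
    (\<lambda>n (x, z). F' n x z) (\<lambda>n (x, z). \<Phi> x * \<Psi> z * lead_factor d n z)"
  shows "uniform_asymp d D F (\<lambda>n x z. chi d * \<Phi> x * \<Psi> z * gauss_factor d n z)"
  unfolding uniform_asymp_def
proof (intro allI impI)
  fix \<delta> :: "nat \<Rightarrow> real" and C :: real
  assume \<delta>: "\<forall>n. 0 < \<delta> n" "\<delta> \<longlonglongrightarrow> 0"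
  show "ratio_tendsto_1_uniformly (region d D \<delta> C) (\<lambda>n (x, z). F n x z)
    (\<lambda>n (x, z). chi d * \<Phi> x * \<Psi> z * gauss_factor d n z)"
  proof (rule ratio_tendsto_1_uniformly_trans[where b = "\<lambda>n (x, z). \<Phi> x * \<Psi> z * lead_factor d n z"])
    have "ratio_tendsto_1_uniformly (region d D \<delta> C)
      (\<lambda>n (x, z). F' n x z) (\<lambda>n (x, z). \<Phi> x * \<Psi> z * lead_factor d n z)"
      using \<delta> by (intro F') auto
    then show "ratio_tendsto_1_uniformly (region d D \<delta> C) (\<lambda>n (x, z). F n x z)
      (\<lambda>n (x, z). \<Phi> x * \<Psi> z * lead_factor d n z)"
      unfolding ratio_tendsto_1_uniformly_def
    proof (intro allI impI)
      fix \<epsilon> :: real assume *: "\<forall>\<epsilon>>0. \<forall>\<^sub>F n in sequentially. \<forall>p\<in>region d D \<delta> C n.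
        \<bar>(case p of (x, z) \<Rightarrow> F' n x z) / (case p of (x, z) \<Rightarrow> \<Phi> x * \<Psi> z * lead_factor d n z) - 1\<bar> < \<epsilon>" and "0 < \<epsilon>"
      from *[rule_format, OF \<open>0 < \<epsilon>\<close>] eventually_ge_at_top[of d]
      show "\<forall>\<^sub>F n in sequentially. \<forall>p\<in>region d D \<delta> C n.
        \<bar>(case p of (x, z) \<Rightarrow> F n x z) / (case p of (x, z) \<Rightarrow> \<Phi> x * \<Psi> z * lead_factor d n z) - 1\<bar> < \<epsilon>"
        by eventually_elim (use F in \<open>auto simp: region_def\<close>)
    qed
    show "ratio_tendsto_1_uniformly (region d D \<delta> C) (\<lambda>n (x, z). \<Phi> x * \<Psi> z * lead_factor d n z)
      (\<lambda>n (x, z). chi d * \<Phi> x * \<Psi> z * gauss_factor d n z)"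
      unfolding ratio_tendsto_1_uniformly_def
    proof (intro allI impI)
      fix \<epsilon> :: real assume "0 < \<epsilon>"
      from lead_factor_ratio[of \<delta> d \<epsilon> D C] \<delta> d this D
      have "\<forall>\<^sub>F n in sequentially. \<forall>(x, z)\<in>region d D \<delta> C n. \<bar>lead_factor d n z / (chi d * gauss_factor d n z) - 1\<bar> < \<epsilon>"
        by blast
      then show "\<forall>\<^sub>F n in sequentially. \<forall>p\<in>region d D \<delta> C n.
        \<bar>(case p of (x, z) \<Rightarrow> \<Phi> x * \<Psi> z * lead_factor d n z) / (case p of (x, z) \<Rightarrow> chi d * \<Phi> x * \<Psi> z * gauss_factor d n z) - 1\<bar> < \<epsilon>"
      proof eventually_elim
        case (elim n)
        show ?case
        proof clarify
          fix x z assume xz: "(x, z) \<in> region d D \<delta> C n"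
          then have "\<Phi> x \<noteq> 0" "\<Psi> z \<noteq> 0" using Phi Psi by (auto simp: region_def)
          then have "\<Phi> x * \<Psi> z * lead_factor d n z / (chi d * \<Phi> x * \<Psi> z * gauss_factor d n z) =
            lead_factor d n z / (chi d * gauss_factor d n z)" by simp
          then show "\<bar>\<Phi> x * \<Psi> z * lead_factor d n z / (chi d * \<Phi> x * \<Psi> z * gauss_factor d n z) - 1\<bar> < \<epsilon>"
            using elim xz by auto
        qed
      qed
    qed
  qed
qed



theorem theorem18:
  fixes d :: nat
    and P :: "'w measure"
    and X :: "nat \<Rightarrow> nat \<Rightarrow> 'w \<Rightarrow> real"
    and G Gt :: "nat \<Rightarrow> (nat \<Rightarrow> real) \<Rightarrow> (nat \<Rightarrow> real) \<Rightarrow> real"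
  assumes "d \<ge> 1"
    and "prob_space P"
    and "prob_space.indep_vars P (\<lambda>_. borel) (\<lambda>(i, j). X i j) ({1..} \<times> {1..d})"
    and "\<And>i j. 1 \<le> i \<Longrightarrow> j \<in> {1..d} \<Longrightarrow> distributed P lborel (X i j) (exponential_density 1)"
    and "\<And>n x. 1 \<le> n \<Longrightarrow> x \<in> weyl d \<Longrightarrow>
      killed_density d P (walk d X x) (noninterlacing_time d (walk d X x)) n (Gt n x)"
    and "\<And>n x z. 1 \<le> n \<Longrightarrow> x \<in> weyl d \<Longrightarrow> z \<in> weyl d \<Longrightarrow> Gt n x z = det_interlacing d n x z"
    and "\<And>n x. 1 \<le> n \<Longrightarrow> x \<in> weyl d \<Longrightarrow>
      killed_density d P (walk d X x) (exit_time d (walk d X x)) n (G n x)"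
    and "\<And>n x z. d \<le> n \<Longrightarrow> x \<in> weyl d \<Longrightarrow> z \<in> weyl d \<Longrightarrow> G n x z = det_ordered d n x z"
  shows "uniform_asymp d (int_weyl d)
           (\<lambda>n x z. Gt n x (add_drift d n z))
           (\<lambda>n x z. chi d * vandermonde d x * vandermonde d z * gauss_factor d n z)
       \<and> uniform_asymp d (weyl d)
           (\<lambda>n x z. G n x (add_drift d n z))
           (\<lambda>n x z. chi d * h d x * h_hat d z * gauss_factor d n z)"
proof
  note d = \<open>d \<ge> 1\<close>
  show "uniform_asymp d (int_weyl d)
           (\<lambda>n x z. Gt n x (add_drift d n z))
           (\<lambda>n x z. chi d * vandermonde d x * vandermonde d z * gauss_factor d n z)"
  proof (rule uniform_asymp_of_lead_factor[OF d int_weyl_subset])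
    fix n x z assume *: "d \<le> n" "x \<in> int_weyl d" "z \<in> int_weyl d"
    then have "x \<in> weyl d" "z \<in> weyl d" using int_weyl_subset by blast+
    moreover have "1 \<le> n" using * d by simp
    ultimately show "Gt n x (add_drift d n z) = det_interlacing d n x (add_drift d n z)"
      using assms(6) add_drift_in_weyl by blast
  next
    show "vandermonde d x \<noteq> 0" if "x \<in> int_weyl d" for x using vandermonde_pos[OF that] by simp
    show "vandermonde d z \<noteq> 0" if "z \<in> int_weyl d" for z using vandermonde_pos[OF that] by simp
  qed (rule det_interlacing_asymp[OF d])
  show "uniform_asymp d (weyl d)
           (\<lambda>n x z. G n x (add_drift d n z))
           (\<lambda>n x z. chi d * h d x * h_hat d z * gauss_factor d n z)"
  proof (rule uniform_asymp_of_lead_factor[OF d order_refl])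
    fix n x z assume *: "d \<le> n" "x \<in> weyl d" "z \<in> weyl d"
    then show "G n x (add_drift d n z) = det_ordered d n x (add_drift d n z)"
      using assms(8) add_drift_in_weyl by blast
  next
    show "h d x \<noteq> 0" if "x \<in> weyl d" for x using h_pos[OF that] by simp
    show "h_hat d z \<noteq> 0" if "z \<in> weyl d" for z
      using h_pos[OF reversed_in_weyl[OF that]] by (simp add: h_hat_def)
  qed (rule det_ordered_asymp[OF d])
qed

end
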